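(* The Exact Cover problem is $\mathbb{NP}$-complete for $\alpha$-acyclic hypergraphs and solvable in polynomial time for hypertrees.
   Context: A hypergraph $H=(V,\mathcal{E})$ has a finite vertex set $V$ and a (multi)set $\mathcal{E}$ of subsets of $V$. A subset $\mathcal{E}'\subseteq\mathcal{E}$ is an exact cover of $H$ if its members are pairwise disjoint and $\bigcup\mathcal{E}'=V$; the Exact Cover problem asks whether $H$ has an exact cover. A join tree of $H$ is a tree $T$ with node set $\mathcal{E}$ such that for every $v\in V$ the hyperedges containing $v$ induce a subtree of $T$; $H$ is $\alpha$-acyclic if it has a join tree. $H$ is a hypertree if there is a tree $T$ with vertex set $V$ such that for every $e\in\mathcal{E}$ the induced subgraph $T[e]$ is connected. *)

theory Defs
  imports
    "HOL-Computational_Algebra.Polynomial"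
    "HOL-Library.Disjoint_Sets"
begin

section \<open>Trees\<close>

text \<open>
  A finite simple undirected graph is given by a vertex set \<open>N\<close> and a set \<open>F\<close> of two-element
  subsets of \<open>N\<close>. The notion of a tree in the AFP entry Graph Theory forbids directed cycles only, and it
  counts an edge together with its reversal as a cycle, so it does not give undirected trees.
  The empty graph counts as connected; in particular it is a (sub)tree.
\<close>

definition is_graph :: "'a set \<Rightarrow> 'a set set \<Rightarrow> bool" where
  "is_graph N F \<longleftrightarrow> finite N \<and> (\<forall>f\<in>F. f \<subseteq> N \<and> card f = 2)"

definition connected_graph :: "'a set \<Rightarrow> 'a set set \<Rightarrow> bool" where
  "connected_graph N F \<longleftrightarrow> (\<forall>u\<in>N. \<forall>v\<in>N. (u, v) \<in> {(a, b). {a, b} \<in> F}\<^sup>*)"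

definition is_cycle :: "'a set set \<Rightarrow> 'a list \<Rightarrow> bool" where
  "is_cycle F c \<longleftrightarrow> 3 \<le> length c \<and> distinct c \<and>
     (\<forall>i<length c. {c ! i, c ! (Suc i mod length c)} \<in> F)"

definition is_tree :: "'a set \<Rightarrow> 'a set set \<Rightarrow> bool" where
  "is_tree N F \<longleftrightarrow> is_graph N F \<and> connected_graph N F \<and> (\<nexists>c. is_cycle F c)"

definition induced_edges :: "'a set set \<Rightarrow> 'a set \<Rightarrow> 'a set set" where
  "induced_edges F W = {f \<in> F. f \<subseteq> W}"

section \<open>Hypergraphs\<close>

text \<open>
  The multiset of hyperedges is represented by a list; its positions serve to tell
  apart several copies of one hyperedge.
\<close>

record 'v hypergraph =
  vertices :: "'v set"
  hyperedges :: "'v set list"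

definition is_hypergraph :: "'v hypergraph \<Rightarrow> bool" where
  "is_hypergraph H \<longleftrightarrow> finite (vertices H) \<and> (\<forall>e\<in>set (hyperedges H). e \<subseteq> vertices H)"

definition edge_indices :: "'v hypergraph \<Rightarrow> nat set" where
  "edge_indices H = {..<length (hyperedges H)}"

definition exact_cover :: "'v hypergraph \<Rightarrow> nat set \<Rightarrow> bool" where
  "exact_cover H I \<longleftrightarrow> I \<subseteq> edge_indices H \<and>
     disjoint_family_on (\<lambda>i. hyperedges H ! i) I \<and>
     (\<Union>i\<in>I. hyperedges H ! i) = vertices H"

definition has_exact_cover :: "'v hypergraph \<Rightarrow> bool" where
  "has_exact_cover H \<longleftrightarrow> (\<exists>I. exact_cover H I)"

definition join_tree :: "'v hypergraph \<Rightarrow> nat set set \<Rightarrow> bool" where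
  "join_tree H F \<longleftrightarrow> is_tree (edge_indices H) F \<and>
     (\<forall>v\<in>vertices H. let W = {i \<in> edge_indices H. v \<in> hyperedges H ! i}
                     in is_tree W (induced_edges F W))"

definition alpha_acyclic :: "'v hypergraph \<Rightarrow> bool" where
  "alpha_acyclic H \<longleftrightarrow> (\<exists>F. join_tree H F)"

definition hypertree :: "'v hypergraph \<Rightarrow> bool" where
  "hypertree H \<longleftrightarrow> (\<exists>F. is_tree (vertices H) F \<and>
     (\<forall>e\<in>set (hyperedges H). connected_graph e (induced_edges F e)))"

section \<open>Multi-tape Turing machines\<close>

text \<open>
  States and tape symbols are initial segments of the natural numbers. Symbol \<open>0\<close> is the blank,
  symbols \<open>1\<close> and \<open>2\<close> stand for the bits. State \<open>0\<close> is the initial state and \<open>state_count M\<close> is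
  the halting state. Tapes are two-way infinite; a tape is paired with its head position.
  Tape \<open>0\<close> holds the input and tape \<open>1\<close> the output.
\<close>

datatype direction = Move_Left | Stay | Move_Right

record turing_machine =
  tape_count :: nat
  state_count :: nat
  symbol_count :: nat
  transition :: "nat \<Rightarrow> nat list \<Rightarrow> nat \<times> (nat \<times> direction) list"

definition is_turing_machine :: "turing_machine \<Rightarrow> bool" where
  "is_turing_machine M \<longleftrightarrow> 2 \<le> tape_count M \<and> 3 \<le> symbol_count M \<and>
     (\<forall>q<state_count M. \<forall>ss. length ss = tape_count M \<and> set ss \<subseteq> {..<symbol_count M} \<longrightarrow>
        (case transition M q ss of (q', as) \<Rightarrow>
           q' \<le> state_count M \<and> length as = tape_count M \<and> fst ` set as \<subseteq> {..<symbol_count M}))"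

type_synonym tape = "(int \<Rightarrow> nat) \<times> int"
type_synonym config = "nat \<times> tape list"

fun read_tape :: "tape \<Rightarrow> nat" where
  "read_tape (c, h) = c h"

fun shift :: "direction \<Rightarrow> int" where
  "shift Move_Left = -1"
| "shift Stay = 0"
| "shift Move_Right = 1"

fun act_tape :: "nat \<times> direction \<Rightarrow> tape \<Rightarrow> tape" where
  "act_tape (s, d) (c, h) = (c(h := s), h + shift d)"

fun tm_step :: "turing_machine \<Rightarrow> config \<Rightarrow> config" where
  "tm_step M (q, ts) =
     (if q = state_count M then (q, ts)
      else case transition M q (map read_tape ts) of (q', as) \<Rightarrow> (q', map2 act_tape as ts))"

definition bit_symbol :: "bool \<Rightarrow> nat" where
  "bit_symbol b = (if b then 2 else 1)"

definition word_tape :: "bool list \<Rightarrow> tape" where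
  "word_tape x =
     (\<lambda>i. if 0 \<le> i \<and> i < int (length x) then bit_symbol (x ! nat i) else 0, 0)"

definition tm_start :: "turing_machine \<Rightarrow> bool list \<Rightarrow> config" where
  "tm_start M x = (0, word_tape x # replicate (tape_count M - 1) (word_tape []))"

text \<open>The output is read from cell \<open>0\<close> of the output tape up to the first blank.\<close>

definition halted_with_output :: "turing_machine \<Rightarrow> config \<Rightarrow> bool list \<Rightarrow> bool" where
  "halted_with_output M C y \<longleftrightarrow> fst C = state_count M \<and>
     (\<forall>i<length y. fst (snd C ! 1) (int i) = bit_symbol (y ! i)) \<and>
     fst (snd C ! 1) (int (length y)) = 0"

section \<open>Polynomial time and NP-completeness\<close>

text \<open>
  The parameter \<open>D\<close> is the set of admissible inputs: nothing is required of the machine on words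
  outside of \<open>D\<close>.
\<close>

definition polytime_computable_on :: "bool list set \<Rightarrow> (bool list \<Rightarrow> bool list) \<Rightarrow> bool" where
  "polytime_computable_on D f \<longleftrightarrow>
     (\<exists>M (p :: nat poly). is_turing_machine M \<and>
        (\<forall>x\<in>D. \<exists>t \<le> poly p (length x).
           halted_with_output M ((tm_step M ^^ t) (tm_start M x)) (f x)))"

definition polytime_decidable_on :: "bool list set \<Rightarrow> bool list set \<Rightarrow> bool" where
  "polytime_decidable_on D L \<longleftrightarrow> polytime_computable_on D (\<lambda>x. [x \<in> L])"

definition pair_word :: "bool list \<Rightarrow> bool list \<Rightarrow> bool list" where
  "pair_word x y = concat (map (\<lambda>b. [True, b]) x) @ False # y"

definition NP :: "bool list set set" where
  "NP = {L. \<exists>R (p :: nat poly). polytime_decidable_on UNIV R \<and>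
          (\<forall>x. x \<in> L \<longleftrightarrow> (\<exists>y. length y \<le> poly p (length x) \<and> pair_word x y \<in> R))}"

text \<open>
  NP-completeness of the problem \<open>L\<close> restricted to the instance class \<open>D\<close>: the language of
  yes-instances in \<open>D\<close> belongs to NP, and each problem in NP has a polynomial-time many-one
  reduction to \<open>L\<close> all of whose values, also those on no-instances, lie in \<open>D\<close>.
\<close>

definition NP_complete_on :: "bool list set \<Rightarrow> bool list set \<Rightarrow> bool" where
  "NP_complete_on D L \<longleftrightarrow> D \<inter> L \<in> NP \<and>
     (\<forall>A\<in>NP. \<exists>f. polytime_computable_on UNIV f \<and> (\<forall>x. f x \<in> D \<and> (x \<in> A \<longleftrightarrow> f x \<in> L)))"

section \<open>Hypergraphs as problem instances\<close>

text \<open>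
  A hypergraph with vertex set \<open>{0, \<dots>, n - 1}\<close> is encoded by \<open>n\<close> in unary followed by the rows of
  its edge-vertex incidence matrix, each introduced by \<open>True\<close>, and a terminating \<open>False\<close>.
\<close>

definition standard_hypergraph :: "nat hypergraph \<Rightarrow> bool" where
  "standard_hypergraph H \<longleftrightarrow> is_hypergraph H \<and> (\<exists>n. vertices H = {..<n})"

definition encode_hypergraph :: "nat hypergraph \<Rightarrow> bool list" where
  "encode_hypergraph H = (let n = card (vertices H) in
     replicate n True @ [False] @
     concat (map (\<lambda>e. True # map (\<lambda>v. v \<in> e) [0..<n]) (hyperedges H)) @ [False])"

lemma replicate_True_False_eq:
  "replicate m True @ False # xs = replicate n True @ False # ys \<Longrightarrow> m = n \<and> xs = ys"
proof (induction m arbitrary: n)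
  case 0
  then show ?case by (cases n) auto
next
  case (Suc m)
  then show ?case by (cases n) auto
qed

lemma incidence_rows_eq:
  assumes "concat (map (\<lambda>e. True # map (\<lambda>v. v \<in> e) [0..<n]) es) @ [False] =
           concat (map (\<lambda>e. True # map (\<lambda>v. v \<in> e) [0..<n]) es') @ [False]"
    and "\<forall>e\<in>set es. e \<subseteq> {..<n}" and "\<forall>e\<in>set es'. e \<subseteq> {..<n}"
  shows "es = es'"
  using assms
proof (induction es arbitrary: es')
  case Nil
  then show ?case by (cases es') auto
next
  case (Cons e es)
  then obtain e' es'' where es': "es' = e' # es''"
    by (cases es') auto
  with Cons.prems have rows: "map (\<lambda>v. v \<in> e) [0..<n] = map (\<lambda>v. v \<in> e') [0..<n]"
    and rest: "concat (map (\<lambda>e. True # map (\<lambda>v. v \<in> e) [0..<n]) es) @ [False] =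
               concat (map (\<lambda>e. True # map (\<lambda>v. v \<in> e) [0..<n]) es'') @ [False]"
    by (simp_all add: append_eq_append_conv)
  from rows have "\<forall>v<n. v \<in> e \<longleftrightarrow> v \<in> e'"
    by simp
  with Cons.prems es' have "e = e'"
    by auto
  moreover have "es = es''"
    using Cons.IH[OF rest] Cons.prems es' by simp
  ultimately show ?case using es' by simp
qed

lemma inj_on_encode_hypergraph: "inj_on encode_hypergraph {H. standard_hypergraph H}"
proof (rule inj_onI, clarify)
  fix H H' :: "nat hypergraph"
  assume H: "standard_hypergraph H" and H': "standard_hypergraph H'"
    and eq: "encode_hypergraph H = encode_hypergraph H'"
  obtain n where n: "vertices H = {..<n}" using H by (auto simp: standard_hypergraph_def)
  obtain n' where n': "vertices H' = {..<n'}" using H' by (auto simp: standard_hypergraph_def)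
  from eq have "replicate n True @ False #
      (concat (map (\<lambda>e. True # map (\<lambda>v. v \<in> e) [0..<n]) (hyperedges H)) @ [False]) =
    replicate n' True @ False #
      (concat (map (\<lambda>e. True # map (\<lambda>v. v \<in> e) [0..<n']) (hyperedges H')) @ [False])"
    by (simp add: encode_hypergraph_def n n')
  then have "n = n'"
    by (blast dest: replicate_True_False_eq)
  then have "hyperedges H = hyperedges H'"
    using incidence_rows_eq[of n "hyperedges H" "hyperedges H'"] eq H H' n n'
    by (simp add: encode_hypergraph_def standard_hypergraph_def is_hypergraph_def)
  with \<open>n = n'\<close> n n' show "H = H'" by simp
qed

definition hypergraph_words :: "(nat hypergraph \<Rightarrow> bool) \<Rightarrow> bool list set" where
  "hypergraph_words P = {encode_hypergraph H | H. standard_hypergraph H \<and> P H}"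

definition EXACT_COVER :: "bool list set" where
  "EXACT_COVER = hypergraph_words has_exact_cover"

end

theory Submission
  imports Defs
begin

text \<open>
  Polynomial time is established through a small language of counting expressions over the input word
  (bounded sums, comparison, access to single bits), which compile to multi-tape machines whose further
  tapes act as counters. Whatever is first-order definable with bounded quantifiers is thus computable in
  polynomial time, and so is the iteration of a length-preserving definable map.

  For hypertrees, an exact cover is a choice of a hyperedge at every vertex that is consistent along the
  edges of the underlying tree. Deleting hyperedges until arc consistency holds between all pairs of
  vertices therefore decides the problem, without knowledge of the tree.

  For hardness, a nondeterministic computation becomes an exact cover problem over coloured slots: of the
  two hyperedges meeting a slot, one contains all colours but \<open>b\<close>, the other one contains \<open>b\<close> only, so that
  the colour is handed over from the one to the other. Two additional vertices and two additional
  hyperedges, one of which contains almost everything but can never be used, make any hypergraph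
  \<open>\<alpha>\<close>-acyclic.
\<close>

section \<open>Structured programs for Turing machines\<close>

text \<open>\<open>polytime_computable_on\<close> asks for concrete machines, so one compiler serves
  the NP verifier, the decision procedure and the reduction alike; each of them is then only a
  definable formula. Unary counters suffice because every value of a fixed expression is polynomial
  in the input length and the values of its variables. Arc consistency deletes whole hyperedges, so
  the survivors still induce subtrees, and \<open>length x\<close> rounds exceed the number of
  hyperedges, which forces stability. For hardness, relative coordinates spare any guess of head
  positions: a transition acts at position \<open>2 * T\<close> and all other cells merely shift. A
  head stays within \<open>T\<close> of its origin, so the window, from \<open>0\<close> to
  \<open>4 * T\<close> at first and losing one cell per side and step, still contains absolute cell
  \<open>0\<close> at time \<open>T\<close>. At least three colours are required because two
  hyperedges that each miss one colour then still overlap; this is what forces a produced colour to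
  be consumed. The machine being deterministic, every cover replays its run on the guessed bits, by
  induction on time.\<close>

datatype prog = Mv nat direction | Wr nat nat | Seq prog prog | If nat nat prog prog | Wh nat nat prog

fun states :: "prog \<Rightarrow> nat" where
  "states (Mv j d) = 1"
| "states (Wr j a) = 1"
| "states (Seq p r) = states p + states r"
| "states (If j a p r) = 1 + states p + states r"
| "states (Wh j a p) = 1 + states p"

fun prog_ok :: "nat \<Rightarrow> prog \<Rightarrow> bool" where
  "prog_ok k (Mv j d) = (j < k)"
| "prog_ok k (Wr j a) = (j < k \<and> a < 3)"
| "prog_ok k (Seq p r) = (prog_ok k p \<and> prog_ok k r)"
| "prog_ok k (If j a p r) = (j < k \<and> prog_ok k p \<and> prog_ok k r)"
| "prog_ok k (Wh j a p) = (j < k \<and> prog_ok k p)"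

definition idle :: "nat list \<Rightarrow> (nat \<times> direction) list" where
  "idle ss = map (\<lambda>s. (s, Stay)) ss"

text \<open>The program occupies the states from \<open>b\<close> on and continues in state \<open>x\<close>.\<close>

fun code :: "prog \<Rightarrow> nat \<Rightarrow> nat \<Rightarrow> nat \<Rightarrow> nat list \<Rightarrow> nat \<times> (nat \<times> direction) list" where
  "code (Mv j d) b x q ss = (x, (idle ss)[j := (ss ! j, d)])"
| "code (Wr j a) b x q ss = (x, (idle ss)[j := (a, Stay)])"
| "code (Seq p r) b x q ss =
     (if q < b + states p then code p b (b + states p) q ss else code r (b + states p) x q ss)"
| "code (If j a p r) b x q ss =
     (if q = b then (if ss ! j = a then Suc b else Suc b + states p, idle ss)
      else if q < Suc b + states p then code p (Suc b) x q ss
      else code r (Suc b + states p) x q ss)"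
| "code (Wh j a p) b x q ss =
     (if q = b then (if ss ! j = a then x else Suc b, idle ss) else code p (Suc b) b q ss)"

text \<open>The time is an exact step count, since \<open>exec_compiled\<close> turns it into a
  power of \<open>tm_step\<close>. A test costs a step of its own, and \<open>Wh j a p\<close>
  repeats \<open>p\<close> until tape \<open>j\<close> shows \<open>a\<close>.\<close>

inductive exec :: "prog \<Rightarrow> (nat \<Rightarrow> tape) \<Rightarrow> nat \<Rightarrow> (nat \<Rightarrow> tape) \<Rightarrow> bool" where
  Mv: "exec (Mv j d) s 1 (s(j := (fst (s j), snd (s j) + shift d)))"
| Wr: "exec (Wr j a) s 1 (s(j := ((fst (s j))(snd (s j) := a), snd (s j))))"
| Seq: "exec p s m s1 \<Longrightarrow> exec r s1 n s2 \<Longrightarrow> exec (Seq p r) s (m + n) s2"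
| IfT: "read_tape (s j) = a \<Longrightarrow> exec p s n s' \<Longrightarrow> exec (If j a p r) s (Suc n) s'"
| IfF: "read_tape (s j) \<noteq> a \<Longrightarrow> exec r s n s' \<Longrightarrow> exec (If j a p r) s (Suc n) s'"
| WhE: "read_tape (s j) = a \<Longrightarrow> exec (Wh j a p) s 1 s"
| WhS: "read_tape (s j) \<noteq> a \<Longrightarrow> exec p s m s1 \<Longrightarrow> exec (Wh j a p) s1 n s2 \<Longrightarrow>
    exec (Wh j a p) s (Suc (m + n)) s2"

lemma states_pos: "0 < states p"
  by (induction p) auto

lemma code_bounds:
  assumes "b \<le> q" "q < b + states p" "prog_ok (length ss) p" "set ss \<subseteq> {..<3}"
  shows "(fst (code p b x q ss) = x \<or> b \<le> fst (code p b x q ss) \<and> fst (code p b x q ss) < b + states p)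
    \<and> length (snd (code p b x q ss)) = length ss \<and> fst ` set (snd (code p b x q ss)) \<subseteq> {..<3}"
  using assms
proof (induction p arbitrary: b x)
  case (Mv j d)
  then have "ss ! j < 3"
    by (auto simp: subset_iff)
  with Mv show ?case
    by (auto simp: idle_def image_iff dest!: set_update_subset_insert[THEN subsetD])
next
  case (Wr j a)
  then show ?case
    by (auto simp: idle_def image_iff dest!: set_update_subset_insert[THEN subsetD])
next
  case (Seq p r)
  show ?case
    using Seq.IH(1)[of b "b + states p"] Seq.IH(2)[of "b + states p" x] Seq.prems states_pos[of r]
    by (cases "q < b + states p") auto
next
  case (If j a p r)
  show ?case
    using If.IH(1)[of "Suc b" x] If.IH(2)[of "Suc b + states p" x] If.prems states_pos[of r] states_pos[of p]
    by (cases "q = b"; cases "q < Suc b + states p") (auto simp: idle_def image_iff)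
next
  case (Wh j a p)
  show ?case
    using Wh.IH[of "Suc b" b] Wh.prems states_pos[of p]
    by (cases "q = b") (auto simp: idle_def image_iff)
qed

text \<open>\<open>M\<close> contains \<open>p\<close> as a block; the rest of the table is left
  open, so that the property passes to subprograms.\<close>

definition compiled :: "turing_machine \<Rightarrow> prog \<Rightarrow> nat \<Rightarrow> nat \<Rightarrow> bool" where
  "compiled M p b x \<longleftrightarrow> prog_ok (tape_count M) p \<and> b + states p \<le> state_count M \<and>
     (\<forall>q ss. b \<le> q \<longrightarrow> q < b + states p \<longrightarrow> transition M q ss = code p b x q ss)"

lemma map2_idle: "length ss = length ts \<Longrightarrow> map read_tape ts = ss \<Longrightarrow> map2 act_tape (idle ss) ts = ts"
proof (rule nth_equalityI)
  fix i assume "length ss = length ts" "map read_tape ts = ss" "i < length (map2 act_tape (idle ss) ts)"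
  then show "map2 act_tape (idle ss) ts ! i = ts ! i"
    by (cases "ts ! i") (auto simp: idle_def)
qed (simp add: idle_def)

lemma step_test:
  assumes "q < state_count M" "transition M q (map (read_tape \<circ> s) [0..<k]) = (q', idle (map (read_tape \<circ> s) [0..<k]))"
  shows "tm_step M (q, map s [0..<k]) = (q', map s [0..<k])"
  using assms by (simp add: map2_idle)

lemma step_update:
  assumes "q < state_count M" "j < k"
    "transition M q (map (read_tape \<circ> s) [0..<k]) = (q', (idle (map (read_tape \<circ> s) [0..<k]))[j := (a, d)])"
  shows "tm_step M (q, map s [0..<k]) = (q', map (s(j := ((fst (s j))(snd (s j) := a), snd (s j) + shift d))) [0..<k])"
proof -
  have "map2 act_tape ((idle (map (read_tape \<circ> s) [0..<k]))[j := (a, d)]) (map s [0..<k]) =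
    map (s(j := ((fst (s j))(snd (s j) := a), snd (s j) + shift d))) [0..<k]"
  proof (rule nth_equalityI)
    fix i assume "i < length (map2 act_tape ((idle (map (read_tape \<circ> s) [0..<k]))[j := (a, d)]) (map s [0..<k]))"
    then have "i < k" by (simp add: idle_def)
    then show "map2 act_tape ((idle (map (read_tape \<circ> s) [0..<k]))[j := (a, d)]) (map s [0..<k]) ! i =
      map (s(j := ((fst (s j))(snd (s j) := a), snd (s j) + shift d))) [0..<k] ! i"
      by (cases "s i") (auto simp: idle_def nth_list_update)
  qed (simp add: idle_def)
  with assms show ?thesis by simp
qed

text \<open>Induction on the execution with \<open>b\<close> and \<open>x\<close> general: a loop
  body starts in state \<open>Suc b\<close> and exits to the test in state \<open>b\<close>.\<close>

lemma exec_compiled: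
  assumes "exec p s n s'" "compiled M p b x"
  shows "(tm_step M ^^ n) (b, map s [0..<tape_count M]) = (x, map s' [0..<tape_count M])"
  using assms
proof (induction arbitrary: b x)
  case (Mv j d s)
  then have j: "j < tape_count M" by (simp add: compiled_def)
  have "tm_step M (b, map s [0..<tape_count M]) =
     (x, map (s(j := ((fst (s j))(snd (s j) := read_tape (s j)), snd (s j) + shift d))) [0..<tape_count M])"
    by (rule step_update) (use Mv j in \<open>auto simp: compiled_def\<close>)
  then show ?case by (cases "s j") simp
next
  case (Wr j a s)
  then have j: "j < tape_count M" by (simp add: compiled_def)
  have "tm_step M (b, map s [0..<tape_count M]) =
     (x, map (s(j := ((fst (s j))(snd (s j) := a), snd (s j) + shift Stay))) [0..<tape_count M])"
    by (rule step_update) (use Wr j in \<open>auto simp: compiled_def\<close>)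
  then show ?case by simp
next
  case (Seq p s m s1 r n s2)
  have "compiled M p b (b + states p)" "compiled M r (b + states p) x"
    using Seq.prems by (auto simp: compiled_def)
  from Seq.IH(1)[OF this(1)] Seq.IH(2)[OF this(2)] show ?case
    by (simp add: add.commute[of m n] funpow_add)
next
  case (IfT s j a p n s' r)
  have c: "compiled M p (Suc b) x"
    using IfT.prems by (auto simp: compiled_def)
  have "tm_step M (b, map s [0..<tape_count M]) = (Suc b, map s [0..<tape_count M])"
    by (rule step_test) (use IfT in \<open>auto simp: compiled_def\<close>)
  with IfT.IH[OF c] show ?case by (simp add: funpow_swap1 del: tm_step.simps)
next
  case (IfF s j a r n s' p)
  have c: "compiled M r (Suc b + states p) x"
    using IfF.prems by (auto simp: compiled_def)
  have "tm_step M (b, map s [0..<tape_count M]) = (Suc b + states p, map s [0..<tape_count M])"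
    by (rule step_test) (use IfF in \<open>auto simp: compiled_def\<close>)
  with IfF.IH[OF c] show ?case by (simp add: funpow_swap1 del: tm_step.simps)
next
  case (WhE s j a p)
  have "tm_step M (b, map s [0..<tape_count M]) = (x, map s [0..<tape_count M])"
    by (rule step_test) (use WhE in \<open>auto simp: compiled_def\<close>)
  then show ?case by (simp del: tm_step.simps)
next
  case (WhS s j a p m s1 n s2)
  have c: "compiled M p (Suc b) b"
    using WhS.prems by (auto simp: compiled_def)
  have "tm_step M (b, map s [0..<tape_count M]) = (Suc b, map s [0..<tape_count M])"
    by (rule step_test) (use WhS in \<open>auto simp: compiled_def\<close>)
  with WhS.IH(1)[OF c] WhS.IH(2)[OF WhS.prems] show ?case
    by (simp add: funpow_swap1 add.commute[of m n] funpow_add del: tm_step.simps)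
qed

definition machine :: "nat \<Rightarrow> prog \<Rightarrow> turing_machine" where
  "machine k p = \<lparr>tape_count = k, state_count = states p, symbol_count = 3,
     transition = code p 0 (states p)\<rparr>"

lemma machine_simps [simp]:
  "tape_count (machine k p) = k" "state_count (machine k p) = states p"
  "symbol_count (machine k p) = 3" "transition (machine k p) = code p 0 (states p)"
  by (simp_all add: machine_def)

lemma is_turing_machine_machine:
  assumes "2 \<le> k" "prog_ok k p"
  shows "is_turing_machine (machine k p)"
  unfolding is_turing_machine_def
proof (intro conjI allI impI)
  fix q ss assume *: "q < state_count (machine k p)"
    "length ss = tape_count (machine k p) \<and> set ss \<subseteq> {..<symbol_count (machine k p)}"
  show "case transition (machine k p) q ss of (q', as) \<Rightarrow> q' \<le> state_count (machine k p) \<and>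
     length as = tape_count (machine k p) \<and> fst ` set as \<subseteq> {..<symbol_count (machine k p)}"
    using code_bounds[of 0 q p ss "states p"] * assms by (auto split: prod.splits simp: image_subset_iff)
qed (use assms in simp_all)

definition runs :: "prog \<Rightarrow> (nat \<Rightarrow> tape) \<Rightarrow> (nat \<Rightarrow> tape) \<Rightarrow> nat \<Rightarrow> bool" where
  "runs p s s' n \<longleftrightarrow> (\<exists>t\<le>n. exec p s t s')"

lemma runs_machine:
  assumes "runs p s s' n" "prog_ok k p"
  shows "\<exists>t\<le>n. (tm_step (machine k p) ^^ t) (0, map s [0..<k]) = (states p, map s' [0..<k])"
proof -
  obtain t where "t \<le> n" "exec p s t s'" using assms(1) by (auto simp: runs_def)
  moreover have "compiled (machine k p) p 0 (states p)"
    using assms(2) by (simp add: compiled_def)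
  ultimately show ?thesis using exec_compiled by fastforce
qed

lemma runs_mono: "runs p s s' n \<Longrightarrow> n \<le> m \<Longrightarrow> runs p s s' m"
  unfolding runs_def by (meson order_trans)

lemma runs_Mv: "s' = s(j := (fst (s j), snd (s j) + shift d)) \<Longrightarrow> 1 \<le> n \<Longrightarrow> runs (Mv j d) s s' n"
  unfolding runs_def using exec.Mv by blast

lemma runs_Wr: "s' = s(j := ((fst (s j))(snd (s j) := a), snd (s j))) \<Longrightarrow> 1 \<le> n \<Longrightarrow> runs (Wr j a) s s' n"
  unfolding runs_def using exec.Wr by blast

lemma runs_Seq: "runs p s s1 m \<Longrightarrow> runs r s1 s2 n \<Longrightarrow> runs (Seq p r) s s2 (m + n)"
  unfolding runs_def by (meson add_mono exec.Seq)

lemma runs_If: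
  "(read_tape (s j) = a \<Longrightarrow> runs p s s' n) \<Longrightarrow> (read_tape (s j) \<noteq> a \<Longrightarrow> runs r s s' n) \<Longrightarrow>
   runs (If j a p r) s s' (Suc n)"
  unfolding runs_def by (metis IfF IfT Suc_le_mono)

text \<open>A loop is verified by the explicit sequence of stores before its \<open>n\<close>
  rounds; each round pays for its body and one test.\<close>

lemma runs_Wh:
  assumes "\<And>i. i < n \<Longrightarrow> read_tape (s i j) \<noteq> a" "\<And>i. i < n \<Longrightarrow> runs p (s i) (s (Suc i)) N"
    "read_tape (s n j) = a" "s0 = s 0" "s1 = s n"
  shows "runs (Wh j a p) s0 s1 (n * Suc N + 1)"
proof -
  \<comment> \<open>The induction is on the number of rounds that remain, since
    \<open>exec.WhS\<close> adds a round in front.\<close>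
  have "runs (Wh j a p) (s (n - k)) (s n) (k * Suc N + 1)" if "k \<le> n" for k
    using that
  proof (induction k)
    case 0
    then show ?case using exec.WhE[of "s n" j a p] assms(3) by (auto simp: runs_def)
  next
    case (Suc k)
    then have "n - Suc k < n" "Suc (n - Suc k) = n - k" by auto
    with assms(1,2)[of "n - Suc k"] obtain t where t: "t \<le> N" "exec p (s (n - Suc k)) t (s (n - k))"
      by (auto simp: runs_def)
    obtain u where u: "u \<le> k * Suc N + 1" "exec (Wh j a p) (s (n - k)) u (s n)"
      using Suc by (auto simp: runs_def)
    have "exec (Wh j a p) (s (n - Suc k)) (Suc (t + u)) (s n)"
      by (rule exec.WhS[OF _ t(2) u(2)]) (use assms(1)[of "n - Suc k"] Suc.prems in auto)
    moreover have "Suc (t + u) \<le> Suc k * Suc N + 1" using t u by simp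
    ultimately show ?case unfolding runs_def by blast
  qed
  from this[of n] assms show ?thesis by simp
qed

section \<open>Counter registers\<close>

text \<open>Tape \<open>r + 3\<close> serves as counter \<open>r\<close>: its value is the position of the head, and cell \<open>0\<close> is marked.\<close>

definition cfg :: "tape \<Rightarrow> tape \<Rightarrow> tape \<Rightarrow> (nat \<Rightarrow> nat) \<Rightarrow> nat \<Rightarrow> tape" where
  "cfg u v w g j = (if j = 0 then u else if j = 1 then v else if j = 2 then w
     else (\<lambda>z. if z = 0 then 1 else 0, int (g (j - 3))))"

definition inc :: "nat \<Rightarrow> prog" where "inc r = Mv (r + 3) Move_Right"
definition dec :: "nat \<Rightarrow> prog" where "dec r = Mv (r + 3) Move_Left"
definition skip :: prog where "skip = Mv 0 Stay"
text \<open>A counter is zero exactly if its head reads the mark \<open>1\<close>. Thus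
  \<open>loop r p\<close> executes \<open>p\<close> once per unit of register \<open>r\<close>,
  provided that \<open>p\<close> leaves \<open>r\<close> alone, and ends with \<open>r\<close> at
  zero; a value still in demand has to be copied first.\<close>

definition loop :: "nat \<Rightarrow> prog \<Rightarrow> prog" where "loop r p = Wh (r + 3) 1 (Seq (dec r) p)"
definition clear :: "nat \<Rightarrow> prog" where "clear r = loop r skip"

lemma cfg_simps [simp]:
  "cfg u v w g 0 = u" "cfg u v w g (Suc 0) = v" "cfg u v w g 2 = w"
  "cfg u v w g (r + 3) = (\<lambda>z. if z = 0 then 1 else 0, int (g r))"
  "cfg u v w g (Suc (Suc (Suc r))) = (\<lambda>z. if z = 0 then 1 else 0, int (g r))"
  by (simp_all add: cfg_def)

lemma runs_inc: "g' = g(r := Suc (g r)) \<Longrightarrow> 1 \<le> n \<Longrightarrow> runs (inc r) (cfg u v w g) (cfg u v w g') n"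
  unfolding inc_def by (rule runs_Mv) (auto simp: cfg_def fun_eq_iff)

lemma runs_dec: "0 < g r \<Longrightarrow> g' = g(r := g r - 1) \<Longrightarrow> 1 \<le> n \<Longrightarrow> runs (dec r) (cfg u v w g) (cfg u v w g') n"
  unfolding dec_def by (rule runs_Mv) (auto simp: cfg_def fun_eq_iff)

lemma runs_skip: "1 \<le> n \<Longrightarrow> runs skip s s n"
  unfolding skip_def by (rule runs_Mv) auto

text \<open>The decrement precedes the body, so the body of round \<open>i\<close> sees
  \<open>n - Suc i\<close> in \<open>r\<close>. The \<open>2\<close> in the time bound pays for the
  test and the decrement.\<close>

lemma runs_loop:
  assumes "\<And>i. i \<le> n \<Longrightarrow> G i r = n - i"
    "\<And>i. i < n \<Longrightarrow> runs p (cfg (u i) (v i) (w i) ((G i)(r := n - Suc i)))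
       (cfg (u (Suc i)) (v (Suc i)) (w (Suc i)) (G (Suc i))) N"
    "s0 = cfg (u 0) (v 0) (w 0) (G 0)" "s1 = cfg (u n) (v n) (w n) (G n)" "n * (N + 2) + 1 \<le> K"
  shows "runs (loop r p) s0 s1 K"
proof -
  have "runs (loop r p) s0 s1 (n * Suc (1 + N) + 1)"
    unfolding loop_def
  proof (rule runs_Wh[where s = "\<lambda>i. cfg (u i) (v i) (w i) (G i)"])
    fix i assume i: "i < n"
    have "runs (dec r) (cfg (u i) (v i) (w i) (G i)) (cfg (u i) (v i) (w i) ((G i)(r := n - Suc i))) 1"
      by (rule runs_dec) (use i assms(1)[of i] in \<open>auto simp: less_imp_le\<close>)
    with assms(2)[OF i] show "runs (Seq (dec r) p) (cfg (u i) (v i) (w i) (G i))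
        (cfg (u (Suc i)) (v (Suc i)) (w (Suc i)) (G (Suc i))) (1 + N)"
      by (rule runs_Seq[rotated])
  qed (use assms in \<open>auto simp: less_imp_le\<close>)
  with assms(5) show ?thesis by (elim runs_mono) simp
qed

lemma runs_clear: "g' = g(r := 0) \<Longrightarrow> 3 * g r + 1 \<le> K \<Longrightarrow> runs (clear r) (cfg u v w g) (cfg u v w g') K"
  unfolding clear_def
  by (rule runs_loop[where n = "g r" and N = 1 and u = "\<lambda>_. u" and v = "\<lambda>_. v" and w = "\<lambda>_. w"
        and G = "\<lambda>i. g(r := g r - i)"])
    (auto simp: intro!: runs_skip)

lemma runs_add:
  assumes "r \<noteq> r'" "g' = g(r := 0, r' := g r' + g r)" "3 * g r + 1 \<le> K"
  shows "runs (loop r (inc r')) (cfg u v w g) (cfg u v w g') K"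
  by (rule runs_loop[where n = "g r" and N = 1 and u = "\<lambda>_. u" and v = "\<lambda>_. v" and w = "\<lambda>_. w"
        and G = "\<lambda>i. g(r := g r - i, r' := g r' + i)"])
    (use assms in \<open>auto intro!: runs_inc simp: fun_upd_twist\<close>)

section \<open>Compiling counting expressions\<close>

text \<open>Monotonicity is included because bounds are composed, as in \<open>h (m + f m)\<close>
  for sums, and evaluated at upper bounds of the true arguments.\<close>

definition poly_bound :: "(nat \<Rightarrow> nat) \<Rightarrow> bool" where
  "poly_bound f \<longleftrightarrow> mono f \<and> (\<exists>p. \<forall>m. f m \<le> poly p m)"

lemma poly_nat_mono: "mono (poly (p :: nat poly))"
proof (rule monoI)
  fix m n :: nat assume "m \<le> n"
  then show "poly p m \<le> poly p n"
    by (induction p) (auto intro!: mult_mono)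
qed

lemma poly_bound_const: "poly_bound (\<lambda>m. c)"
  unfolding poly_bound_def by (auto intro!: monoI exI[of _ "[:c:]"])

lemma poly_bound_id: "poly_bound (\<lambda>m. m)"
  unfolding poly_bound_def by (auto intro!: monoI exI[of _ "[:0, 1:]"])

lemma poly_bound_add: "poly_bound f \<Longrightarrow> poly_bound g \<Longrightarrow> poly_bound (\<lambda>m. f m + g m)"
  unfolding poly_bound_def
proof (elim conjE exE, intro conjI)
  fix p q assume "\<forall>m. f m \<le> poly p m" "\<forall>m. g m \<le> poly q m"
  then show "\<exists>p. \<forall>m. f m + g m \<le> poly p m"
    by (intro exI[of _ "p + q"]) (auto intro: add_mono)
qed (auto intro!: monoI add_mono dest: monoD)

lemma poly_bound_mult: "poly_bound f \<Longrightarrow> poly_bound g \<Longrightarrow> poly_bound (\<lambda>m. f m * g m)"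
  unfolding poly_bound_def
proof (elim conjE exE, intro conjI)
  fix p q assume "\<forall>m. f m \<le> poly p m" "\<forall>m. g m \<le> poly q m"
  then show "\<exists>p. \<forall>m. f m * g m \<le> poly p m"
    by (intro exI[of _ "p * q"]) (auto intro: mult_mono)
qed (auto intro!: monoI mult_mono dest: monoD)

lemma poly_bound_comp: "poly_bound f \<Longrightarrow> poly_bound g \<Longrightarrow> poly_bound (\<lambda>m. f (g m))"
  unfolding poly_bound_def
proof (elim conjE exE, intro conjI)
  fix p q assume p: "\<forall>m. f m \<le> poly p m" and q: "\<forall>m. g m \<le> poly q m"
  have "f (g m) \<le> poly p (poly q m)" for m
    using p q poly_nat_mono[of p] by (meson monoD order_trans)
  then show "\<exists>p. \<forall>m. f (g m) \<le> poly p m"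
    by (intro exI[of _ "pcompose p q"]) (simp add: poly_pcompose)
qed (auto intro!: monoI dest: monoD)

lemmas poly_bound_intros = poly_bound_const poly_bound_id poly_bound_add poly_bound_mult

text \<open>Variables are de Bruijn indices, and \<open>Sum\<close> binds index \<open>0\<close>.
  Renaming is a constructor so that weakening under a binder involves no syntactic
  substitution.\<close>

datatype expr = Var nat | Const nat | Len | Bit expr | Less expr expr | Add expr expr
  | Sum expr expr | Ren "nat \<Rightarrow> nat" expr

fun eval :: "expr \<Rightarrow> bool list \<Rightarrow> (nat \<Rightarrow> nat) \<Rightarrow> nat" where
  "eval (Var k) x e = e k"
| "eval (Const c) x e = c"
| "eval Len x e = length x"
| "eval (Bit a) x e = of_bool (eval a x e < length x \<and> x ! eval a x e)"
| "eval (Less a b) x e = of_bool (eval a x e < eval b x e)"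
| "eval (Add a b) x e = eval a x e + eval b x e"
| "eval (Sum a b) x e = (\<Sum>i<eval a x e. eval b x (case_nat i e))"
| "eval (Ren f a) x e = eval a x (\<lambda>k. e (f k))"

definition dec_sat :: "nat \<Rightarrow> prog" where "dec_sat r = If (r + 3) 1 skip (dec r)"

text \<open>Variable \<open>k\<close> is kept in register \<open>\<rho> k\<close>; the registers from \<open>L\<close> on are free,
  and the value is delivered in register \<open>L\<close>.\<close>

fun comp :: "expr \<Rightarrow> (nat \<Rightarrow> nat) \<Rightarrow> nat \<Rightarrow> prog" where
  "comp (Var k) \<rho> L = Seq (loop (\<rho> k) (Seq (inc L) (inc (L + 1)))) (loop (L + 1) (inc (\<rho> k)))"
| "comp (Const c) \<rho> L = (Seq (inc L) ^^ c) skip"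
| "comp Len \<rho> L =
     Seq (Wh 0 0 (Seq (Mv 0 Move_Right) (Seq (inc L) (inc (L + 1))))) (loop (L + 1) (Mv 0 Move_Left))"
| "comp (Bit a) \<rho> L = Seq (comp a \<rho> (L + 1)) (Seq (loop (L + 1) (Seq (Mv 0 Move_Right) (inc (L + 2))))
     (Seq (If 0 2 (inc L) skip) (loop (L + 2) (Mv 0 Move_Left))))"
| "comp (Less a b) \<rho> L = Seq (comp a \<rho> L) (Seq (comp b \<rho> (L + 1))
     (Seq (loop L (dec_sat (L + 1)))
       (If (L + 1 + 3) 1 skip (Seq (inc L) (clear (L + 1))))))"
| "comp (Add a b) \<rho> L = Seq (comp a \<rho> L) (Seq (comp b \<rho> (L + 1)) (loop (L + 1) (inc L)))"
| "comp (Sum a b) \<rho> L = Seq (comp a \<rho> (L + 1))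
     (Seq (loop (L + 1) (Seq (comp b (case_nat (L + 2) \<rho>) (L + 3)) (Seq (loop (L + 3) (inc L)) (inc (L + 2)))))
       (clear (L + 2)))"
| "comp (Ren f a) \<rho> L = comp a (\<lambda>k. \<rho> (f k)) L"

text \<open>All registers from \<open>L\<close> on are zero before, and all but \<open>L\<close>
  again afterwards, so they can be reused as scratch space. One function bounds time and value
  together: values drive loops and so enter the running time of enclosing expressions.\<close>

definition computes_within :: "expr \<Rightarrow> (nat \<Rightarrow> nat) \<Rightarrow> bool" where
  "computes_within a f \<longleftrightarrow> (\<forall>\<rho> L x g m v w. (\<forall>k. \<rho> k < L) \<longrightarrow> (\<forall>r\<ge>L. g r = 0) \<longrightarrow> (\<forall>k. g (\<rho> k) \<le> m) \<longrightarrow>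
     length x \<le> m \<longrightarrow> eval a x (\<lambda>k. g (\<rho> k)) \<le> f m \<and>
     runs (comp a \<rho> L) (cfg (word_tape x) v w g)
       (cfg (word_tape x) v w (g(L := eval a x (\<lambda>k. g (\<rho> k))))) (f m))"

abbreviation outcome where
  "outcome a \<rho> L x g v w N \<equiv> eval a x (\<lambda>k. g (\<rho> k)) \<le> N \<and>
     (\<exists>n\<le>N. runs (comp a \<rho> L) (cfg (word_tape x) v w g)
       (cfg (word_tape x) v w (g(L := eval a x (\<lambda>k. g (\<rho> k))))) n)"

lemma computes_withinI:
  assumes "\<And>\<rho> L x g m v w. (\<And>k. \<rho> k < L) \<Longrightarrow> (\<And>r. r \<ge> L \<Longrightarrow> g r = 0) \<Longrightarrow> (\<And>k. g (\<rho> k) \<le> m) \<Longrightarrow>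
     length x \<le> m \<Longrightarrow> outcome a \<rho> L x g v w (f m)"
  shows "computes_within a f"
  unfolding computes_within_def using assms by (meson runs_mono)

lemma computes_withinD:
  assumes "computes_within a f" "\<And>k. \<rho> k < L" "\<And>r. r \<ge> L \<Longrightarrow> g r = 0" "\<And>k. g (\<rho> k) \<le> m" "length x \<le> m"
  shows "eval a x (\<lambda>k. g (\<rho> k)) \<le> f m"
    "g' = g(L := eval a x (\<lambda>k. g (\<rho> k))) \<Longrightarrow>
     runs (comp a \<rho> L) (cfg (word_tape x) v w g) (cfg (word_tape x) v w g') (f m)"
  using assms unfolding computes_within_def by blast+

lemma word_tape_simps [simp]:
  "snd (word_tape x) = 0" "fst (word_tape x) (int i) = (if i < length x then bit_symbol (x ! i) else 0)"
  by (auto simp: word_tape_def)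

lemma runs_head0:
  assumes "u' = (fst u, snd u + shift d)" "1 \<le> n"
  shows "runs (Mv 0 d) (cfg u v w g) (cfg u' v w g) n"
  using assms by (intro runs_Mv) (auto simp: cfg_def fun_eq_iff)

lemma cfg_eqI: "u = u' \<Longrightarrow> (\<And>k. g k = g' k) \<Longrightarrow> cfg u v w g = cfg u' v w g'"
  by (auto simp: cfg_def)

lemma runs_inc_inc:
  assumes "\<And>k. g' k = (g(r := Suc (g r), r' := Suc ((g(r := Suc (g r))) r'))) k" "2 \<le> n"
  shows "runs (Seq (inc r) (inc r')) (cfg u v w g) (cfg u v w g') n"
  by (rule runs_mono, rule runs_Seq, rule runs_inc, rule refl, rule order_refl, rule runs_inc,
      rule ext, rule assms, rule order_refl) (use assms in simp)

lemma runs_head0_inc: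
  assumes "u' = (fst u, snd u + shift d)" "\<And>k. g' k = (g(r := Suc (g r))) k" "2 \<le> n"
  shows "runs (Seq (Mv 0 d) (inc r)) (cfg u v w g) (cfg u' v w g') n"
  by (rule runs_mono, rule runs_Seq, rule runs_head0, rule assms, rule order_refl, rule runs_inc,
      rule ext, rule assms, rule order_refl) (use assms in simp)

lemma runs_head0_inc_inc:
  assumes "u' = (fst u, snd u + shift d)"
    "\<And>k. g' k = (g(r := Suc (g r), r' := Suc ((g(r := Suc (g r))) r'))) k" "3 \<le> n"
  shows "runs (Seq (Mv 0 d) (Seq (inc r) (inc r'))) (cfg u v w g) (cfg u' v w g') n"
  by (rule runs_mono, rule runs_Seq, rule runs_head0, rule assms, rule order_refl, rule runs_inc_inc,
      rule assms, rule order_refl) (use assms in simp)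

lemma runs_dec_sat:
  assumes "\<And>k. g' k = (g(r := g r - 1)) k" "2 \<le> n"
  shows "runs (dec_sat r) (cfg u v w g) (cfg u v w g') n"
proof -
  have g': "g' = g(r := g r - 1)" using assms(1) by (rule ext)
  have "runs (dec_sat r) (cfg u v w g) (cfg u v w g') (Suc 1)"
    unfolding dec_sat_def
  proof (rule runs_If)
    assume "read_tape (cfg u v w g (r + 3)) = 1"
    then have "g' = g" unfolding g' by (auto split: if_splits)
    then show "runs skip (cfg u v w g) (cfg u v w g') 1" by (simp add: runs_skip)
  next
    assume "read_tape (cfg u v w g (r + 3)) \<noteq> 1"
    then show "runs (dec r) (cfg u v w g) (cfg u v w g') 1"
      using g' by (intro runs_dec) (auto split: if_splits)
  qed
  with assms(2) show ?thesis by (elim runs_mono) simp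
qed

lemma le_exI: "runs p s s' n \<Longrightarrow> n \<le> N \<Longrightarrow> \<exists>n\<le>N. runs p s s' n"
  by blast

lemma runs_skip_cfg:
  assumes "\<And>k. g' k = g k" "1 \<le> n"
  shows "runs skip (cfg u v w g) (cfg u v w g') n"
  using runs_skip[OF assms(2)] ext[of g' g] assms(1) by metis

lemma runs_head0_eq:
  assumes "u' = (fst u, snd u + shift d)" "\<And>k. g' k = g k" "1 \<le> n"
  shows "runs (Mv 0 d) (cfg u v w g) (cfg u' v w g') n"
  using runs_head0[OF assms(1,3)] ext[of g' g] assms(2) by metis

text \<open>A loop drains its counter, so the value is moved to \<open>L\<close> and
  \<open>L + 1\<close> at once and restored from \<open>L + 1\<close>.\<close>

lemma computes_Var: "computes_within (Var k) (\<lambda>m. 10 * m + 10)"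
proof (rule computes_withinI)
  fix \<rho> :: "nat \<Rightarrow> nat" and L :: nat and x :: "bool list" and g :: "nat \<Rightarrow> nat" and m :: nat and v w :: tape
  assume \<rho>: "\<And>k. \<rho> k < (L::nat)" and g: "\<And>r. r \<ge> L \<Longrightarrow> g r = (0::nat)" and m: "\<And>k. g (\<rho> k) \<le> m"
  let ?n = "g (\<rho> k)"
  have 1: "runs (loop (\<rho> k) (Seq (inc L) (inc (L + 1)))) (cfg (word_tape x) v w g)
      (cfg (word_tape x) v w (g(\<rho> k := 0, L := ?n, L + 1 := ?n))) (?n * 4 + 1)"
    by (rule runs_loop[where n = ?n and N = 2 and u = "\<lambda>_. word_tape x" and v = "\<lambda>_. v" and w = "\<lambda>_. w"
        and G = "\<lambda>i. g(\<rho> k := ?n - i, L := i, L + 1 := i)"])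
      (use \<rho>[of k] g in \<open>auto intro!: runs_inc_inc cfg_eqI\<close>)
  have 2: "runs (loop (L + 1) (inc (\<rho> k))) (cfg (word_tape x) v w (g(\<rho> k := 0, L := ?n, L + 1 := ?n)))
      (cfg (word_tape x) v w (g(L := ?n))) (3 * ?n + 1)"
    by (rule runs_add) (use \<rho>[of k] g in \<open>auto simp: fun_eq_iff\<close>)
  show "outcome (Var k) \<rho> L x g v w (10 * m + 10)"
    unfolding comp.simps eval.simps
    by (intro conjI le_exI[OF runs_Seq[OF 1 2]]) (use m[of k] in auto)
qed

lemma computes_Const: "computes_within (Const c) (\<lambda>m. c + 1)"
proof (rule computes_withinI)
  fix \<rho> :: "nat \<Rightarrow> nat" and L :: nat and x :: "bool list" and g :: "nat \<Rightarrow> nat" and m :: nat and v w :: tape assume "\<And>r. r \<ge> L \<Longrightarrow> g r = (0::nat)"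
  moreover have "runs ((Seq (inc L) ^^ c) skip) (cfg (word_tape x) v w g)
      (cfg (word_tape x) v w (g(L := g L + c))) (c + 1)" for g
  proof (induction c arbitrary: g)
    case (Suc c)
    have "runs (inc L) (cfg (word_tape x) v w g) (cfg (word_tape x) v w (g(L := Suc (g L)))) 1"
      by (rule runs_inc) auto
    from runs_Seq[OF this Suc] show ?case by (simp add: fun_upd_def cong: if_cong)
  qed (simp add: runs_skip)
  ultimately show "outcome (Const c) \<rho> L x g v w (c + 1)"
    by (metis add_0 comp.simps(2) eval.simps(2) le_add1 order_refl)
qed

lemma computes_Len: "computes_within Len (\<lambda>m. 10 * m + 10)"
proof (rule computes_withinI)
  fix \<rho> :: "nat \<Rightarrow> nat" and L :: nat and x :: "bool list" and g :: "nat \<Rightarrow> nat" and m :: nat and v w :: tape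
  assume g: "\<And>r. r \<ge> L \<Longrightarrow> g r = (0::nat)" and m: "length x \<le> m"
  let ?n = "length x" and ?u = "\<lambda>i. (fst (word_tape x), int i)"
  have 0: "?u 0 = word_tape x" by (simp add: word_tape_def)
  have 1: "runs (Wh 0 0 (Seq (Mv 0 Move_Right) (Seq (inc L) (inc (L + 1))))) (cfg (word_tape x) v w g)
      (cfg (?u ?n) v w (g(L := ?n, L + 1 := ?n))) (?n * Suc 3 + 1)"
    by (rule runs_Wh[where s = "\<lambda>i. cfg (?u i) v w (g(L := i, L + 1 := i))"])
      (use g 0 in \<open>auto simp: bit_symbol_def
          intro!: cfg_eqI runs_head0_inc_inc\<close>)
  have 2: "runs (loop (L + 1) (Mv 0 Move_Left)) (cfg (?u ?n) v w (g(L := ?n, L + 1 := ?n)))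
      (cfg (word_tape x) v w (g(L := ?n))) (?n * 3 + 1)"
    by (rule runs_loop[where n = ?n and N = 1 and u = "\<lambda>i. ?u (?n - i)" and v = "\<lambda>_. v" and w = "\<lambda>_. w"
        and G = "\<lambda>i. g(L := ?n, L + 1 := ?n - i)"])
      (use g 0 in \<open>auto intro!: runs_head0_eq cfg_eqI\<close>)
  show "outcome Len \<rho> L x g v w (10 * m + 10)"
    unfolding comp.simps eval.simps
    by (intro conjI le_exI[OF runs_Seq[OF 1 2]]) (use m in auto)
qed

text \<open>The range check in \<open>Bit\<close> is done by the tape itself: past the end of the
  word the head reads a blank, which differs from \<open>2\<close>. Register \<open>L + 2\<close>
  remembers the way back.\<close>

lemma computes_Bit:
  assumes a: "computes_within a f"
  shows "computes_within (Bit a) (\<lambda>m. 11 * f m + 10)"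
proof (rule computes_withinI)
  fix \<rho> :: "nat \<Rightarrow> nat" and L :: nat and x :: "bool list" and g :: "nat \<Rightarrow> nat" and m :: nat and v w :: tape
  assume \<rho>: "\<And>k. \<rho> k < (L::nat)" and g: "\<And>r. r \<ge> L \<Longrightarrow> g r = (0::nat)" and m: "\<And>k. g (\<rho> k) \<le> m"
    and x: "length x \<le> m"
  let ?u = "\<lambda>i. (fst (word_tape x), int i)"
  define n where "n = eval a x (\<lambda>k. g (\<rho> k))"
  define b where "b = (of_bool (n < length x \<and> x ! n) :: nat)"
  have 0: "?u 0 = word_tape x" by (simp add: word_tape_def)
  have \<rho>': "\<rho> k < L + 1" for k using \<rho>[of k] by simp
  have n: "n \<le> f m" unfolding n_def by (rule computes_withinD(1)[OF a]) (fact \<rho> g m x)+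
  have 1: "runs (comp a \<rho> (L + 1)) (cfg (word_tape x) v w g)
      (cfg (word_tape x) v w (g(L + 1 := n))) (f m)"
    by (rule computes_withinD(2)[OF a]) (use \<rho>' g m x n_def in auto)
  have 2: "runs (loop (L + 1) (Seq (Mv 0 Move_Right) (inc (L + 2)))) (cfg (word_tape x) v w (g(L + 1 := n)))
      (cfg (?u n) v w (g(L + 2 := n))) (n * 4 + 1)"
    by (rule runs_loop[where n = n and N = 2 and u = "?u" and v = "\<lambda>_. v" and w = "\<lambda>_. w"
        and G = "\<lambda>i. g(L + 1 := n - i, L + 2 := i)"])
      (use g 0 in \<open>auto intro!: runs_head0_inc cfg_eqI\<close>)
  have 3: "runs (If 0 2 (inc L) skip) (cfg (?u n) v w (g(L + 2 := n))) (cfg (?u n) v w (g(L + 2 := n, L := b))) (Suc 1)"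
    by (rule runs_If) (use g in \<open>auto simp: b_def bit_symbol_def intro!: runs_inc[OF ext] runs_skip_cfg split: if_splits\<close>)
  have 4: "runs (loop (L + 2) (Mv 0 Move_Left)) (cfg (?u n) v w (g(L + 2 := n, L := b)))
      (cfg (word_tape x) v w (g(L := b))) (n * 3 + 1)"
    by (rule runs_loop[where n = n and N = 1 and u = "\<lambda>i. ?u (n - i)" and v = "\<lambda>_. v" and w = "\<lambda>_. w"
        and G = "\<lambda>i. g(L + 2 := n - i, L := b)"])
      (use g 0 in \<open>auto intro!: runs_head0_eq cfg_eqI\<close>)
  show "outcome (Bit a) \<rho> L x g v w (11 * f m + 10)"
    unfolding comp.simps eval.simps n_def[symmetric] b_def[symmetric]
    by (intro conjI le_exI[OF runs_Seq[OF 1 runs_Seq[OF 2 runs_Seq[OF 3 4]]]]) (use n in \<open>auto simp: b_def\<close>)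
qed

text \<open>Decrementing \<open>q\<close> as many as \<open>p\<close> times, but not below zero,
  leaves \<open>q - p\<close>, which is positive iff \<open>p < q\<close>.\<close>

lemma computes_Less:
  assumes a: "computes_within a f" and b: "computes_within b h"
  shows "computes_within (Less a b) (\<lambda>m. 10 * f m + 10 * h m + 10)"
proof (rule computes_withinI)
  fix \<rho> :: "nat \<Rightarrow> nat" and L :: nat and x :: "bool list" and g :: "nat \<Rightarrow> nat" and m :: nat and v w :: tape
  assume \<rho>: "\<And>k. \<rho> k < (L::nat)" and g: "\<And>r. r \<ge> L \<Longrightarrow> g r = (0::nat)" and m: "\<And>k. g (\<rho> k) \<le> m"
    and x: "length x \<le> m"
  define p where "p = eval a x (\<lambda>k. g (\<rho> k))"
  define q where "q = eval b x (\<lambda>k. g (\<rho> k))"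
  have \<rho>': "\<rho> k \<noteq> L" "\<rho> k < L + 1" for k using \<rho>[of k] by auto
  have p: "p \<le> f m" unfolding p_def by (rule computes_withinD(1)[OF a]) (fact \<rho> g m x)+
  have q: "q \<le> h m" unfolding q_def by (rule computes_withinD(1)[OF b]) (fact \<rho> g m x)+
  have 1: "runs (comp a \<rho> L) (cfg (word_tape x) v w g) (cfg (word_tape x) v w (g(L := p))) (f m)"
    by (rule computes_withinD(2)[OF a]) (use \<rho> g m x p_def in auto)
  have 2: "runs (comp b \<rho> (L + 1)) (cfg (word_tape x) v w (g(L := p)))
      (cfg (word_tape x) v w (g(L := p, L + 1 := q))) (h m)"
    by (rule computes_withinD(2)[OF b]) (use \<rho>' g m x q_def in auto)
  have 3: "runs (loop L (dec_sat (L + 1))) (cfg (word_tape x) v w (g(L := p, L + 1 := q)))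
      (cfg (word_tape x) v w (g(L + 1 := q - p))) (p * 4 + 1)"
    by (rule runs_loop[where n = p and N = 2 and u = "\<lambda>_. word_tape x" and v = "\<lambda>_. v" and w = "\<lambda>_. w"
        and G = "\<lambda>i. g(L := p - i, L + 1 := q - i)"])
      (use g in \<open>auto intro!: cfg_eqI runs_dec_sat\<close>)
  have 4: "runs (If (L + 1 + 3) 1 skip (Seq (inc L) (clear (L + 1)))) (cfg (word_tape x) v w (g(L + 1 := q - p)))
      (cfg (word_tape x) v w (g(L := of_bool (p < q)))) (Suc (1 + (3 * (q - p) + 1)))"
  proof (rule runs_If)
    assume "read_tape (cfg (word_tape x) v w (g(L + 1 := q - p)) (L + 1 + 3)) = 1"
    then have "q - p = 0" by (simp add: cfg_def split: if_splits)
    then have "g(L + 1 := q - p) = g(L := of_bool (p < q))" using g by (auto simp: fun_eq_iff)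
    then show "runs skip (cfg (word_tape x) v w (g(L + 1 := q - p)))
      (cfg (word_tape x) v w (g(L := of_bool (p < q)))) (1 + (3 * (q - p) + 1))"
      by (simp add: runs_skip)
  next
    assume "read_tape (cfg (word_tape x) v w (g(L + 1 := q - p)) (L + 1 + 3)) \<noteq> 1"
    then have pq: "p < q" by (simp add: cfg_def split: if_splits)
    have "runs (inc L) (cfg (word_tape x) v w (g(L + 1 := q - p)))
       (cfg (word_tape x) v w (g(L + 1 := q - p, L := 1))) 1"
      by (rule runs_inc) (use g in auto)
    moreover have "runs (clear (L + 1)) (cfg (word_tape x) v w (g(L + 1 := q - p, L := 1)))
       (cfg (word_tape x) v w (g(L := of_bool (p < q)))) (3 * (q - p) + 1)"
      by (rule runs_clear) (use g pq in \<open>auto simp: fun_eq_iff\<close>)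
    ultimately show "runs (Seq (inc L) (clear (L + 1))) (cfg (word_tape x) v w (g(L + 1 := q - p)))
      (cfg (word_tape x) v w (g(L := of_bool (p < q)))) (1 + (3 * (q - p) + 1))"
      by (rule runs_Seq)
  qed
  show "outcome (Less a b) \<rho> L x g v w (10 * f m + 10 * h m + 10)"
    unfolding comp.simps eval.simps p_def[symmetric] q_def[symmetric]
    by (intro conjI le_exI[OF runs_Seq[OF 1 runs_Seq[OF 2 runs_Seq[OF 3 4]]]]) (use p q in auto)
qed

lemma computes_Add:
  assumes a: "computes_within a f" and b: "computes_within b h"
  shows "computes_within (Add a b) (\<lambda>m. f m + 4 * h m + 1)"
proof (rule computes_withinI)
  fix \<rho> :: "nat \<Rightarrow> nat" and L :: nat and x :: "bool list" and g :: "nat \<Rightarrow> nat" and m :: nat and v w :: tape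
  assume \<rho>: "\<And>k. \<rho> k < (L::nat)" and g: "\<And>r. r \<ge> L \<Longrightarrow> g r = (0::nat)" and m: "\<And>k. g (\<rho> k) \<le> m"
    and x: "length x \<le> m"
  define p where "p = eval a x (\<lambda>k. g (\<rho> k))"
  define q where "q = eval b x (\<lambda>k. g (\<rho> k))"
  have \<rho>': "\<rho> k \<noteq> L" "\<rho> k < L + 1" for k using \<rho>[of k] by auto
  have p: "p \<le> f m" unfolding p_def by (rule computes_withinD(1)[OF a]) (fact \<rho> g m x)+
  have q: "q \<le> h m" unfolding q_def by (rule computes_withinD(1)[OF b]) (fact \<rho> g m x)+
  have 1: "runs (comp a \<rho> L) (cfg (word_tape x) v w g) (cfg (word_tape x) v w (g(L := p))) (f m)"
    by (rule computes_withinD(2)[OF a]) (use \<rho> g m x p_def in auto)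
  have 2: "runs (comp b \<rho> (L + 1)) (cfg (word_tape x) v w (g(L := p)))
      (cfg (word_tape x) v w (g(L := p, L + 1 := q))) (h m)"
    by (rule computes_withinD(2)[OF b]) (use \<rho>' g m x q_def in auto)
  have 3: "runs (loop (L + 1) (inc L)) (cfg (word_tape x) v w (g(L := p, L + 1 := q)))
      (cfg (word_tape x) v w (g(L := p + q))) (3 * q + 1)"
    by (rule runs_add) (use g in \<open>auto simp: fun_eq_iff\<close>)
  show "outcome (Add a b) \<rho> L x g v w (f m + 4 * h m + 1)"
    unfolding comp.simps eval.simps p_def[symmetric] q_def[symmetric]
    by (intro conjI le_exI[OF runs_Seq[OF 1 runs_Seq[OF 2 3]]]) (use p q in auto)
qed

text \<open>Register \<open>L\<close> accumulates, \<open>L + 1\<close> counts the rounds left,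
  \<open>L + 2\<close> is the bound variable and \<open>L + 3\<close> receives the summand. The
  bound variable stays below \<open>f m\<close>, hence the body is run with parameter
  \<open>m + f m\<close>.\<close>

lemma computes_Sum:
  assumes a: "computes_within a f" and b: "computes_within b h" and "mono h"
  shows "computes_within (Sum a b) (\<lambda>m. 8 * f m + 2 + f m * (4 * h (m + f m) + 4))"
proof (rule computes_withinI)
  fix \<rho> :: "nat \<Rightarrow> nat" and L :: nat and x :: "bool list" and g :: "nat \<Rightarrow> nat" and m :: nat and v w :: tape
  assume \<rho>: "\<And>k. \<rho> k < (L::nat)" and g: "\<And>r. r \<ge> L \<Longrightarrow> g r = (0::nat)" and m: "\<And>k. g (\<rho> k) \<le> m"
    and x: "length x \<le> m"
  let ?e = "\<lambda>k. g (\<rho> k)"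
  define n where "n = eval a x ?e"
  define s where "s i = (\<Sum>j<i. eval b x (case_nat j ?e))" for i
  define H where "H = h (m + f m)"
  have \<rho>': "\<rho> k \<noteq> L" "\<rho> k \<noteq> L + 1" "\<rho> k \<noteq> L + 2" "\<rho> k < L + 1" "\<rho> k \<noteq> Suc L" "\<rho> k \<noteq> Suc (Suc L)" "\<rho> k < L + 3"
    for k using \<rho>[of k] by auto
  have n: "n \<le> f m" unfolding n_def by (rule computes_withinD(1)[OF a]) (fact \<rho> g m x)+
  have 1: "runs (comp a \<rho> (L + 1)) (cfg (word_tape x) v w g)
      (cfg (word_tape x) v w (g(L + 1 := n))) (f m)"
    by (rule computes_withinD(2)[OF a]) (use \<rho>' g m x n_def in auto)
  have G: "(g(L := s i, L + 1 := j, L + 2 := i)) (case_nat (L + 2) \<rho> k) = case_nat i ?e k" for i j k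
    using \<rho>' by (auto split: nat.split)
  have body: "eval b x (case_nat i ?e) \<le> H \<and> runs (comp b (case_nat (L + 2) \<rho>) (L + 3))
      (cfg (word_tape x) v w (g(L := s i, L + 1 := j, L + 2 := i)))
      (cfg (word_tape x) v w (g(L := s i, L + 1 := j, L + 2 := i, L + 3 := eval b x (case_nat i ?e)))) H"
    if "i < n" for i j
  proof -
    have "case_nat (L + 2) \<rho> k < L + 3" for k using \<rho>' by (auto split: nat.split)
    moreover have "(g(L := s i, L + 1 := j, L + 2 := i)) r = 0" if "L + 3 \<le> r" for r using g that by auto
    moreover have "(g(L := s i, L + 1 := j, L + 2 := i)) (case_nat (L + 2) \<rho> k) \<le> m + f m" for k
      unfolding G using m n that by (auto split: nat.split simp: trans_le_add1)
    moreover have "length x \<le> m + f m" using x by simp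
    ultimately show ?thesis
      using computes_withinD[OF b, of "case_nat (L + 2) \<rho>" "L + 3" "g(L := s i, L + 1 := j, L + 2 := i)" "m + f m" x]
      unfolding G H_def by metis
  qed
  have 2: "runs (loop (L + 1) (Seq (comp b (case_nat (L + 2) \<rho>) (L + 3)) (Seq (loop (L + 3) (inc L)) (inc (L + 2)))))
      (cfg (word_tape x) v w (g(L + 1 := n)))
      (cfg (word_tape x) v w (g(L := s n, L + 2 := n))) (n * ((H + ((3 * H + 1) + 1)) + 2) + 1)"
  proof (rule runs_loop[where n = n and N = "H + ((3 * H + 1) + 1)" and u = "\<lambda>_. word_tape x" and v = "\<lambda>_. v" and w = "\<lambda>_. w"
        and G = "\<lambda>i. g(L := s i, L + 1 := n - i, L + 2 := i)"])
    fix i assume i: "i < n"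
    let ?g = "g(L := s i, L + 1 := n - Suc i, L + 2 := i)" and ?v = "eval b x (case_nat i ?e)"
    have "runs (Seq (comp b (case_nat (L + 2) \<rho>) (L + 3)) (Seq (loop (L + 3) (inc L)) (inc (L + 2))))
       (cfg (word_tape x) v w ?g)
       (cfg (word_tape x) v w (g(L := s (Suc i), L + 1 := n - Suc i, L + 2 := Suc i))) (H + ((3 * H + 1) + 1))"
    proof (intro runs_Seq)
      show "runs (comp b (case_nat (L + 2) \<rho>) (L + 3)) (cfg (word_tape x) v w ?g) (cfg (word_tape x) v w (?g(L + 3 := ?v))) H"
        using body[OF i] by blast
      show "runs (loop (L + 3) (inc L)) (cfg (word_tape x) v w (?g(L + 3 := ?v)))
         (cfg (word_tape x) v w (?g(L := s (Suc i)))) (3 * H + 1)"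
        by (rule runs_add) (use g body[OF i] in \<open>auto simp: fun_eq_iff s_def\<close>)
      show "runs (inc (L + 2)) (cfg (word_tape x) v w (?g(L := s (Suc i))))
         (cfg (word_tape x) v w (g(L := s (Suc i), L + 1 := n - Suc i, L + 2 := Suc i))) 1"
        by (rule runs_inc) (auto simp: fun_eq_iff)
    qed
    moreover have "(g(L := s i, L + 1 := n - i, L + 2 := i))(L + 1 := n - Suc i) = ?g"
      by (auto simp: fun_eq_iff)
    ultimately show "runs (Seq (comp b (case_nat (L + 2) \<rho>) (L + 3)) (Seq (loop (L + 3) (inc L)) (inc (L + 2))))
       (cfg (word_tape x) v w ((g(L := s i, L + 1 := n - i, L + 2 := i))(L + 1 := n - Suc i)))
       (cfg (word_tape x) v w (g(L := s (Suc i), L + 1 := n - Suc i, L + 2 := Suc i))) (H + ((3 * H + 1) + 1))"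
      by simp
  qed (use g in \<open>auto simp: s_def fun_upd_idem\<close>)
  have 3: "runs (clear (L + 2)) (cfg (word_tape x) v w (g(L := s n, L + 2 := n)))
      (cfg (word_tape x) v w (g(L := s n))) (3 * n + 1)"
    by (rule runs_clear) (use g in \<open>auto simp: fun_eq_iff\<close>)
  have "s n \<le> n * H"
    unfolding s_def using sum_bounded_above[of "{..<n}" "\<lambda>j. eval b x (case_nat j ?e)" H] body by auto
  also have "n * H \<le> f m * H" using n by simp
  finally have s: "s n \<le> f m * H" .
  have "n * (4 * H + 4) \<le> f m * (4 * H + 4)" using n by (intro mult_right_mono) auto
  moreover have "n * ((H + ((3 * H + 1) + 1)) + 2) = n * (4 * H + 4)" by (simp add: algebra_simps)
  ultimately have t: "f m + (n * ((H + ((3 * H + 1) + 1)) + 2) + 1 + (3 * n + 1)) \<le> 8 * f m + 2 + f m * (4 * H + 4)"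
    using n by linarith
  have e: "eval (Sum a b) x ?e = s n" by (simp add: s_def n_def)
  have "s n \<le> 8 * f m + 2 + f m * (4 * H + 4)" using s by (simp add: algebra_simps)
  then show "outcome (Sum a b) \<rho> L x g v w (8 * f m + 2 + f m * (4 * h (m + f m) + 4))"
    unfolding e H_def[symmetric] comp.simps
    by (intro conjI le_exI[OF runs_Seq[OF 1 runs_Seq[OF 2 3]]] t)
qed

text \<open>The nesting of sums is fixed by the expression, so the composed bounds remain
  polynomial.\<close>

lemma computes_poly: "\<exists>f. poly_bound f \<and> computes_within a f"
proof (induction a)
  case (Var k)
  show ?case by (rule exI, rule conjI[OF _ computes_Var]) (rule poly_bound_intros)+
next
  case (Const c)
  show ?case by (rule exI, rule conjI[OF _ computes_Const]) (rule poly_bound_intros)+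
next
  case Len
  show ?case by (rule exI, rule conjI[OF _ computes_Len]) (rule poly_bound_intros)+
next
  case (Bit a)
  then obtain f where f: "poly_bound f" "computes_within a f" by blast
  show ?case by (rule exI, rule conjI[OF _ computes_Bit[OF f(2)]]) (rule poly_bound_intros f)+
next
  case (Less a b)
  then obtain f h where f: "poly_bound f" "computes_within a f" "poly_bound h" "computes_within b h" by blast
  show ?case by (rule exI, rule conjI[OF _ computes_Less[OF f(2,4)]]) (rule poly_bound_intros f)+
next
  case (Add a b)
  then obtain f h where f: "poly_bound f" "computes_within a f" "poly_bound h" "computes_within b h" by blast
  show ?case by (rule exI, rule conjI[OF _ computes_Add[OF f(2,4)]]) (rule poly_bound_intros f)+
next
  case (Sum a b)
  then obtain f h where f: "poly_bound f" "computes_within a f" "poly_bound h" "computes_within b h" by blast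
  have fh: "poly_bound (\<lambda>m. h (m + f m))"
    by (rule poly_bound_comp[OF f(3)]) (intro poly_bound_id poly_bound_add f)
  have "mono h" using f(3) by (simp add: poly_bound_def)
  show ?case
    by (rule exI, rule conjI[OF _ computes_Sum[OF f(2,4) \<open>mono h\<close>]])
      (rule fh f poly_bound_id poly_bound_const poly_bound_add poly_bound_mult)+
next
  case (Ren s a)
  then obtain f where f: "poly_bound f" "computes_within a f" by blast
  from f(2) have "computes_within (Ren s a) f"
    unfolding computes_within_def comp.simps eval.simps
  proof (intro allI impI)
    fix \<rho> :: "nat \<Rightarrow> nat" and L :: nat and x :: "bool list" and g :: "nat \<Rightarrow> nat" and m :: nat and v w :: tape
    assume "\<forall>k. \<rho> k < L" "\<forall>r\<ge>L. g r = 0" "\<forall>k. g (\<rho> k) \<le> m" "length x \<le> m"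
    then show "eval a x (\<lambda>k. g (\<rho> (s k))) \<le> f m \<and> runs (comp a (\<lambda>k. \<rho> (s k)) L) (cfg (word_tape x) v w g)
      (cfg (word_tape x) v w (g(L := eval a x (\<lambda>k. g (\<rho> (s k)))))) (f m)"
      using f(2)[unfolded computes_within_def, rule_format, of "\<lambda>k. \<rho> (s k)" L g m x v w] by blast
  qed
  with f(1) show ?case by blast
qed

section \<open>Polynomial time for definable functions\<close>

definition definable :: "(bool list \<Rightarrow> (nat \<Rightarrow> nat) \<Rightarrow> nat) \<Rightarrow> bool" where
  "definable F \<longleftrightarrow> (\<exists>a. \<forall>x e. F x e = eval a x e)"

definition out_tape :: "bool list \<Rightarrow> tape" where
  "out_tape y = (fst (word_tape y), int (length y))"

definition emit :: "nat \<Rightarrow> nat \<Rightarrow> prog" where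
  "emit j r = Seq (If (r + 3) 1 (Wr j 1) (Wr j 2)) (Seq (Mv j Move_Right) (clear r))"

text \<open>The expression sees nothing but the index of the output bit: every variable is mapped to
  register \<open>3\<close>.\<close>

definition produce :: "nat \<Rightarrow> expr \<Rightarrow> nat \<Rightarrow> prog" where
  "produce j a r = loop r (Seq (comp a (\<lambda>_. 3) 4) (Seq (emit j 4) (inc 3)))"

text \<open>Working from right to left, tape \<open>2\<close> is erased while it is copied, and both
  heads end at their origin. Nothing else on tape \<open>0\<close> is overwritten, so the old and
  the new word must have equal length.\<close>

definition copy_back :: prog where
  "copy_back = Seq (Wh 0 0 (Mv 0 Move_Right)) (Seq (Mv 0 Move_Left) (Seq (Mv 2 Move_Left)
     (Seq (Wh 2 0 (Seq (If 2 1 (Wr 0 1) (Wr 0 2)) (Seq (Wr 2 0) (Seq (Mv 0 Move_Left) (Mv 2 Move_Left)))))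
       (Seq (Mv 0 Move_Right) (Mv 2 Move_Right)))))"

definition rounds :: "expr \<Rightarrow> prog" where
  "rounds a = Seq (comp Len (\<lambda>_. 0) 1) (loop 1 (Seq (comp Len (\<lambda>_. 0) 2)
     (Seq (produce 2 a 2) (Seq (clear 3) copy_back))))"

text \<open>All tapes but the input start blank; a \<open>1\<close> in cell \<open>0\<close> turns a
  blank tape into a counter of value zero.\<close>

fun mark :: "nat \<Rightarrow> prog" where
  "mark 0 = skip"
| "mark (Suc k) = Seq (mark k) (Wr (k + 3) 1)"

text \<open>The working tape is \<open>j\<close>; the contents of the other one of tapes \<open>1\<close> and \<open>2\<close> is \<open>z\<close>.\<close>

abbreviation cfg' :: "nat \<Rightarrow> tape \<Rightarrow> tape \<Rightarrow> tape \<Rightarrow> (nat \<Rightarrow> nat) \<Rightarrow> nat \<Rightarrow> tape" where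
  "cfg' j u o' z g \<equiv> cfg u (if j = 1 then o' else z) (if j = 1 then z else o') g"

lemma word_tape_snoc:
  "(fst (word_tape y))(int (length y) := bit_symbol b) = fst (word_tape (y @ [b]))"
  by (auto simp: word_tape_def fun_eq_iff nth_append)

lemma tape_eqI: "(\<And>i. f (int i) = g (int i)) \<Longrightarrow> (\<And>z. z < 0 \<Longrightarrow> f z = g z) \<Longrightarrow> f = g"
proof (rule ext)
  fix z assume f: "\<And>i. f (int i) = g (int i)" "\<And>z. z < 0 \<Longrightarrow> f z = g z"
  show "f z = g z"
    using f(1)[of "nat z"] f(2)[of z] by (cases "z < 0") auto
qed

lemma runs_emit:
  assumes "j = 1 \<or> j = 2" "b = (0 < g r)"
  shows "runs (emit j r) (cfg' j u (out_tape y) z g) (cfg' j u (out_tape (y @ [b])) z (g(r := 0))) (3 * g r + 4)"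
proof -
  let ?o = "(fst (word_tape (y @ [b])), int (length y))"
  have 1: "runs (If (r + 3) 1 (Wr j 1) (Wr j 2)) (cfg' j u (out_tape y) z g) (cfg' j u ?o z g) (Suc 1)"
  proof (rule runs_If)
    assume "read_tape (cfg' j u (out_tape y) z g (r + 3)) = 1"
    then have "bit_symbol b = 1" using assms(2) by (auto simp: bit_symbol_def split: if_splits)
    then show "runs (Wr j 1) (cfg' j u (out_tape y) z g) (cfg' j u ?o z g) 1"
      using assms(1) word_tape_snoc[of y b] by (intro runs_Wr) (auto simp: cfg_def out_tape_def)
  next
    assume "read_tape (cfg' j u (out_tape y) z g (r + 3)) \<noteq> 1"
    then have "bit_symbol b = 2" using assms(2) by (auto simp: bit_symbol_def split: if_splits)
    then show "runs (Wr j 2) (cfg' j u (out_tape y) z g) (cfg' j u ?o z g) 1"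
      using assms(1) word_tape_snoc[of y b] by (intro runs_Wr) (auto simp: cfg_def out_tape_def)
  qed
  have 2: "runs (Mv j Move_Right) (cfg' j u ?o z g) (cfg' j u (out_tape (y @ [b])) z g) 1"
    by (rule runs_Mv) (use assms(1) in \<open>auto simp: cfg_def fun_eq_iff out_tape_def\<close>)
  have 3: "runs (clear r) (cfg' j u (out_tape (y @ [b])) z g) (cfg' j u (out_tape (y @ [b])) z (g(r := 0))) (3 * g r + 1)"
    by (rule runs_clear) auto
  show ?thesis unfolding emit_def
    by (rule runs_mono[OF runs_Seq[OF 1 runs_Seq[OF 2 3]]]) simp
qed

lemma runs_produce:
  assumes a: "computes_within a f" and j: "j = 1 \<or> j = 2" and r: "r = 1 \<or> r = 2"
    and g: "\<And>k. k \<ge> 3 \<Longrightarrow> g k = 0" and N: "g r = N" "N \<le> m" "length y \<le> m"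
    and g': "\<And>k. g' k = (g(r := 0, 3 := N)) k"
  shows "runs (produce j a r) (cfg' j (word_tape y) (out_tape []) z g)
    (cfg' j (word_tape y) (out_tape (map (\<lambda>i. 0 < eval a y (\<lambda>_. i)) [0..<N])) z g') (m * (4 * f m + 7) + 1)"
proof -
  let ?o = "\<lambda>i. out_tape (map (\<lambda>i. 0 < eval a y (\<lambda>_. i)) [0..<i])"
  let ?G = "\<lambda>i. g(r := N - i, 3 := i)"
  have step: "runs (Seq (comp a (\<lambda>_. 3) 4) (Seq (emit j 4) (inc 3)))
      (cfg' j (word_tape y) (?o i) z ((?G i)(r := N - Suc i)))
      (cfg' j (word_tape y) (?o (Suc i)) z (?G (Suc i))) (4 * f m + 5)" if "i < N" for i
  proof -
    let ?g = "g(r := N - Suc i, 3 := i)"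
    let ?v = "eval a y (\<lambda>_. i)"
    have b: "?v \<le> f m"
      using computes_withinD(1)[OF a, of "\<lambda>_. 3" 4 ?g m y] g N r that by auto
    have 0: "(?G i)(r := N - Suc i) = ?g" using r by auto
    have 1: "runs (comp a (\<lambda>_. 3) 4) (cfg' j (word_tape y) (?o i) z ?g)
      (cfg' j (word_tape y) (?o i) z (?g(4 := ?v))) (f m)"
      by (rule computes_withinD(2)[OF a]) (use g N r that in auto)
    have m: "map (\<lambda>i. 0 < eval a y (\<lambda>_. i)) [0..<Suc i] = map (\<lambda>i. 0 < eval a y (\<lambda>_. i)) [0..<i] @ [0 < ?v]"
      by simp
    have 2: "runs (emit j 4) (cfg' j (word_tape y) (?o i) z (?g(4 := ?v)))
      (cfg' j (word_tape y) (?o (Suc i)) z ((?g(4 := ?v))(4 := 0))) (3 * ?v + 4)"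
      unfolding m using runs_emit[OF j refl, of 4 "word_tape y" "map (\<lambda>i. 0 < eval a y (\<lambda>_. i)) [0..<i]" z "?g(4 := ?v)"]
      by (simp only: fun_upd_same)
    have 3: "runs (inc 3) (cfg' j (word_tape y) (?o (Suc i)) z ((?g(4 := ?v))(4 := 0)))
      (cfg' j (word_tape y) (?o (Suc i)) z (?G (Suc i))) 1"
      by (rule runs_inc) (use g r in \<open>auto simp: fun_eq_iff\<close>)
    show ?thesis unfolding 0
      by (rule runs_mono[OF runs_Seq[OF 1 runs_Seq[OF 2 3]]]) (use b in simp)
  qed
  show ?thesis unfolding produce_def
  proof (rule runs_loop[where n = N and N = "4 * f m + 5" and u = "\<lambda>_. word_tape y" and v = "\<lambda>i. if j = 1 then ?o i else z"
        and w = "\<lambda>i. if j = 1 then z else ?o i" and G = ?G])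
    show "(?G i) r = N - i" for i using r by auto
    show "cfg' j (word_tape y) (out_tape []) z g = cfg' j (word_tape y) (?o 0) z (?G 0)"
      by (simp only: upt_conv_Nil[OF order_refl] list.map) (rule cfg_eqI, use N g in auto)
    show "cfg' j (word_tape y) (?o N) z g' = cfg' j (word_tape y) (?o N) z (?G N)"
      by (rule cfg_eqI) (use g' in auto)
    show "N * (4 * f m + 5 + 2) + 1 \<le> m * (4 * f m + 7) + 1"
      using mult_right_mono[OF N(2), of "4 * f m + 7"] by (simp add: add.commute)
  qed (rule step)
qed

lemma runs_Wr0: "u' = ((fst u)(snd u := a), snd u) \<Longrightarrow> 1 \<le> n \<Longrightarrow>
    runs (Wr 0 a) (cfg u v w g) (cfg u' v w g) n"
  by (rule runs_Wr) (auto simp: cfg_def)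

lemma runs_Wr2: "w' = ((fst w)(snd w := a), snd w) \<Longrightarrow> 1 \<le> n \<Longrightarrow>
    runs (Wr 2 a) (cfg u v w g) (cfg u v w' g) n"
  by (rule runs_Wr) (auto simp: cfg_def)

lemma runs_copy_back:
  assumes l: "length y = length x"
  shows "runs copy_back (cfg (word_tape x) v (out_tape y) g) (cfg (word_tape y) v (word_tape []) g) (8 * length x + 6)"
proof -
  let ?n = "length x"
  let ?u = "\<lambda>k. (fst (word_tape (take k x @ drop k y)), int k - 1)"
  let ?w = "\<lambda>k. (fst (word_tape (take k y)), int k - 1)"
  have 1: "runs (Wh 0 0 (Mv 0 Move_Right)) (cfg (word_tape x) v (out_tape y) g)
     (cfg (fst (word_tape x), int ?n) v (out_tape y) g) (?n * Suc 1 + 1)"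
    by (rule runs_Wh[where s = "\<lambda>i. cfg (fst (word_tape x), int i) v (out_tape y) g"])
      (auto simp: bit_symbol_def cfg_def fun_eq_iff word_tape_def intro!: runs_head0)
  have 2: "runs (Mv 0 Move_Left) (cfg (fst (word_tape x), int ?n) v (out_tape y) g) (cfg (?u ?n) v (out_tape y) g) 1"
    by (rule runs_Mv) (use l in \<open>auto simp: cfg_def fun_eq_iff\<close>)
  have 3: "runs (Mv 2 Move_Left) (cfg (?u ?n) v (out_tape y) g) (cfg (?u ?n) v (?w ?n) g) 1"
    by (rule runs_Mv) (use l in \<open>auto simp: cfg_def fun_eq_iff out_tape_def\<close>)
  let ?B = "Seq (If 2 1 (Wr 0 1) (Wr 0 2)) (Seq (Wr 2 0) (Seq (Mv 0 Move_Left) (Mv 2 Move_Left)))"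
  have B: "runs ?B (cfg (?u (Suc k)) v (?w (Suc k)) g) (cfg (?u k) v (?w k) g) 5" if k: "k < ?n" for k
  proof -
    have y: "fst (word_tape (take (Suc k) y)) (int k) = bit_symbol (y ! k)"
      using k l by simp
    have c: "(fst (word_tape (take (Suc k) x @ drop (Suc k) y)))(int k := bit_symbol (y ! k)) =
      fst (word_tape (take k x @ drop k y))"
      by (rule tape_eqI) (use k l in \<open>auto simp: nth_append min_def less_Suc_eq word_tape_def\<close>)
    have c': "(fst (word_tape (take (Suc k) y)))(int k := 0) = fst (word_tape (take k y))"
      by (rule tape_eqI) (use k l in \<open>auto simp: less_Suc_eq word_tape_def\<close>)
    have 1: "runs (If 2 1 (Wr 0 1) (Wr 0 2)) (cfg (?u (Suc k)) v (?w (Suc k)) g)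
      (cfg (fst (?u k), int k) v (?w (Suc k)) g) (Suc 1)"
    proof (rule runs_If)
      assume "read_tape (cfg (?u (Suc k)) v (?w (Suc k)) g 2) = 1"
      with y have "bit_symbol (y ! k) = 1" by simp
      from c[unfolded this] show "runs (Wr 0 1) (cfg (?u (Suc k)) v (?w (Suc k)) g)
        (cfg (fst (?u k), int k) v (?w (Suc k)) g) 1"
        by (intro runs_Wr0) simp_all
    next
      assume "read_tape (cfg (?u (Suc k)) v (?w (Suc k)) g 2) \<noteq> 1"
      with y have "bit_symbol (y ! k) = 2" by (auto simp: bit_symbol_def split: if_splits)
      from c[unfolded this] show "runs (Wr 0 2) (cfg (?u (Suc k)) v (?w (Suc k)) g)
        (cfg (fst (?u k), int k) v (?w (Suc k)) g) 1"
        by (intro runs_Wr0) simp_all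
    qed
    have 2: "runs (Wr 2 0) (cfg (fst (?u k), int k) v (?w (Suc k)) g)
      (cfg (fst (?u k), int k) v (fst (?w k), int k) g) 1"
      by (rule runs_Wr2) (use c' in simp_all)
    have 3: "runs (Mv 0 Move_Left) (cfg (fst (?u k), int k) v (fst (?w k), int k) g)
      (cfg (?u k) v (fst (?w k), int k) g) 1"
      by (rule runs_Mv) (auto simp: cfg_def fun_eq_iff)
    have 4: "runs (Mv 2 Move_Left) (cfg (?u k) v (fst (?w k), int k) g) (cfg (?u k) v (?w k) g) 1"
      by (rule runs_Mv) (auto simp: cfg_def fun_eq_iff)
    show ?thesis
      by (rule runs_mono[OF runs_Seq[OF 1 runs_Seq[OF 2 runs_Seq[OF 3 4]]]]) simp
  qed
  have 4: "runs (Wh 2 0 ?B) (cfg (?u ?n) v (?w ?n) g) (cfg (?u 0) v (?w 0) g) (?n * Suc 5 + 1)"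
  proof (rule runs_Wh[where s = "\<lambda>i. cfg (?u (?n - i)) v (?w (?n - i)) g"])
    fix i assume i: "i < ?n"
    then have "Suc (?n - Suc i) = ?n - i" "?n - Suc i < ?n" by auto
    with B[of "?n - Suc i"] show "runs ?B (cfg (?u (?n - i)) v (?w (?n - i)) g) (cfg (?u (?n - Suc i)) v (?w (?n - Suc i)) g) 5"
      by simp
    from i show "read_tape (cfg (?u (?n - i)) v (?w (?n - i)) g 2) \<noteq> 0"
      using l by (auto simp: word_tape_def bit_symbol_def)
  qed (auto simp: word_tape_def)
  have 5: "runs (Mv 0 Move_Right) (cfg (?u 0) v (?w 0) g) (cfg (word_tape y) v (?w 0) g) 1"
    by (rule runs_Mv) (auto simp: cfg_def fun_eq_iff word_tape_def)
  have 6: "runs (Mv 2 Move_Right) (cfg (word_tape y) v (?w 0) g) (cfg (word_tape y) v (word_tape []) g) 1"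
    by (rule runs_Mv) (auto simp: cfg_def fun_eq_iff word_tape_def)
  show ?thesis unfolding copy_back_def
    by (rule runs_mono[OF runs_Seq[OF 1 runs_Seq[OF 2 runs_Seq[OF 3 runs_Seq[OF 4 runs_Seq[OF 5 6]]]]]]) simp
qed

definition revise :: "expr \<Rightarrow> bool list \<Rightarrow> bool list" where
  "revise a y = map (\<lambda>i. 0 < eval a y (\<lambda>_. i)) [0..<length y]"

lemma length_revise [simp]: "length (revise a y) = length y" "length ((revise a ^^ n) y) = length y"
  by (simp add: revise_def, induction n) (simp_all add: revise_def)

lemma runs_rounds:
  assumes a: "computes_within a f"
  shows "runs (rounds a) (cfg (word_tape x) v (word_tape []) (\<lambda>_. 0))
    (cfg (word_tape ((revise a ^^ length x) x)) v (word_tape []) (\<lambda>_. 0))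
    (10 * length x + 11 + length x * (length x * (4 * f (length x) + 7) + 21 * length x + 20))"
proof -
  let ?n = "length x"
  let ?y = "\<lambda>i. (revise a ^^ i) x"
  let ?G = "\<lambda>i. (\<lambda>_. 0)(1 := ?n - i)"
  let ?B = "Seq (comp Len (\<lambda>_. 0) 2) (Seq (produce 2 a 2) (Seq (clear 3) copy_back))"
  let ?N = "?n * (4 * f ?n + 7) + 21 * ?n + 18"
  have o: "out_tape [] = word_tape []" by (simp add: out_tape_def word_tape_def)
  have 1: "runs (comp Len (\<lambda>_. 0) 1) (cfg (word_tape x) v (word_tape []) (\<lambda>_. 0))
     (cfg (word_tape x) v (word_tape []) (?G 0)) (10 * ?n + 10)"
    by (rule computes_withinD(2)[OF computes_Len]) auto
  have B: "runs ?B (cfg (word_tape (?y i)) v (word_tape []) (?G (Suc i)))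
     (cfg (word_tape (?y (Suc i))) v (word_tape []) (?G (Suc i))) ?N" if "i < ?n" for i
  proof -
    let ?g = "?G (Suc i)"
    have 1: "runs (comp Len (\<lambda>_. 0) 2) (cfg (word_tape (?y i)) v (word_tape []) ?g)
      (cfg (word_tape (?y i)) v (word_tape []) (?g(2 := ?n))) (10 * ?n + 10)"
      by (rule computes_withinD(2)[OF computes_Len]) auto
    have 2: "runs (produce 2 a 2) (cfg (word_tape (?y i)) v (word_tape []) (?g(2 := ?n)))
      (cfg (word_tape (?y i)) v (out_tape (?y (Suc i))) (?g(3 := ?n))) (?n * (4 * f ?n + 7) + 1)"
      using runs_produce[OF a, of 2 2 "?g(2 := ?n)" ?n ?n "?y i" "?g(3 := ?n)" v]
      by (simp add: o) (simp add: revise_def)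
    have 3: "runs (clear 3) (cfg (word_tape (?y i)) v (out_tape (?y (Suc i))) (?g(3 := ?n)))
      (cfg (word_tape (?y i)) v (out_tape (?y (Suc i))) ?g) (3 * ?n + 1)"
      by (rule runs_clear) auto
    have 4: "runs copy_back (cfg (word_tape (?y i)) v (out_tape (?y (Suc i))) ?g)
      (cfg (word_tape (?y (Suc i))) v (word_tape []) ?g) (8 * ?n + 6)"
      using runs_copy_back[of "?y (Suc i)" "?y i" v ?g] by simp
    show ?thesis by (rule runs_mono[OF runs_Seq[OF 1 runs_Seq[OF 2 runs_Seq[OF 3 4]]]]) simp
  qed
  have 2: "runs (loop 1 ?B) (cfg (word_tape x) v (word_tape []) (?G 0))
     (cfg (word_tape (?y ?n)) v (word_tape []) (\<lambda>_. 0)) (?n * (?N + 2) + 1)"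
    by (rule runs_loop[where n = ?n and N = ?N and u = "\<lambda>i. word_tape (?y i)" and v = "\<lambda>_. v"
        and w = "\<lambda>_. word_tape []" and G = ?G]) (use B in \<open>auto intro!: cfg_eqI\<close>)
  show ?thesis unfolding rounds_def
    by (rule runs_mono[OF runs_Seq[OF 1 2]]) simp
qed

lemma runs_mark:
  assumes "k \<le> K"
  shows "runs (mark k) (\<lambda>j. if 3 \<le> j \<and> j < K + 3 then word_tape [] else cfg u v w (\<lambda>_. 0) j)
    (\<lambda>j. if k + 3 \<le> j \<and> j < K + 3 then word_tape [] else cfg u v w (\<lambda>_. 0) j) (k + 1)"
  using assms
proof (induction k)
  case (Suc k)
  have "runs (Wr (k + 3) 1) (\<lambda>j. if k + 3 \<le> j \<and> j < K + 3 then word_tape [] else cfg u v w (\<lambda>_. 0) j)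
     (\<lambda>j. if Suc k + 3 \<le> j \<and> j < K + 3 then word_tape [] else cfg u v w (\<lambda>_. 0) j) 1"
    by (rule runs_Wr) (use Suc.prems in \<open>auto simp: fun_eq_iff word_tape_def cfg_def\<close>)
  from runs_Seq[OF Suc.IH this] Suc.prems show ?case by simp
qed (simp add: runs_skip)

text \<open>A program addresses finitely many tapes. Saying so with \<open>eventually\<close> avoids
  counting registers and combines by conjunction.\<close>

lemma eventually_prog_ok_comp: "\<forall>\<^sub>F k in sequentially. prog_ok k (comp a \<rho> L)"
proof (induction a arbitrary: \<rho> L)
  case (Const c)
  show ?case
    by (simp, induction c)
      (simp_all add: skip_def inc_def eventually_conj_iff eventually_gt_at_top)
qed (simp_all add: loop_def inc_def dec_def clear_def skip_def dec_sat_def eventually_conj_iff eventually_gt_at_top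
    del: One_nat_def)

lemma prog_ok_mark: "prog_ok (K + 3) (mark k)" if "k \<le> K" for k
  using that by (induction k) (simp_all add: skip_def)

text \<open>Expression \<open>a\<close> revises the word in each round; on the final word,
  \<open>c\<close> gives the length of the output and \<open>b\<close> its bits.\<close>

lemma polytime_revise:
  "polytime_computable_on UNIV (\<lambda>x. let y = (revise a ^^ length x) x in
     map (\<lambda>i. 0 < eval b y (\<lambda>_. i)) [0..<eval c y (\<lambda>_. 0)])"
proof -
  let ?p = "Seq (rounds a) (Seq (comp c (\<lambda>_. 0) 1) (produce 1 b 1))"
  obtain f where f: "poly_bound f" "computes_within a f" using computes_poly by blast
  obtain g where g: "poly_bound g" "computes_within b g" using computes_poly by blast
  obtain h where h: "poly_bound h" "computes_within c h" using computes_poly by blast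
  have "\<forall>\<^sub>F k in sequentially. prog_ok k ?p"
    using eventually_prog_ok_comp[of a] eventually_prog_ok_comp[of b] eventually_prog_ok_comp[of c]
    by (simp add: rounds_def produce_def emit_def copy_back_def loop_def inc_def dec_def clear_def skip_def
        eventually_conj_iff eventually_gt_at_top)
  then obtain K where K: "prog_ok (K + 3) ?p"
    unfolding eventually_sequentially by (meson le_add1)
  define t where "t = (\<lambda>n. (10 * n + 11 + n * (n * (4 * f n + 7) + 21 * n + 20)) +
     (h n + ((n + h n) * (4 * g (n + h n) + 7) + 1)))"
  have gh: "poly_bound (\<lambda>n. g (n + h n))"
    by (rule poly_bound_comp[OF g(1)]) (intro poly_bound_add poly_bound_id h)
  have "poly_bound (\<lambda>n. (K + 1) + t n)"
    unfolding t_def by (intro poly_bound_intros f h gh)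
  then obtain p where p: "\<And>n. (K + 1) + t n \<le> poly p n" by (auto simp: poly_bound_def)
  let ?M = "machine (K + 3) (Seq (mark K) ?p)"
  have tm: "is_turing_machine ?M"
    by (rule is_turing_machine_machine) (use K prog_ok_mark in auto)
  have "\<exists>s\<le>poly p (length x). halted_with_output ?M ((tm_step ?M ^^ s) (tm_start ?M x))
     (let y = (revise a ^^ length x) x in map (\<lambda>i. 0 < eval b y (\<lambda>_. i)) [0..<eval c y (\<lambda>_. 0)])" for x
  proof -
    let ?n = "length x"
    define y where "y = (revise a ^^ length x) x"
    define N where "N = eval c y (\<lambda>_. 0)"
    define z where "z = map (\<lambda>i. 0 < eval b y (\<lambda>_. i)) [0..<N]"
    have y: "length y = ?n" by (simp add: y_def)
    have o: "out_tape [] = word_tape []" by (simp add: out_tape_def word_tape_def)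
    let ?s = "\<lambda>j. if 3 \<le> j \<and> j < K + 3 then word_tape [] else cfg (word_tape x) (word_tape []) (word_tape []) (\<lambda>_. 0) j"
    have 1: "runs (mark K) ?s (cfg (word_tape x) (word_tape []) (word_tape []) (\<lambda>_. 0)) (K + 1)"
      using runs_mark[of K K "word_tape x" "word_tape []" "word_tape []"]
      by (simp add: not_less[symmetric] cong: conj_cong)
    note 2 = runs_rounds[OF f(2), of x "word_tape []", folded y_def]
    have N: "N \<le> h ?n"
      using computes_withinD(1)[OF h(2), of "\<lambda>_. 0" 1 "\<lambda>_. 0" ?n y] by (simp add: N_def y)
    have 3: "runs (comp c (\<lambda>_. 0) 1) (cfg (word_tape y) (word_tape []) (word_tape []) (\<lambda>_. 0))
      (cfg (word_tape y) (word_tape []) (word_tape []) ((\<lambda>_. 0)(1 := N))) (h ?n)"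
      by (rule computes_withinD(2)[OF h(2)]) (auto simp: N_def y)
    have 4: "runs (produce 1 b 1) (cfg (word_tape y) (word_tape []) (word_tape []) ((\<lambda>_. 0)(1 := N)))
      (cfg (word_tape y) (out_tape z) (word_tape []) ((\<lambda>_. 0)(3 := N)))
      ((?n + h ?n) * (4 * g (?n + h ?n) + 7) + 1)"
      using runs_produce[OF g(2), of 1 1 "(\<lambda>_. 0)(1 := N)" N "?n + h ?n" y "(\<lambda>_. 0)(3 := N)" "word_tape []"] N y
      by (simp add: o z_def)
    have "runs (Seq (mark K) ?p) ?s (cfg (word_tape y) (out_tape z) (word_tape []) ((\<lambda>_. 0)(3 := N))) (poly p ?n)"
      by (rule runs_mono[OF runs_Seq[OF 1 runs_Seq[OF 2 runs_Seq[OF 3 4]]]]) (use p[of ?n] in \<open>simp add: t_def\<close>)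
    from runs_machine[OF this, of "K + 3"] K prog_ok_mark obtain s where s: "s \<le> poly p ?n"
      "(tm_step ?M ^^ s) (0, map ?s [0..<K + 3]) =
        (states (Seq (mark K) ?p), map (cfg (word_tape y) (out_tape z) (word_tape []) ((\<lambda>_. 0)(3 := N))) [0..<K + 3])"
      by auto
    have "map ?s [0..<K + 3] = word_tape x # replicate (K + 2) (word_tape [])"
      by (rule nth_equalityI) (auto simp: nth_Cons cfg_def split: nat.split)
    then have "(tm_step ?M ^^ s) (tm_start ?M x) =
        (states (Seq (mark K) ?p), map (cfg (word_tape y) (out_tape z) (word_tape []) ((\<lambda>_. 0)(3 := N))) [0..<K + 3])"
      using s(2) by (simp add: tm_start_def del: upt_Suc)
    then have "halted_with_output ?M ((tm_step ?M ^^ s) (tm_start ?M x)) z"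
      by (simp add: halted_with_output_def out_tape_def del: upt_Suc)
    with s(1) show ?thesis unfolding Let_def y_def[symmetric] N_def[symmetric] z_def[symmetric] by blast
  qed
  with tm show ?thesis unfolding polytime_computable_on_def by blast
qed

section \<open>Closure properties of definable functions and predicates\<close>

lemma definable_var: "definable (\<lambda>x e. e k)"
  unfolding definable_def by (rule exI[of _ "Var k"]) simp

lemma definable_const: "definable (\<lambda>x e. c)"
  unfolding definable_def by (rule exI[of _ "Const c"]) simp

lemma definable_length: "definable (\<lambda>x e. length x)"
  unfolding definable_def by (rule exI[of _ Len]) simp

lemma definable_add: "definable a \<Longrightarrow> definable b \<Longrightarrow> definable (\<lambda>x e. a x e + b x e)"
  unfolding definable_def by (metis eval.simps(6))

lemma definable_ren: "definable a \<Longrightarrow> definable (\<lambda>x e. a x (\<lambda>k. e (f k)))"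
  unfolding definable_def by (metis eval.simps(8))

text \<open>In the second premise the summation index has become variable \<open>0\<close> and the
  other variables are shifted; this is the shape on which the closure rules work by
  \<open>intro\<close>.\<close>

lemma definable_sum:
  assumes "definable a" "definable (\<lambda>x e. b x (\<lambda>k. e (Suc k)) (e 0))"
  shows "definable (\<lambda>x e. \<Sum>i<a x e. b x e i)"
proof -
  obtain c d where "\<And>x e. a x e = eval c x e" "\<And>x e. b x (\<lambda>k. e (Suc k)) (e 0) = eval d x e"
    using assms unfolding definable_def by blast
  then have "(\<Sum>i<a x e. b x e i) = eval (Sum c d) x e" for x e
    by (simp flip: \<open>\<And>x e. b x (\<lambda>k. e (Suc k)) (e 0) = eval d x e\<close>)
  then show ?thesis unfolding definable_def by blast
qed

abbreviation decidable :: "(bool list \<Rightarrow> (nat \<Rightarrow> nat) \<Rightarrow> bool) \<Rightarrow> bool" where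
  "decidable P \<equiv> definable (\<lambda>x e. of_bool (P x e))"

definition bit_at :: "bool list \<Rightarrow> nat \<Rightarrow> bool" where
  "bit_at x i \<longleftrightarrow> i < length x \<and> x ! i"

lemma decidable_bit: "definable a \<Longrightarrow> decidable (\<lambda>x e. bit_at x (a x e))"
  unfolding definable_def bit_at_def by (metis eval.simps(4))

lemma decidable_less: "definable a \<Longrightarrow> definable b \<Longrightarrow> decidable (\<lambda>x e. a x e < b x e)"
  unfolding definable_def by (metis eval.simps(5))

lemma definable_mult:
  assumes "definable a" "definable b" shows "definable (\<lambda>x e. a x e * b x e)"
  using definable_sum[OF assms(1), of "\<lambda>x e i. b x e"] definable_ren[OF assms(2), of Suc] by simp

lemma decidable_not:
  assumes "decidable P" shows "decidable (\<lambda>x e. \<not> P x e)"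
proof -
  have "(\<lambda>x e. of_bool (\<not> P x e)) = (\<lambda>x e. of_bool (of_bool (P x e) < (1::nat)) :: nat)" by auto
  then show ?thesis using decidable_less[OF assms definable_const[of 1]] by simp
qed

lemma decidable_conj:
  assumes "decidable P" "decidable Q" shows "decidable (\<lambda>x e. P x e \<and> Q x e)"
  using definable_mult[OF assms] by (simp add: of_bool_conj)

lemma decidable_disj:
  assumes "decidable P" "decidable Q" shows "decidable (\<lambda>x e. P x e \<or> Q x e)"
proof -
  have "decidable (\<lambda>x e. \<not> (\<not> P x e \<and> \<not> Q x e))"
    by (intro decidable_not decidable_conj assms)
  then show ?thesis by simp
qed

lemma decidable_imp:
  assumes "decidable P" "decidable Q" shows "decidable (\<lambda>x e. P x e \<longrightarrow> Q x e)"
proof -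
  have "decidable (\<lambda>x e. \<not> P x e \<or> Q x e)"
    by (intro decidable_not decidable_disj assms)
  then show ?thesis by simp
qed

lemma decidable_le: "definable a \<Longrightarrow> definable b \<Longrightarrow> decidable (\<lambda>x e. a x e \<le> b x e)"
  unfolding not_less[symmetric] by (intro decidable_not decidable_less)

lemma decidable_eq:
  assumes "definable a" "definable b" shows "decidable (\<lambda>x e. a x e = b x e)"
  unfolding eq_iff by (intro decidable_conj decidable_le assms)

lemma decidable_iff:
  assumes "decidable P" "decidable Q" shows "decidable (\<lambda>x e. P x e \<longleftrightarrow> Q x e)"
proof -
  have "decidable (\<lambda>x e. (of_bool (P x e) :: nat) = of_bool (Q x e))"
    by (intro decidable_eq assms)
  then show ?thesis by (simp only: of_bool_eq_iff)
qed

lemma decidable_ex: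
  assumes "definable a" "decidable (\<lambda>x e. P x (\<lambda>k. e (Suc k)) (e 0))"
  shows "decidable (\<lambda>x e. \<exists>i<a x e. P x e i)"
proof -
  have "(\<lambda>x e. of_bool (\<exists>i<a x e. P x e i)) = (\<lambda>x e. of_bool (0 < (\<Sum>i<a x e. of_bool (P x e i) :: nat)) :: nat)"
    by (intro ext) (auto simp flip: neq0_conv)
  moreover have "decidable (\<lambda>x e. 0 < (\<Sum>i<a x e. of_bool (P x e i) :: nat))"
    by (intro decidable_less definable_const definable_sum assms)
  ultimately show ?thesis by simp
qed

lemma decidable_all:
  assumes "definable a" "decidable (\<lambda>x e. P x (\<lambda>k. e (Suc k)) (e 0))"
  shows "decidable (\<lambda>x e. \<forall>i<a x e. P x e i)"
proof -
  have "decidable (\<lambda>x e. \<not> (\<exists>i<a x e. \<not> P x e i))"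
    by (intro decidable_not decidable_ex assms)
  then show ?thesis by simp
qed

lemma definable_if:
  assumes "decidable P" "definable a" "definable b"
  shows "definable (\<lambda>x e. if P x e then a x e else b x e)"
proof -
  have "(\<lambda>x e. if P x e then a x e else b x e) = (\<lambda>x e. of_bool (P x e) * a x e + of_bool (\<not> P x e) * b x e)"
    by (intro ext) simp
  moreover have "definable (\<lambda>x e. of_bool (P x e) * a x e + of_bool (\<not> P x e) * b x e)"
    by (intro definable_add definable_mult decidable_not assms)
  ultimately show ?thesis by simp
qed

lemma definable_minus:
  assumes "definable a" "definable b" shows "definable (\<lambda>x e. a x e - b x e)"
proof -
  have "(\<Sum>i<m. of_bool (n \<le> i)) = m - n" for m n :: nat
    by (induction m) auto
  then have "(\<lambda>x e. a x e - b x e) = (\<lambda>x e. \<Sum>i<a x e. of_bool (b x e \<le> i))"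
    by (intro ext) simp
  moreover have "definable (\<lambda>x e. \<Sum>i<a x e. of_bool (b x e \<le> i))"
    by (intro definable_sum decidable_le definable_var definable_ren[OF assms(2)] assms(1))
  ultimately show ?thesis by simp
qed

lemma definable_div:
  assumes "definable a" "definable b" shows "definable (\<lambda>x e. a x e div b x e)"
proof -
  \<comment> \<open>The range \<open>k\<close> is separated from \<open>m\<close> for the induction.
    The conjunct \<open>0 < n\<close> yields zero for divisor zero, in accordance with
    \<open>m div 0 = 0\<close>.\<close>
  have "(\<Sum>i<k. of_bool (Suc i * n \<le> m \<and> 0 < n)) = min k (m div n)" for k m n :: nat
  proof (induction k)
    case (Suc k)
    have "Suc k * n \<le> m \<and> 0 < n \<longleftrightarrow> Suc k \<le> m div n"
      by (cases "n = 0") (simp_all add: less_eq_div_iff_mult_less_eq)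
    with Suc show ?case by (auto simp: min_def)
  qed simp
  then have "(\<Sum>i<m. of_bool (Suc i * n \<le> m \<and> 0 < n)) = m div n" for m n :: nat
    by (simp only: min_absorb2 div_le_dividend)
  then have "(\<lambda>x e. a x e div b x e) = (\<lambda>x e. \<Sum>i<a x e. of_bool ((i + 1) * b x e \<le> a x e \<and> 0 < b x e))"
    by (intro ext) simp
  moreover have "definable (\<lambda>x e. \<Sum>i<a x e. of_bool ((i + 1) * b x e \<le> a x e \<and> 0 < b x e))"
    by (intro definable_sum decidable_conj decidable_less decidable_le definable_mult definable_add
        definable_var definable_const definable_ren[OF assms(1)] definable_ren[OF assms(2)] assms(1))
  ultimately show ?thesis by simp
qed

lemma definable_mod:
  assumes "definable a" "definable b" shows "definable (\<lambda>x e. a x e mod b x e)"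
  unfolding minus_div_mult_eq_mod[symmetric] by (intro definable_minus definable_mult definable_div assms)

lemma definable_Suc: "definable a \<Longrightarrow> definable (\<lambda>x e. Suc (a x e))"
  unfolding Suc_eq_plus1 by (intro definable_add definable_const)

lemma decidable_if:
  assumes "decidable P" "decidable Q" "decidable R"
  shows "decidable (\<lambda>x e. if P x e then Q x e else R x e)"
  using definable_if[OF assms] by (simp only: if_distrib)

text \<open>This hard-wires a finite table, such as that of a fixed machine, into an
  expression.\<close>

lemma definable_cases:
  assumes "definable a" "\<And>k. k < K \<Longrightarrow> definable (g k)"
  shows "definable (\<lambda>x e. if a x e < K then g (a x e) x e else 0)"
  using assms(2)
proof (induction K)
  case 0
  then show ?case by (simp add: definable_const)
next
  case (Suc K)
  have "(\<lambda>x e. if a x e < Suc K then g (a x e) x e else 0) =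
    (\<lambda>x e. if a x e = K then g K x e else if a x e < K then g (a x e) x e else 0)"
    by (intro ext) (auto simp: less_Suc_eq)
  moreover have "definable (\<lambda>x e. if a x e = K then g K x e else if a x e < K then g (a x e) x e else 0)"
    by (rule definable_if, rule decidable_eq, rule assms(1), rule definable_const, rule Suc.prems, simp,
        rule Suc.IH, rule Suc.prems) simp
  ultimately show ?case by simp
qed

lemma definable_lookup: "definable a \<Longrightarrow> definable (\<lambda>x e. if a x e < K then f (a x e) else 0)"
  by (rule definable_cases) (auto intro: definable_const)

lemma definable_poly: "definable a \<Longrightarrow> definable (\<lambda>x e. poly p (a x e))"
  by (induction p) (auto intro!: definable_add definable_mult definable_const)

lemmas definable_intros = definable_var definable_const definable_length definable_sum
  definable_add definable_mult definable_minus definable_div definable_mod definable_Suc definable_if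
  decidable_bit decidable_less decidable_le decidable_eq decidable_not decidable_conj decidable_disj
  decidable_imp decidable_iff decidable_ex decidable_all decidable_if

lemma polytime_iterate:
  assumes S: "decidable (\<lambda>x e. S x (e 0))" and P: "decidable (\<lambda>x e. P x (e 0))" and g: "definable (\<lambda>x e. g x)"
  shows "polytime_computable_on UNIV (\<lambda>x. let y = ((\<lambda>y. map (S y) [0..<length y]) ^^ length x) x in map (P y) [0..<g y])"
proof -
  obtain a where a: "\<And>x e. of_bool (S x (e 0)) = eval a x e" using S unfolding definable_def by blast
  obtain b where b: "\<And>x e. of_bool (P x (e 0)) = eval b x e" using P unfolding definable_def by blast
  obtain c where c: "\<And>x e. g x = eval c x e" using g unfolding definable_def by blast
  have "S x i = (0 < eval a x (\<lambda>_. i))" "P x i = (0 < eval b x (\<lambda>_. i))" for x i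
    using a[of x "\<lambda>_. i", symmetric] b[of x "\<lambda>_. i", symmetric] by simp_all
  then have "S = (\<lambda>x i. 0 < eval a x (\<lambda>_. i))" "P = (\<lambda>x i. 0 < eval b x (\<lambda>_. i))" "g = (\<lambda>x. eval c x (\<lambda>_. 0))"
    using c by blast+
  then show ?thesis using polytime_revise[of a b c]
    by (simp add: revise_def[abs_def])
qed

lemma polytime_definable:
  assumes P: "decidable (\<lambda>x e. P x (e 0))" and g: "definable (\<lambda>x e. g x)"
  shows "polytime_computable_on UNIV (\<lambda>x. map (P x) [0..<g x])"
proof -
  have i: "map (\<lambda>i. bit_at y i) [0..<length y] = y" for y
    by (rule nth_equalityI) (auto simp: bit_at_def)
  have "((\<lambda>y. map (bit_at y) [0..<length y]) ^^ n) x = x" for n x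
    by (induction n) (simp_all add: i)
  then show ?thesis
    using polytime_iterate[of bit_at P g] assms decidable_bit[OF definable_var, of 0] by simp
qed

lemma polytime_decidable_iterate:
  assumes S: "decidable (\<lambda>x e. S x (e 0))" and P: "decidable (\<lambda>x e. P x)"
  shows "polytime_decidable_on UNIV {x. P (((\<lambda>y. map (S y) [0..<length y]) ^^ length x) x)}"
  using polytime_iterate[OF S, of "\<lambda>x _. P x" "\<lambda>_. 1"] P definable_const[of 1]
  by (simp add: polytime_decidable_on_def Let_def)

lemma polytime_decidable:
  assumes P: "decidable (\<lambda>x e. P x)"
  shows "polytime_decidable_on UNIV {x. P x}"
  using polytime_definable[of "\<lambda>x _. P x" "\<lambda>_. 1"] P definable_const[of 1]
  by (simp add: polytime_decidable_on_def)

section \<open>Hypergraphs given by incidence matrices\<close>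

definition matrix_hypergraph :: "nat \<Rightarrow> nat \<Rightarrow> (nat \<Rightarrow> nat \<Rightarrow> bool) \<Rightarrow> nat hypergraph" where
  "matrix_hypergraph n m M = \<lparr>vertices = {..<n}, hyperedges = map (\<lambda>i. {v. v < n \<and> M i v}) [0..<m]\<rparr>"

lemma matrix_hypergraph_simps [simp]:
  "vertices (matrix_hypergraph n m M) = {..<n}"
  "hyperedges (matrix_hypergraph n m M) = map (\<lambda>i. {v. v < n \<and> M i v}) [0..<m]"
  "edge_indices (matrix_hypergraph n m M) = {..<m}"
  by (simp_all add: matrix_hypergraph_def edge_indices_def)

lemma standard_matrix_hypergraph: "standard_hypergraph (matrix_hypergraph n m M)"
  by (auto simp: standard_hypergraph_def is_hypergraph_def)

lemma standard_hypergraphE: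
  assumes "standard_hypergraph H"
  obtains n m M where "H = matrix_hypergraph n m M"
proof -
  obtain n where n: "vertices H = {..<n}" "\<forall>e\<in>set (hyperedges H). e \<subseteq> {..<n}"
    using assms by (auto simp: standard_hypergraph_def is_hypergraph_def)
  have "hyperedges H = map (\<lambda>i. {v. v < n \<and> v \<in> hyperedges H ! i}) [0..<length (hyperedges H)]"
    using n by (intro nth_equalityI) (auto dest!: nth_mem)
  with n have "H = matrix_hypergraph n (length (hyperedges H)) (\<lambda>i v. v \<in> hyperedges H ! i)"
    by (simp add: matrix_hypergraph_def)
  then show ?thesis by (rule that)
qed

definition matrix_word :: "nat \<Rightarrow> nat \<Rightarrow> (nat \<Rightarrow> nat \<Rightarrow> bool) \<Rightarrow> bool list" where
  "matrix_word n m M = encode_hypergraph (matrix_hypergraph n m M)"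

text \<open>Bit \<open>k\<close> of the encoding: \<open>True\<close> below \<open>n\<close>,
  \<open>False\<close> at \<open>n\<close>, then rows of width \<open>n + 1\<close> whose column
  \<open>0\<close> is the introductory \<open>True\<close>, and \<open>False\<close> at the last
  position.\<close>

definition matrix_bit :: "nat \<Rightarrow> nat \<Rightarrow> (nat \<Rightarrow> nat \<Rightarrow> bool) \<Rightarrow> nat \<Rightarrow> bool" where
  "matrix_bit n m M k \<longleftrightarrow> k < n \<or> n < k \<and> k < n + 1 + m * (n + 1) \<and>
     ((k - (n + 1)) mod (n + 1) = 0 \<or> M ((k - (n + 1)) div (n + 1)) ((k - (n + 1)) mod (n + 1) - 1))"

lemma concat_rows:
  "0 < w \<Longrightarrow> concat (map (\<lambda>i. map (h i) [0..<w]) [0..<m]) = map (\<lambda>k. h (k div w) (k mod w)) [0..<m * w]"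
proof (induction m)
  case (Suc m)
  have "[0..<Suc m * w] = [0..<m * w] @ [m * w..<m * w + w]"
    by (metis add.commute le_add1 mult_Suc upt_add_eq_append zero_le)
  moreover have "map (\<lambda>k. h (k div w) (k mod w)) [m * w..<m * w + w] = map (h m) [0..<w]"
    using Suc.prems by (intro nth_equalityI) auto
  ultimately show ?case using Suc by simp
qed simp

lemma matrix_word_eq: "matrix_word n m M = map (matrix_bit n m M) [0..<n + 2 + m * (n + 1)]"
proof -
  have row: "True # map (\<lambda>v. v \<in> {v. v < n \<and> M i v}) [0..<n] = map (\<lambda>c. c = 0 \<or> M i (c - 1)) [0..<n + 1]" for i
    by (rule nth_equalityI) (simp_all add: nth_Cons del: upt_Suc split: nat.split)
  have "matrix_word n m M = replicate n True @ [False] @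
      map (\<lambda>k. k mod (n + 1) = 0 \<or> M (k div (n + 1)) (k mod (n + 1) - 1)) [0..<m * (n + 1)] @ [False]"
    using concat_rows[of "n + 1" "\<lambda>i c. c = 0 \<or> M i (c - 1)" m] row
    by (simp add: matrix_word_def encode_hypergraph_def comp_def del: upt_Suc mem_Collect_eq)
  also have "\<dots> = map (matrix_bit n m M) [0..<n + 2 + m * (n + 1)]"
    by (rule nth_equalityI) (auto simp: nth_append matrix_bit_def nth_Cons' simp del: upt_Suc)
  finally show ?thesis .
qed

lemma length_matrix_word [simp]: "length (matrix_word n m M) = n + 2 + m * (n + 1)"
  by (simp add: matrix_word_eq del: upt_Suc)

lemma bit_at_matrix_word: "bit_at (matrix_word n m M) k \<longleftrightarrow> k < n + 2 + m * (n + 1) \<and> matrix_bit n m M k"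
  by (auto simp: bit_at_def matrix_word_eq simp del: upt_Suc)

definition vertex_count :: "bool list \<Rightarrow> nat" where
  "vertex_count x = (\<Sum>i<length x. of_bool (\<forall>j<Suc i. bit_at x j))"

definition edge_count :: "bool list \<Rightarrow> nat" where
  "edge_count x = (length x - (vertex_count x + 2)) div (vertex_count x + 1)"

definition entry :: "bool list \<Rightarrow> nat \<Rightarrow> nat \<Rightarrow> bool" where
  "entry x i v = bit_at x (vertex_count x + 2 + i * (vertex_count x + 1) + v)"

text \<open>Decoding is total, so a word is an encoding iff encoding the decoded matrix gives it
  back. This makes the syntax check definable.\<close>

definition well_formed :: "bool list \<Rightarrow> bool" where
  "well_formed x \<longleftrightarrow> x = matrix_word (vertex_count x) (edge_count x) (entry x)"

lemma vertex_count_matrix_word [simp]: "vertex_count (matrix_word n m M) = n"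
proof -
  have "bit_at (matrix_word n m M) j \<longleftrightarrow> j < n" if "j \<le> n" for j
    using that by (auto simp: bit_at_def matrix_word_eq matrix_bit_def nth_append simp del: upt_Suc)
  then have "(\<forall>j<Suc i. bit_at (matrix_word n m M) j) \<longleftrightarrow> i < n" for i
    by (metis less_Suc_eq_le linorder_not_less nat_le_linear order_le_less_trans order_less_le)
  then have "vertex_count (matrix_word n m M) = (\<Sum>i<n + 2 + m * (n + 1). of_bool (i < n))"
    by (simp add: vertex_count_def)
  also have "\<dots> = (\<Sum>i<n. 1)"
    by (rule sum.mono_neutral_cong_right) auto
  finally show ?thesis by simp
qed

lemma edge_count_matrix_word [simp]: "edge_count (matrix_word n m M) = m"
  by (simp add: edge_count_def del: mult_Suc_right)

lemma entry_matrix_word [simp]: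
  assumes "i < m" "v < n" shows "entry (matrix_word n m M) i v = M i v"
proof -
  let ?k = "n + 2 + i * (n + 1) + v"
  have "i * (n + 1) + (n + 1) \<le> m * (n + 1)"
    using mult_le_mono1[of "Suc i" m "n + 1"] assms by simp
  then have k: "?k < n + 1 + m * (n + 1)" using assms by simp
  have "?k - (n + 1) = (v + 1) + (n + 1) * i" by simp
  then have "(?k - (n + 1)) div (n + 1) = i" "(?k - (n + 1)) mod (n + 1) = v + 1"
    using assms by (simp_all only: div_mult_self2 mod_mult_self2) auto
  then have "matrix_bit n m M ?k = M i v" using k by (simp add: matrix_bit_def)
  with k show ?thesis
    unfolding entry_def vertex_count_matrix_word bit_at_matrix_word by auto
qed

lemma matrix_hypergraph_cong:
  "(\<And>i v. i < m \<Longrightarrow> v < n \<Longrightarrow> M i v = M' i v) \<Longrightarrow> matrix_hypergraph n m M = matrix_hypergraph n m M'"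
  by (auto simp: matrix_hypergraph_def)

definition decoded :: "bool list \<Rightarrow> nat hypergraph" where
  "decoded x = matrix_hypergraph (vertex_count x) (edge_count x) (entry x)"

lemma decoded_matrix_word [simp]: "decoded (matrix_word n m M) = matrix_hypergraph n m M"
  unfolding decoded_def vertex_count_matrix_word edge_count_matrix_word
  by (rule matrix_hypergraph_cong) simp

lemma well_formed_matrix_word: "well_formed (matrix_word n m M)"
proof -
  have "matrix_hypergraph n m M = matrix_hypergraph n m (entry (matrix_word n m M))"
    by (rule matrix_hypergraph_cong) simp
  then show ?thesis
    unfolding well_formed_def vertex_count_matrix_word edge_count_matrix_word by (metis matrix_word_def)
qed

lemma mem_hypergraph_words: "x \<in> hypergraph_words P \<longleftrightarrow> well_formed x \<and> P (decoded x)"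
proof
  assume "x \<in> hypergraph_words P"
  then obtain H where H: "x = encode_hypergraph H" "standard_hypergraph H" "P H"
    by (auto simp: hypergraph_words_def)
  from H(2) obtain n m M where "H = matrix_hypergraph n m M" by (rule standard_hypergraphE)
  with H(1) have "x = matrix_word n m M" "H = decoded x" by (simp_all flip: matrix_word_def)
  with H(3) show "well_formed x \<and> P (decoded x)" by (simp add: well_formed_matrix_word)
next
  assume "well_formed x \<and> P (decoded x)"
  then show "x \<in> hypergraph_words P"
    unfolding hypergraph_words_def well_formed_def matrix_word_def decoded_def
    using standard_matrix_hypergraph by auto
qed

lemma matrix_word_mem_hypergraph_words:
  "matrix_word n m M \<in> hypergraph_words P \<longleftrightarrow> P (matrix_hypergraph n m M)"
  by (simp add: mem_hypergraph_words well_formed_matrix_word)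

lemma has_exact_cover_matrix:
  "has_exact_cover (matrix_hypergraph n m M) \<longleftrightarrow> (\<exists>I\<subseteq>{..<m}. \<forall>v<n. \<exists>!i. i \<in> I \<and> M i v)"
proof -
  have "exact_cover (matrix_hypergraph n m M) I \<longleftrightarrow> I \<subseteq> {..<m} \<and> (\<forall>v<n. \<exists>!i. i \<in> I \<and> M i v)" for I
  proof (cases "I \<subseteq> {..<m}")
    case True
    then have e: "hyperedges (matrix_hypergraph n m M) ! i = {v. v < n \<and> M i v}" if "i \<in> I" for i
      using that by (auto simp: subset_iff)
    have "disjoint_family_on (\<lambda>i. hyperedges (matrix_hypergraph n m M) ! i) I \<longleftrightarrow>
        (\<forall>i\<in>I. \<forall>j\<in>I. \<forall>v<n. M i v \<longrightarrow> M j v \<longrightarrow> i = j)"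
      using e by (simp add: disjoint_family_on_def) blast
    moreover have "(\<Union>i\<in>I. hyperedges (matrix_hypergraph n m M) ! i) = {..<n} \<longleftrightarrow> (\<forall>v<n. \<exists>i\<in>I. M i v)"
      using e by auto
    ultimately show ?thesis using True unfolding exact_cover_def
      by (auto 0 3 simp del: matrix_hypergraph_simps(2))
  qed (simp add: exact_cover_def)
  then show ?thesis by (auto simp: has_exact_cover_def)
qed

lemma definable_vertex_count: "definable (\<lambda>x e. vertex_count x)"
  unfolding vertex_count_def by (intro definable_intros)

lemma definable_edge_count: "definable (\<lambda>x e. edge_count x)"
  unfolding edge_count_def by (intro definable_intros definable_vertex_count)

lemma decidable_entry: "definable a \<Longrightarrow> definable b \<Longrightarrow> decidable (\<lambda>x e. entry x (a x e) (b x e))"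
  unfolding entry_def by (intro definable_intros definable_vertex_count)

lemma decidable_matrix_bit:
  assumes "definable n" "definable m" "definable k" "\<And>a b. definable a \<Longrightarrow> definable b \<Longrightarrow> decidable (\<lambda>x e. M x e (a x e) (b x e))"
  shows "decidable (\<lambda>x e. matrix_bit (n x e) (m x e) (M x e) (k x e))"
  unfolding matrix_bit_def by (intro definable_intros assms)

section \<open>Trees and their leaves\<close>

text \<open>Take a longest path. A neighbour of its first vertex \<open>l\<close> lies on the path,
  else it could be prolonged, and at position \<open>1\<close>, else a cycle would close; so
  \<open>l\<close> is a leaf.\<close>

lemma tree_leaf:
  assumes t: "is_tree N F" and ab: "a \<in> N" "b \<in> N" "a \<noteq> b"
  obtains l p where "l \<in> N" "p \<in> N" "l \<noteq> p" "{l, p} \<in> F" "\<And>f. f \<in> F \<Longrightarrow> l \<in> f \<Longrightarrow> f = {l, p}"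
proof -
  define path where "path c \<longleftrightarrow> 2 \<le> length c \<and> distinct c \<and> set c \<subseteq> N \<and>
    (\<forall>i. Suc i < length c \<longrightarrow> {c ! i, c ! Suc i} \<in> F)" for c
  have F: "f \<subseteq> N" "card f = 2" if "f \<in> F" for f using t that by (auto simp: is_tree_def is_graph_def)
  have fin: "finite N" using t by (simp add: is_tree_def is_graph_def)
  have "(a, b) \<in> {(a, b). {a, b} \<in> F}\<^sup>*" using t ab by (auto simp: is_tree_def connected_graph_def)
  then obtain y where y: "{a, y} \<in> F" using ab(3) by (auto elim: converse_rtranclE)
  have p0: "path [a, y]" using y F[OF y] by (auto simp: path_def less_Suc_eq card_2_iff)
  have "\<forall>c. path c \<longrightarrow> length c < Suc (card N)"
    unfolding path_def less_Suc_eq_le using fin by (metis card_mono distinct_card)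
  from ex_has_greatest_nat[OF p0 this] obtain c where c: "path c" and max: "\<And>d. path d \<Longrightarrow> length d \<le> length c"
    by metis
  obtain l p r where lpr: "c = l # p # r"
    using c unfolding path_def by (cases c rule: remdups_adj.cases) auto
  have lp: "{l, p} \<in> F" using c[unfolded path_def] lpr by force
  have "f = {l, p}" if f: "f \<in> F" "l \<in> f" for f
  proof -
    from F(2)[OF f(1)] f(2) obtain z where z: "f = {l, z}" "z \<noteq> l"
      by (auto simp: card_2_iff insert_commute)
    have "z \<in> set c"
    proof (rule ccontr)
      assume "z \<notin> set c"
      moreover have "{(z # c) ! i, (z # c) ! Suc i} \<in> F" if "Suc i < length (z # c)" for i
        using that c f z lpr by (cases i) (auto simp: path_def insert_commute)
      ultimately have "path (z # c)"
        using c F(1)[OF f(1)] z by (auto simp: path_def)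
      from max[OF this] show False by simp
    qed
    then obtain j where j: "j < length c" "c ! j = z" by (auto simp: in_set_conv_nth)
    then have "j \<noteq> 0" using z lpr by (metis nth_Cons_0)
    moreover have "\<not> 2 \<le> j"
    proof
      assume j2: "2 \<le> j"
      have "is_cycle F (take (Suc j) c)"
        unfolding is_cycle_def
      proof (intro conjI allI impI)
        fix i assume i: "i < length (take (Suc j) c)"
        show "{take (Suc j) c ! i, take (Suc j) c ! (Suc i mod length (take (Suc j) c))} \<in> F"
        proof (cases "i = j")
          case True
          have "length (take (Suc j) c) = Suc j" "take (Suc j) c ! j = z" using j by auto
          moreover have "take (Suc j) c ! 0 = l" using lpr by simp
          ultimately show ?thesis using True f(1) z(1) by (simp add: insert_commute)
        next
          case False
          with i j c show ?thesis by (auto simp: min_def path_def)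
        qed
      qed (use j j2 c in \<open>auto simp: path_def\<close>)
      with t show False by (auto simp: is_tree_def)
    qed
    ultimately have "j = 1" by simp
    with j lpr z show ?thesis by simp
  qed
  moreover have "l \<noteq> p" "l \<in> N" "p \<in> N" using c lpr by (auto simp: path_def)
  ultimately show ?thesis using that lp by blast
qed

text \<open>A walk enters and leaves \<open>l\<close> through \<open>p\<close> only. For the
  induction to go through, an end point \<open>l\<close> is replaced by \<open>p\<close>.\<close>

lemma rtrancl_avoid_leaf:
  assumes "(u, v) \<in> {(a, b). {a, b} \<in> E}\<^sup>*" "u \<noteq> l" "l \<noteq> p" "\<And>f. f \<in> E \<Longrightarrow> l \<in> f \<Longrightarrow> f = {l, p}"
    "\<And>f. f \<in> E \<Longrightarrow> l \<notin> f \<Longrightarrow> f \<in> E'"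
  shows "(u, if v = l then p else v) \<in> {(a, b). {a, b} \<in> E'}\<^sup>*"
  using assms(1)
proof (induction rule: rtrancl_induct)
  case (step v w)
  then have vw: "{v, w} \<in> E" by simp
  show ?case
  proof (cases "v = l \<or> w = l")
    case True
    with assms(4)[OF vw] have "{v, w} = {l, p}" by auto
    with step.IH assms(3) show ?thesis by (auto simp: doubleton_eq_iff)
  next
    case False
    with assms(5)[OF vw] have "{v, w} \<in> E'" by auto
    with step.IH False show ?thesis by (auto intro: rtrancl_into_rtrancl)
  qed
qed (use assms in simp)

text \<open>\<open>E'\<close> is general because it stands for the edges of the smaller tree as well
  as for those induced by a smaller vertex set.\<close>

lemma connected_remove_leaf:
  assumes "connected_graph W E" "l \<noteq> p" "\<And>f. f \<in> E \<Longrightarrow> l \<in> f \<Longrightarrow> f = {l, p}"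
    "\<And>f. f \<in> E \<Longrightarrow> l \<notin> f \<Longrightarrow> f \<in> E'"
  shows "connected_graph (W - {l}) E'"
  unfolding connected_graph_def
proof (intro ballI)
  fix u v assume uv: "u \<in> W - {l}" "v \<in> W - {l}"
  then have "(u, v) \<in> {(a, b). {a, b} \<in> E}\<^sup>*" using assms(1) by (auto simp: connected_graph_def)
  from rtrancl_avoid_leaf[OF this _ assms(2-4)] uv show "(u, v) \<in> {(a, b). {a, b} \<in> E'}\<^sup>*" by auto
qed

text \<open>Trees arise by attaching leaves; as the empty graph counts as a tree, there are two base
  cases.\<close>

lemma tree_induct [consumes 1, case_names empty single leaf]:
  assumes "is_tree N F" "P {} {}" "\<And>v. P {v} {}"
    "\<And>N F l p. is_tree N F \<Longrightarrow> l \<notin> N \<Longrightarrow> p \<in> N \<Longrightarrow> P N F \<Longrightarrow> P (insert l N) (insert {l, p} F)"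
  shows "P N F"
  using assms(1)
proof (induction "card N" arbitrary: N F rule: less_induct)
  case less
  have fin: "finite N" and F: "\<And>f. f \<in> F \<Longrightarrow> f \<subseteq> N \<and> card f = 2"
    using less.prems by (auto simp: is_tree_def is_graph_def)
  show ?case
  proof (cases "\<exists>a b. a \<in> N \<and> b \<in> N \<and> a \<noteq> b")
    case False
    have "F = {}" using F False by (fastforce simp: card_2_iff)
    moreover have "N = {} \<or> (\<exists>v. N = {v})" using False by blast
    ultimately show ?thesis using assms(2,3) by blast
  next
    case True
    then obtain l p where lp: "l \<in> N" "p \<in> N" "l \<noteq> p" "{l, p} \<in> F" and u: "\<And>f. f \<in> F \<Longrightarrow> l \<in> f \<Longrightarrow> f = {l, p}"
      using tree_leaf[OF less.prems] by metis
    let ?N = "N - {l}" and ?F = "F - {{l, p}}"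
    have "f \<subseteq> ?N" if "f \<in> ?F" for f using that F[of f] u[of f] by blast
    then have "is_graph ?N ?F" using fin F unfolding is_graph_def by blast
    moreover have "connected_graph ?N ?F"
    proof (rule connected_remove_leaf[where E = F and p = p])
      show "connected_graph N F" using less.prems by (simp add: is_tree_def)
    qed (use lp u in blast)+
    moreover have "\<nexists>c. is_cycle ?F c" using less.prems unfolding is_tree_def is_cycle_def by blast
    ultimately have t: "is_tree ?N ?F" by (simp add: is_tree_def)
    moreover have "card ?N < card N" using fin lp by (meson card_Diff1_less)
    ultimately have "P ?N ?F" using less.hyps by blast
    from assms(4)[OF t _ _ this, of l p] lp show ?thesis by (simp add: insert_absorb)
  qed
qed

lemma connected_neighbour:
  assumes "connected_graph W E" "u \<in> W" "v \<in> W" "u \<noteq> v"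
  obtains w where "{u, w} \<in> E"
proof -
  have "(u, v) \<in> {(a, b). {a, b} \<in> E}\<^sup>*" using assms by (auto simp: connected_graph_def)
  then show ?thesis using assms(4) that by (auto elim: converse_rtranclE)
qed

text \<open>A rooted orientation of the tree, with a rank against circularity. By the last clause a
  connected set has at most one node without a parent in it, its top; this replaces reachability by
  a first-order condition.\<close>

definition parent_system :: "'a set \<Rightarrow> 'a set set \<Rightarrow> ('a \<Rightarrow> 'a \<Rightarrow> bool) \<Rightarrow> ('a \<Rightarrow> nat) \<Rightarrow> bool" where
  "parent_system N F Pr rk \<longleftrightarrow> (\<forall>i j. Pr i j \<longrightarrow> i \<in> N \<and> j \<in> N \<and> rk j < rk i) \<and>
     (\<forall>i j k. Pr i j \<longrightarrow> Pr i k \<longrightarrow> j = k) \<and>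
     (\<forall>W. W \<subseteq> N \<longrightarrow> connected_graph W (induced_edges F W) \<longrightarrow>
       (\<forall>i\<in>W. \<forall>j\<in>W. i \<noteq> j \<longrightarrow> (\<exists>k\<in>W. Pr i k \<or> Pr j k)))"

lemma parent_systemD:
  assumes "parent_system N F Pr rk"
  shows "Pr i j \<Longrightarrow> i \<in> N \<and> j \<in> N \<and> rk j < rk i" "Pr i j \<Longrightarrow> Pr i k \<Longrightarrow> j = k"
    "W \<subseteq> N \<Longrightarrow> connected_graph W (induced_edges F W) \<Longrightarrow> i \<in> W \<Longrightarrow> j \<in> W \<Longrightarrow> i \<noteq> j \<Longrightarrow>
       \<exists>k\<in>W. Pr i k \<or> Pr j k"
  using assms unfolding parent_system_def by blast+

lemma parent_systemI:
  assumes "\<And>i j. Pr i j \<Longrightarrow> i \<in> N \<and> j \<in> N \<and> rk j < rk i" "\<And>i j k. Pr i j \<Longrightarrow> Pr i k \<Longrightarrow> j = k"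
    "\<And>W i j. W \<subseteq> N \<Longrightarrow> connected_graph W (induced_edges F W) \<Longrightarrow> i \<in> W \<Longrightarrow> j \<in> W \<Longrightarrow> i \<noteq> j \<Longrightarrow>
       \<exists>k\<in>W. Pr i k \<or> Pr j k"
  shows "parent_system N F Pr rk"
  unfolding parent_system_def by (intro conjI allI impI ballI) (fact assms | blast dest: assms(1))+

text \<open>An attached leaf gets its neighbour \<open>p\<close> as parent. A connected set that
  contains the leaf and another vertex contains \<open>p\<close>, and it stays connected without the
  leaf.\<close>

lemma tree_parents:
  assumes "is_tree N F" shows "\<exists>Pr rk. parent_system N F Pr rk"
  using assms
proof (induction rule: tree_induct)
  case empty
  have "parent_system {} {} (\<lambda>_ _. False) (\<lambda>_. 0)" by (rule parent_systemI) blast+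
  then show ?case by blast
next
  case (single v)
  have "parent_system {v} {} (\<lambda>_ _. False) (\<lambda>_. 0)"
  proof (rule parent_systemI)
    fix W i j assume W: "W \<subseteq> {v}" and ij: "i \<in> W" "j \<in> W" "i \<noteq> j"
    have "i = v" "j = v" using subsetD[OF W ij(1)] subsetD[OF W ij(2)] by simp_all
    with ij(3) show "\<exists>k\<in>W. False \<or> False" by simp
  qed blast+
  then show ?case by blast
next
  case (leaf N F l p)
  from leaf(4) obtain Pr rk where P: "parent_system N F Pr rk" by blast
  note 1 = parent_systemD(1)[OF P] and 2 = parent_systemD(2)[OF P] and 3 = parent_systemD(3)[OF P]
  let ?F = "insert {l, p} F"
  have F: "f \<subseteq> N" if "f \<in> F" for f using leaf that by (auto simp: is_tree_def is_graph_def)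
  have lp: "l \<noteq> p" using leaf by auto
  define Pr' where "Pr' = (\<lambda>i j. Pr i j \<or> i = l \<and> j = p)"
  define rk' where "rk' = rk(l := Suc (rk p))"
  have 4: "\<exists>k\<in>W. Pr' i k \<or> Pr' j k"
    if W: "W \<subseteq> insert l N" "connected_graph W (induced_edges ?F W)" and ij: "i \<in> W" "j \<in> W" "i \<noteq> j" for W i j
  proof -
    have u: "f = {l, p}" if "f \<in> induced_edges ?F W" "l \<in> f" for f
      using that F leaf(2) by (auto simp: induced_edges_def)
    show ?thesis
    proof (cases "i = l \<or> j = l")
      case True
      have "p \<in> W"
      proof -
        obtain w where "{l, w} \<in> induced_edges ?F W"
          using connected_neighbour[OF W(2), of l] True ij by metis
        with u[OF this] show ?thesis by (auto simp: induced_edges_def)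
      qed
      with True show ?thesis by (auto simp: Pr'_def)
    next
      case False
      have "connected_graph (W - {l}) (induced_edges F (W - {l}))"
        by (rule connected_remove_leaf[OF W(2) lp u]) (auto simp: induced_edges_def)
      with 3[of "W - {l}" i j] W(1) ij False show ?thesis by (auto simp: Pr'_def)
    qed
  qed
  have "parent_system (insert l N) ?F Pr' rk'"
  proof (rule parent_systemI)
    show "i \<in> insert l N \<and> j \<in> insert l N \<and> rk' j < rk' i" if "Pr' i j" for i j
      using that 1[of i j] leaf(2,3) by (auto simp: Pr'_def rk'_def)
    show "j = k" if "Pr' i j" "Pr' i k" for i j k
      using that 1[of i j] 1[of i k] 2[of i j k] leaf(2) by (auto simp: Pr'_def)
  qed (fact 4)
  then show ?case by blast
qed

section \<open>Acyclic hypergraphs by parent relations\<close>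

definition parent_edges :: "nat \<Rightarrow> (nat \<Rightarrow> nat \<Rightarrow> bool) \<Rightarrow> nat set set" where
  "parent_edges m Pr = {{i, j} | i j. i < m \<and> j < m \<and> Pr i j}"

lemma parent_edges_iff: "{i, j} \<in> parent_edges m Pr \<longleftrightarrow> i < m \<and> j < m \<and> (Pr i j \<or> Pr j i)"
proof
  assume "{i, j} \<in> parent_edges m Pr"
  then have "\<exists>a b. {i, j} = {a, b} \<and> a < m \<and> b < m \<and> Pr a b"
    unfolding parent_edges_def by (rule CollectD)
  then show "i < m \<and> j < m \<and> (Pr i j \<or> Pr j i)"
    by (elim exE conjE) (simp only: doubleton_eq_iff, blast)
next
  assume "i < m \<and> j < m \<and> (Pr i j \<or> Pr j i)"
  then show "{i, j} \<in> parent_edges m Pr"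
    unfolding parent_edges_def using insert_commute[of i j] by blast
qed

text \<open>\<open>Pr i j\<close> says that \<open>j\<close> is the parent of \<open>i\<close>, and the strict order \<open>Or\<close> witnesses that parents
  are not circular. A set of nodes induces a subtree iff at most one of its nodes has no parent in it.\<close>

definition rooted :: "nat \<Rightarrow> (nat \<Rightarrow> nat \<Rightarrow> bool) \<Rightarrow> (nat \<Rightarrow> nat \<Rightarrow> bool) \<Rightarrow> bool" where
  "rooted m Pr Or \<longleftrightarrow> (\<forall>i<m. \<not> Or i i) \<and> (\<forall>i<m. \<forall>j<m. \<forall>k<m. Or i j \<and> Or j k \<longrightarrow> Or i k) \<and>
     (\<forall>i<m. \<forall>j<m. Pr i j \<longrightarrow> Or j i) \<and> (\<forall>i<m. \<forall>j<m. \<forall>k<m. Pr i j \<and> Pr i k \<longrightarrow> j = k)"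

text \<open>First-order in \<open>Pr\<close> and \<open>Or\<close>, so that both can be listed in a
  certificate and checked by a definable predicate. The middle clause concerns the whole tree, the
  last one the rows that contain \<open>v\<close>.\<close>

definition join_rooted :: "nat \<Rightarrow> nat \<Rightarrow> (nat \<Rightarrow> nat \<Rightarrow> bool) \<Rightarrow> (nat \<Rightarrow> nat \<Rightarrow> bool) \<Rightarrow> (nat \<Rightarrow> nat \<Rightarrow> bool) \<Rightarrow> bool" where
  "join_rooted n m M Pr Or \<longleftrightarrow> rooted m Pr Or \<and>
     (\<forall>i<m. \<forall>j<m. i \<noteq> j \<longrightarrow> (\<exists>k<m. Pr i k \<or> Pr j k)) \<and>
     (\<forall>v<n. \<forall>i<m. \<forall>j<m. i \<noteq> j \<and> M i v \<and> M j v \<longrightarrow> (\<exists>k<m. M k v \<and> (Pr i k \<or> Pr j k)))"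

lemma rootedD:
  assumes "rooted m Pr Or"
  shows "i < m \<Longrightarrow> \<not> Or i i"
    "i < m \<Longrightarrow> j < m \<Longrightarrow> k < m \<Longrightarrow> Or i j \<Longrightarrow> Or j k \<Longrightarrow> Or i k"
    "i < m \<Longrightarrow> j < m \<Longrightarrow> Pr i j \<Longrightarrow> Or j i"
    "i < m \<Longrightarrow> j < m \<Longrightarrow> k < m \<Longrightarrow> Pr i j \<Longrightarrow> Pr i k \<Longrightarrow> j = k"
  using assms unfolding rooted_def by blast+

text \<open>The first direction serves for climbing to a root, the second for choosing an
  \<open>Or\<close>-maximal node on a cycle. Both rest on finiteness.\<close>

lemma rooted_wf:
  assumes "rooted m Pr Or"
  shows "wf {(j, i). i < m \<and> j < m \<and> Or j i}" "wf {(j, i). i < m \<and> j < m \<and> Or i j}"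
proof -
  let ?R = "{(j, i). i < m \<and> j < m \<and> Or j i}"
  have "?R \<subseteq> {..<m} \<times> {..<m}" by auto
  then have fin: "finite ?R" by (rule finite_subset) simp
  have "trans ?R" using rootedD(2)[OF assms] unfolding trans_def by blast
  then have "acyclic ?R" using rootedD(1)[OF assms] by (auto simp: acyclic_def trancl_id)
  then show "wf ?R" "wf {(j, i). i < m \<and> j < m \<and> Or i j}"
    using fin finite_acyclic_wf[OF fin] finite_acyclic_wf_converse[OF fin]
    by (auto simp: converse_unfold conj_ac case_prod_unfold)
qed

text \<open>An \<open>Or\<close>-maximal node on a cycle would have both of its neighbours there as
  parents, but a parent is unique.\<close>

lemma rooted_no_cycle:
  assumes r: "rooted m Pr Or"
  shows "\<not> is_cycle (parent_edges m Pr) c"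
proof
  assume c: "is_cycle (parent_edges m Pr) c"
  let ?n = "length c"
  have n: "3 \<le> ?n" "distinct c" and e: "\<And>i. i < ?n \<Longrightarrow> {c ! i, c ! (Suc i mod ?n)} \<in> parent_edges m Pr"
    using c by (auto simp: is_cycle_def)
  have "set c \<noteq> {}" using n by auto
  then obtain z where z: "z \<in> set c" "\<And>y. y \<in> set c \<Longrightarrow> \<not> (z < m \<and> y < m \<and> Or z y)"
    by (rule wfE_min'[OF rooted_wf(2)[OF r]]) auto
  obtain k where k: "k < ?n" "c ! k = z" using z(1) by (auto simp: in_set_conv_nth)
  have up: "Pr z y" if "y \<in> set c" "{z, y} \<in> parent_edges m Pr" for y
  proof -
    have zy: "z < m" "y < m" "Pr z y \<or> Pr y z" using that(2) by (simp_all add: parent_edges_iff)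
    then have "Pr y z \<Longrightarrow> Or z y" by (intro rootedD(3)[OF r])
    with zy z(2)[OF that(1)] show ?thesis by blast
  qed
  let ?s = "Suc k mod ?n" and ?p = "if k = 0 then ?n - 1 else k - 1"
  have p: "Suc ?p mod ?n = k" "?p < ?n" "?s < ?n" using k n by (auto intro: mod_less_divisor)
  have "?s \<noteq> ?p" using k n by (auto simp: mod_Suc split: if_splits)
  have "Pr z (c ! ?s)" by (rule up) (use e[OF k(1)] k p in auto)
  moreover have "Pr z (c ! ?p)" by (rule up) (use e[OF p(2)] k p in \<open>auto simp: insert_commute\<close>)
  moreover have "c ! ?s < m" "c ! ?p < m" "z < m"
    using e[OF k(1)] e[OF p(2)] k p by (auto simp: parent_edges_iff)
  ultimately have "c ! ?s = c ! ?p" by (intro rootedD(4)[OF r])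
  with n(2) p \<open>?s \<noteq> ?p\<close> show False by (simp add: nth_eq_iff_index_eq)
qed

text \<open>Parents within \<open>W\<close> lead from each node up to a node that has none in
  \<open>W\<close>. By \<open>one\<close> this node is the same for all, so \<open>W\<close> is
  connected through it.\<close>

lemma rooted_tree:
  assumes r: "rooted m Pr Or" and W: "W \<subseteq> {..<m}"
    and one: "\<And>i j. i \<in> W \<Longrightarrow> j \<in> W \<Longrightarrow> i \<noteq> j \<Longrightarrow> \<exists>k\<in>W. Pr i k \<or> Pr j k"
  shows "is_tree W (induced_edges (parent_edges m Pr) W)"
proof -
  let ?E = "induced_edges (parent_edges m Pr) W"
  let ?R = "{(a, b). {a, b} \<in> ?E}"
  have "finite W" using W finite_subset by blast
  moreover have "i \<noteq> j" if "i < m" "j < m" "Pr i j" for i j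
    using rootedD(1,3)[OF r] that by blast
  ultimately have g: "is_graph W ?E"
    by (auto simp: is_graph_def induced_edges_def parent_edges_def)
  have root: "\<exists>t\<in>W. (\<forall>k\<in>W. \<not> Pr t k) \<and> (i, t) \<in> ?R\<^sup>*" if "i \<in> W" for i
    using that
  proof (induction i rule: wf_induct_rule[OF rooted_wf(1)[OF r]])
    case (1 i)
    show ?case
    proof (cases "\<exists>k\<in>W. Pr i k")
      case True
      then obtain k where k: "k \<in> W" "Pr i k" by blast
      with 1(2) W have "i < m" "k < m" by auto
      with k have "Or k i" by (intro rootedD(3)[OF r])
      with 1(1)[of k] k \<open>i < m\<close> \<open>k < m\<close> obtain t where t: "t \<in> W" "\<forall>k\<in>W. \<not> Pr t k" "(k, t) \<in> ?R\<^sup>*" by blast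
      have "(i, k) \<in> ?R" using k 1(2) \<open>i < m\<close> \<open>k < m\<close> W by (auto simp: induced_edges_def parent_edges_iff)
      with t show ?thesis by (meson converse_rtrancl_into_rtrancl)
    qed (use 1(2) in blast)
  qed
  have "sym ?R" by (auto simp: sym_def insert_commute)
  then have s: "sym (?R\<^sup>*)" by (rule sym_rtrancl)
  have "connected_graph W ?E"
    unfolding connected_graph_def
  proof (intro ballI)
    fix u v assume uv: "u \<in> W" "v \<in> W"
    obtain t where t: "t \<in> W" "\<forall>k\<in>W. \<not> Pr t k" "(u, t) \<in> ?R\<^sup>*" using root[OF uv(1)] by blast
    obtain t' where t': "t' \<in> W" "\<forall>k\<in>W. \<not> Pr t' k" "(v, t') \<in> ?R\<^sup>*" using root[OF uv(2)] by blast
    have "t = t'" using one[of t t'] t t' by blast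
    with t t' s show "(u, v) \<in> ?R\<^sup>*" by (meson rtrancl_trans symD)
  qed
  moreover have "\<not> is_cycle ?E c" for c
    using rooted_no_cycle[OF r, of c] unfolding is_cycle_def induced_edges_def by blast
  ultimately show ?thesis using g by (simp add: is_tree_def)
qed

lemma rooted_parents:
  assumes "\<And>i j. Pr i j \<Longrightarrow> rk j < (rk i :: nat)" "\<And>i j k. Pr i j \<Longrightarrow> Pr i k \<Longrightarrow> j = k"
  shows "rooted m Pr (\<lambda>i j. rk i < rk j)"
  using assms by (auto simp: rooted_def intro: less_trans)

section \<open>Membership in NP\<close>

text \<open>Substitution is simulated by a bounded quantifier over an index that is equated with
  \<open>a\<close>.\<close>

lemma decidable_subst:
  assumes P: "decidable (\<lambda>x e. P x (e 0))" and a: "definable a"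
  shows "decidable (\<lambda>x e. P x (a x e))"
proof -
  have "decidable (\<lambda>x e. \<exists>i<Suc (a x e). i = a x e \<and> P x i)"
    by (intro definable_intros P a definable_ren[OF a])
  then show ?thesis by (simp add: less_Suc_eq)
qed

lemma decidable_subst2:
  assumes P: "decidable (\<lambda>x e. P x (e (Suc 0)) (e 0))" and a: "definable a" and b: "definable b"
  shows "decidable (\<lambda>x e. P x (a x e) (b x e))"
proof -
  have "decidable (\<lambda>x e. \<exists>i<Suc (a x e). \<exists>j<Suc (b x e). i = a x e \<and> j = b x e \<and> P x i j)"
    by (intro definable_intros P a b definable_ren[OF a] definable_ren[OF b])
  moreover have "(\<exists>i<Suc (a x e). \<exists>j<Suc (b x e). i = a x e \<and> j = b x e \<and> P x i j) = P x (a x e) (b x e)" for x e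
    by auto
  ultimately show ?thesis by simp
qed

text \<open>Composition with a word-valued map, by recursion on the expression: the bits of the new
  word are a definable predicate and its length is a definable number.\<close>

lemma definable_comp:
  assumes F: "definable F" and P: "decidable (\<lambda>w e. P w (e 0))" and g: "definable (\<lambda>w e. g w)"
  shows "definable (\<lambda>w e. F (map (P w) [0..<g w]) e)"
proof -
  obtain a where a: "F x e = eval a x e" for x e using F unfolding definable_def by blast
  have "definable (\<lambda>w e. eval a (map (P w) [0..<g w]) e)"
  proof (induction a)
    case (Bit a)
    have "decidable (\<lambda>w e. eval a (map (P w) [0..<g w]) e < g w \<and> P w (eval a (map (P w) [0..<g w]) e))"
      by (intro decidable_conj decidable_less decidable_subst[OF P] Bit g)
    then show ?case by (simp cong: conj_cong)
  next
    case (Sum a b)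
    have "(\<lambda>k. case k of 0 \<Rightarrow> e 0 | Suc k \<Rightarrow> e (Suc k)) = (e :: nat \<Rightarrow> nat)" for e
      by (auto split: nat.split)
    then show ?case
      using Sum by (auto intro!: definable_sum)
  next
    case (Ren f a)
    then show ?case using definable_ren[of "\<lambda>w e. eval a (map (P w) [0..<g w]) e" f] by simp
  qed (auto intro!: definable_intros g)
  then show ?thesis by (simp add: a)
qed

text \<open>In \<open>pair_word x y\<close> the even positions hold \<open>True\<close> as far as
  \<open>x\<close> reaches, and the separator \<open>False\<close> is at position
  \<open>2 * length x\<close>.\<close>

definition first_length :: "bool list \<Rightarrow> nat" where
  "first_length w = (\<Sum>i<length w. of_bool (\<forall>j<Suc i. bit_at w (2 * j)))"

definition first_word :: "bool list \<Rightarrow> bool list" where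
  "first_word w = map (\<lambda>i. bit_at w (2 * i + 1)) [0..<first_length w]"

definition second_bit :: "bool list \<Rightarrow> nat \<Rightarrow> bool" where
  "second_bit w i \<longleftrightarrow> bit_at w (2 * first_length w + 1 + i)"

lemma length_pair_word [simp]: "length (pair_word x y) = 2 * length x + 1 + length y"
  unfolding pair_word_def by (induction x) auto

lemma nth_pair_word:
  "pair_word x y ! k = (if k < 2 * length x then even k \<or> x ! (k div 2)
     else if k = 2 * length x then False else y ! (k - (2 * length x + 1)))"
proof (induction x arbitrary: k)
  case Nil
  then show ?case by (auto simp: pair_word_def nth_Cons')
next
  case (Cons b x)
  have p: "pair_word (b # x) y = True # b # pair_word x y" by (simp add: pair_word_def)
  consider "k = 0" | "k = 1" | j where "k = Suc (Suc j)"
    by (metis One_nat_def old.nat.exhaust)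
  then show ?case by cases (auto simp: p Cons)
qed

lemma first_length_pair_word [simp]: "first_length (pair_word x y) = length x"
proof -
  have "bit_at (pair_word x y) (2 * j) \<longleftrightarrow> j < length x" if "j \<le> length x" for j
    using that by (auto simp: bit_at_def nth_pair_word)
  then have "(\<forall>j<Suc i. bit_at (pair_word x y) (2 * j)) \<longleftrightarrow> i < length x" for i
    by (metis less_Suc_eq_le linorder_not_less nat_le_linear order_le_less_trans order_less_le)
  then have "first_length (pair_word x y) = (\<Sum>i<2 * length x + 1 + length y. of_bool (i < length x))"
    by (simp add: first_length_def)
  also have "\<dots> = (\<Sum>i<length x. 1)"
    by (rule sum.mono_neutral_cong_right) auto
  finally show ?thesis by simp
qed

lemma first_word_pair_word [simp]: "first_word (pair_word x y) = x"
  by (rule nth_equalityI) (auto simp: first_word_def bit_at_def nth_pair_word)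

lemma second_bit_pair_word [simp]: "second_bit (pair_word x y) = bit_at y"
  by (auto simp: fun_eq_iff second_bit_def bit_at_def nth_pair_word)

lemma definable_first_length: "definable (\<lambda>w e. first_length w)"
  unfolding first_length_def by (intro definable_intros)

lemma definable_first_word: "definable F \<Longrightarrow> definable (\<lambda>w e. F (first_word w) e)"
  unfolding first_word_def by (rule definable_comp, assumption) (intro definable_intros definable_first_length)+

lemma decidable_second_bit: "definable a \<Longrightarrow> decidable (\<lambda>w e. second_bit w (a w e))"
  unfolding second_bit_def by (intro definable_intros definable_first_length)

lemma decidable_well_formed: "decidable (\<lambda>x e. well_formed x)"
proof -
  have "well_formed x \<longleftrightarrow> length x = vertex_count x + 2 + edge_count x * (vertex_count x + 1) \<and>
    (\<forall>k<length x. bit_at x k \<longleftrightarrow> matrix_bit (vertex_count x) (edge_count x) (entry x) k)" for x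
    unfolding well_formed_def matrix_word_eq
    by (auto simp: list_eq_iff_nth_eq bit_at_def simp del: upt_Suc)
  moreover have "decidable (\<lambda>x e. length x = vertex_count x + 2 + edge_count x * (vertex_count x + 1) \<and>
    (\<forall>k<length x. bit_at x k \<longleftrightarrow> matrix_bit (vertex_count x) (edge_count x) (entry x) k))"
    by (intro definable_intros decidable_matrix_bit definable_vertex_count definable_edge_count decidable_entry)
  ultimately show ?thesis by simp
qed

lemma induced_edges_all: "is_graph N F \<Longrightarrow> induced_edges F N = F"
  by (auto simp: is_graph_def induced_edges_def)

lemma alpha_acyclic_matrix:
  "alpha_acyclic (matrix_hypergraph n m M) \<longleftrightarrow> (\<exists>Pr Or. join_rooted n m M Pr Or)"
proof
  let ?W = "\<lambda>v. {i. i < m \<and> M i v}"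
  have W: "{i \<in> edge_indices (matrix_hypergraph n m M). v \<in> hyperedges (matrix_hypergraph n m M) ! i} = ?W v"
    if "v < n" for v
    using that by auto
  {
    assume "alpha_acyclic (matrix_hypergraph n m M)"
    then obtain F where F: "is_tree {..<m} F" and v: "\<And>v. v < n \<Longrightarrow> is_tree (?W v) (induced_edges F (?W v))"
      using W unfolding alpha_acyclic_def join_tree_def Let_def by auto
    obtain Pr rk where P: "parent_system {..<m} F Pr rk" using tree_parents[OF F] by blast
    have "induced_edges F {..<m} = F" using F by (intro induced_edges_all) (simp add: is_tree_def)
    then have c: "connected_graph {..<m} (induced_edges F {..<m})" using F by (simp add: is_tree_def)
    have "rooted m Pr (\<lambda>i j. rk i < rk j)"
      by (rule rooted_parents) (use parent_systemD(1,2)[OF P] in blast)+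
    moreover have "\<exists>k<m. Pr i k \<or> Pr j k" if "i < m" "j < m" "i \<noteq> j" for i j
      using parent_systemD(3)[OF P order_refl c, of i j] that by auto
    moreover have "\<exists>k<m. M k v \<and> (Pr i k \<or> Pr j k)"
      if "v < n" "i < m" "j < m" "i \<noteq> j" "M i v" "M j v" for v i j
      using parent_systemD(3)[OF P, of "?W v" i j] v[OF that(1)] that by (auto simp: is_tree_def)
    ultimately show "\<exists>Pr Or. join_rooted n m M Pr Or"
      unfolding join_rooted_def by blast
  next
    assume "\<exists>Pr Or. join_rooted n m M Pr Or"
    then obtain Pr Or where J: "join_rooted n m M Pr Or" by blast
    then have r: "rooted m Pr Or" by (simp add: join_rooted_def)
    let ?F = "parent_edges m Pr"
    have "is_tree {..<m} (induced_edges ?F {..<m})"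
    proof (rule rooted_tree[OF r order_refl])
      fix i j assume "i \<in> {..<m}" "j \<in> {..<m}" "i \<noteq> j"
      with J have "\<exists>k<m. Pr i k \<or> Pr j k" by (simp add: join_rooted_def)
      then show "\<exists>k\<in>{..<m}. Pr i k \<or> Pr j k" by auto
    qed
    moreover have "induced_edges ?F {..<m} = ?F"
      by (auto simp: induced_edges_def parent_edges_def)
    ultimately have all: "is_tree {..<m} ?F" by simp
    have Wv: "is_tree (?W v) (induced_edges ?F (?W v))" if "v < n" for v
    proof (rule rooted_tree[OF r])
      fix i j assume ij: "i \<in> ?W v" "j \<in> ?W v" "i \<noteq> j"
      then have "\<exists>k<m. M k v \<and> (Pr i k \<or> Pr j k)" using J that by (simp add: join_rooted_def)
      then show "\<exists>k\<in>?W v. Pr i k \<or> Pr j k" by auto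
    qed auto
    have "join_tree (matrix_hypergraph n m M) ?F"
      unfolding join_tree_def Let_def
    proof (intro conjI ballI)
      show "is_tree (edge_indices (matrix_hypergraph n m M)) ?F" using all by simp
    next
      fix v assume "v \<in> vertices (matrix_hypergraph n m M)"
      then have v: "v < n" by simp
      show "is_tree {i \<in> edge_indices (matrix_hypergraph n m M). v \<in> hyperedges (matrix_hypergraph n m M) ! i}
        (induced_edges ?F {i \<in> edge_indices (matrix_hypergraph n m M). v \<in> hyperedges (matrix_hypergraph n m M) ! i})"
        unfolding W[OF v] by (rule Wv[OF v])
    qed
    then show "alpha_acyclic (matrix_hypergraph n m M)" unfolding alpha_acyclic_def by blast
  }
qed

text \<open>A certificate \<open>y\<close> lists the indicator of the cover, the parent relation and the order.\<close>

definition certifies :: "bool list \<Rightarrow> (nat \<Rightarrow> bool) \<Rightarrow> bool" where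
  "certifies x y \<longleftrightarrow> (let n = vertex_count x; m = edge_count x in well_formed x \<and>
     join_rooted n m (entry x) (\<lambda>i j. y (m + i * m + j)) (\<lambda>i j. y (m + m * m + i * m + j)) \<and>
     (\<forall>v<n. \<exists>i<m. y i \<and> entry x i v \<and> (\<forall>j<m. y j \<and> entry x j v \<longrightarrow> j = i)))"

lemma decidable_certifies: "decidable (\<lambda>w e. certifies (first_word w) (second_bit w))"
proof -
  have e: "decidable (\<lambda>w e. entry (first_word w) (a w e) (b w e))" if "definable a" "definable b" for a b
    by (rule decidable_subst2[OF definable_first_word that], rule decidable_entry) (rule definable_var)+
  show ?thesis
    unfolding certifies_def Let_def join_rooted_def rooted_def
    by (intro definable_intros e decidable_second_bit definable_first_word[OF definable_vertex_count]
        definable_first_word[OF definable_edge_count] definable_first_word[OF decidable_well_formed])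
qed

lemma join_rooted_cong:
  assumes "join_rooted n m M Pr Or" and P: "\<And>i j. i < m \<Longrightarrow> j < m \<Longrightarrow> Pr' i j = Pr i j"
    and O: "\<And>i j. i < m \<Longrightarrow> j < m \<Longrightarrow> Or' i j = Or i j"
  shows "join_rooted n m M Pr' Or'"
proof -
  have "join_rooted n m M Pr' Or' = join_rooted n m M Pr Or"
    unfolding join_rooted_def rooted_def by (simp add: P O cong: conj_cong)
  with assms(1) show ?thesis by simp
qed

text \<open>For \<open>m\<close> hyperedges a certificate has \<open>m + 2 * (m * m)\<close> bits,
  and \<open>m \<le> length x\<close>; hence the polynomial \<open>[:0, 1, 2:]\<close>.\<close>

lemma certifies_iff:
  "x \<in> hypergraph_words alpha_acyclic \<inter> EXACT_COVER \<longleftrightarrow>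
     (\<exists>y. length y \<le> poly [:0, 1, 2:] (length x) \<and> certifies x (bit_at y))"
proof -
  let ?n = "vertex_count x" and ?m = "edge_count x"
  let ?cover = "\<lambda>c. \<forall>v<?n. \<exists>i<?m. c i \<and> entry x i v \<and> (\<forall>j<?m. c j \<and> entry x j v \<longrightarrow> j = i)"
  have "has_exact_cover (decoded x) \<longleftrightarrow> (\<exists>c. ?cover c)"
    unfolding decoded_def has_exact_cover_matrix
  proof
    assume "\<exists>I\<subseteq>{..<?m}. \<forall>v<?n. \<exists>!i. i \<in> I \<and> entry x i v"
    then obtain I where I: "I \<subseteq> {..<?m}" "\<forall>v<?n. \<exists>!i. i \<in> I \<and> entry x i v" by blast
    have "?cover (\<lambda>i. i \<in> I)"
    proof (intro allI impI)
      fix v assume "v < ?n"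
      with I(2) obtain i where "i \<in> I" "entry x i v" "\<And>j. j \<in> I \<Longrightarrow> entry x j v \<Longrightarrow> j = i" by blast
      with I(1) show "\<exists>i<?m. i \<in> I \<and> entry x i v \<and> (\<forall>j<?m. j \<in> I \<and> entry x j v \<longrightarrow> j = i)" by blast
    qed
    then show "\<exists>c. ?cover c" by (rule exI[where P = ?cover])
  next
    assume "\<exists>c. ?cover c"
    then obtain c where c: "?cover c" ..
    have "\<exists>!i. i \<in> {i. i < ?m \<and> c i} \<and> entry x i v" if v: "v < ?n" for v
    proof -
      from c v have "\<exists>i<?m. c i \<and> entry x i v \<and> (\<forall>j<?m. c j \<and> entry x j v \<longrightarrow> j = i)" by simp
      then obtain i where i: "i < ?m \<and> c i \<and> entry x i v \<and> (\<forall>j<?m. c j \<and> entry x j v \<longrightarrow> j = i)" ..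
      then have u: "\<forall>j<?m. c j \<and> entry x j v \<longrightarrow> j = i" by (elim conjE)
      from i have "i \<in> {i. i < ?m \<and> c i} \<and> entry x i v" by simp
      then show ?thesis by (rule ex1I) (use u in simp)
    qed
    then show "\<exists>I\<subseteq>{..<?m}. \<forall>v<?n. \<exists>!i. i \<in> I \<and> entry x i v"
      by (intro exI[of _ "{i. i < ?m \<and> c i}"]) auto
  qed
  then have *: "x \<in> hypergraph_words alpha_acyclic \<inter> EXACT_COVER \<longleftrightarrow>
      well_formed x \<and> (\<exists>Pr Or. join_rooted ?n ?m (entry x) Pr Or) \<and> (\<exists>c. ?cover c)"
    unfolding EXACT_COVER_def Int_iff mem_hypergraph_words by (auto simp: decoded_def alpha_acyclic_matrix)
  show ?thesis
  proof
    assume "x \<in> hypergraph_words alpha_acyclic \<inter> EXACT_COVER"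
    then have wf: "well_formed x" and exJ: "\<exists>Pr Or. join_rooted ?n ?m (entry x) Pr Or" and exc: "\<exists>c. ?cover c"
      unfolding * by - (elim conjE; assumption)+
    from exJ obtain Pr where "\<exists>Or. join_rooted ?n ?m (entry x) Pr Or" ..
    then obtain Or where J: "join_rooted ?n ?m (entry x) Pr Or" ..
    from exc obtain c where c: "?cover c" ..
    define y where "y = map (\<lambda>k. if k < ?m then c k else if k < ?m + ?m * ?m then Pr ((k - ?m) div ?m) ((k - ?m) mod ?m)
      else Or ((k - (?m + ?m * ?m)) div ?m) ((k - (?m + ?m * ?m)) mod ?m)) [0..<?m + 2 * (?m * ?m)]"
    have b: "i * ?m + j < ?m * ?m" if "i < ?m" "j < ?m" for i j
      using that mult_le_mono1[of "Suc i" ?m ?m] by simp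
    have yc: "bit_at y i = c i" if "i < ?m" for i
      using that by (simp add: y_def bit_at_def)
    have yP: "bit_at y (?m + i * ?m + j) = Pr i j" if "i < ?m" "j < ?m" for i j
      using that b[OF that] by (simp add: y_def bit_at_def)
    have yO: "bit_at y (?m + ?m * ?m + i * ?m + j) = Or i j" if "i < ?m" "j < ?m" for i j
      using that b[OF that] by (simp add: y_def bit_at_def)
    have "join_rooted ?n ?m (entry x) (\<lambda>i j. bit_at y (?m + i * ?m + j)) (\<lambda>i j. bit_at y (?m + ?m * ?m + i * ?m + j))"
      by (rule join_rooted_cong[OF J]) (fact yP yO)+
    moreover have "?cover (bit_at y)"
    proof (intro allI impI)
      fix v assume "v < ?n"
      with c have "\<exists>i<?m. c i \<and> entry x i v \<and> (\<forall>j<?m. c j \<and> entry x j v \<longrightarrow> j = i)" by simp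
      then obtain i where i: "i < ?m \<and> c i \<and> entry x i v \<and> (\<forall>j<?m. c j \<and> entry x j v \<longrightarrow> j = i)" ..
      then show "\<exists>i<?m. bit_at y i \<and> entry x i v \<and> (\<forall>j<?m. bit_at y j \<and> entry x j v \<longrightarrow> j = i)"
        by (intro exI[of _ i]) (simp add: yc)
    qed
    ultimately have "certifies x (bit_at y)"
      using wf unfolding certifies_def Let_def by simp
    moreover have "?m \<le> length x"
      using wf length_matrix_word[of ?n ?m "entry x"] unfolding well_formed_def by simp
    then have "length y \<le> poly [:0, 1, 2:] (length x)"
      using mult_le_mono[of ?m "length x" ?m "length x"] by (simp add: y_def algebra_simps)
    ultimately show "\<exists>y. length y \<le> poly [:0, 1, 2:] (length x) \<and> certifies x (bit_at y)" by blast
  next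
    assume "\<exists>y. length y \<le> poly [:0, 1, 2:] (length x) \<and> certifies x (bit_at y)"
    then show "x \<in> hypergraph_words alpha_acyclic \<inter> EXACT_COVER"
      unfolding * certifies_def Let_def by blast
  qed
qed

lemma alpha_acyclic_exact_cover_in_NP: "hypergraph_words alpha_acyclic \<inter> EXACT_COVER \<in> NP"
  unfolding NP_def
proof (rule CollectI, intro exI conjI)
  show "polytime_decidable_on UNIV {w. certifies (first_word w) (second_bit w)}"
    by (rule polytime_decidable[OF decidable_certifies])
  show "\<forall>x. x \<in> hypergraph_words alpha_acyclic \<inter> EXACT_COVER \<longleftrightarrow>
    (\<exists>y. length y \<le> poly [:0, 1, 2:] (length x) \<and> pair_word x y \<in> {w. certifies (first_word w) (second_bit w)})"
    unfolding mem_Collect_eq first_word_pair_word second_bit_pair_word using certifies_iff by blast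
qed

section \<open>Exact covers of hypertrees\<close>

text \<open>Choosing at every vertex the hyperedge that covers it is a binary constraint satisfaction
  problem whose constraints only need to be imposed on the edges of the tree; hence arc consistency
  suffices for a solution.\<close>

lemma tree_choice:
  assumes "is_tree N F" "\<And>v. v \<in> N \<Longrightarrow> \<exists>e\<in>S. v \<in> e"
    "\<And>u v e. {u, v} \<in> F \<Longrightarrow> e \<in> S \<Longrightarrow> u \<in> e \<Longrightarrow> v \<notin> e \<Longrightarrow> \<exists>f\<in>S. v \<in> f \<and> u \<notin> f"
  shows "\<exists>c. (\<forall>v\<in>N. c v \<in> S \<and> v \<in> c v) \<and> (\<forall>u v. {u, v} \<in> F \<longrightarrow> v \<in> c u \<longrightarrow> c u = c v)"
  using assms
proof (induction rule: tree_induct)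
  case empty
  show ?case by simp
next
  case (single v)
  then obtain e where "e \<in> S" "v \<in> e" by blast
  then show ?case by (intro exI[of _ "\<lambda>_. e"]) simp
next
  case (leaf N F l p)
  have "\<exists>c. (\<forall>v\<in>N. c v \<in> S \<and> v \<in> c v) \<and> (\<forall>u v. {u, v} \<in> F \<longrightarrow> v \<in> c u \<longrightarrow> c u = c v)"
    by (rule leaf.IH) (use leaf.prems in blast)+
  then obtain c where c: "\<And>v. v \<in> N \<Longrightarrow> c v \<in> S \<and> v \<in> c v" "\<And>u v. {u, v} \<in> F \<Longrightarrow> v \<in> c u \<Longrightarrow> c u = c v"
    by metis
  have F: "u \<noteq> l" "v \<noteq> l" if "{u, v} \<in> F" for u v
    using leaf.hyps that by (auto simp: is_tree_def is_graph_def)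
  have lp: "l \<noteq> p" using leaf.hyps by auto
  \<comment> \<open>The leaf copies the choice at \<open>p\<close> if that covers it; otherwise arc
    consistency supplies a hyperedge that contains \<open>l\<close> and avoids
    \<open>p\<close>.\<close>
  obtain f where f: "f \<in> S" "l \<in> f" "l \<in> c p \<or> p \<in> f \<Longrightarrow> f = c p"
  proof (cases "l \<in> c p")
    case True
    with that[of "c p"] c(1)[OF leaf.hyps(3)] show ?thesis by blast
  next
    case False
    then obtain f where "f \<in> S" "l \<in> f" "p \<notin> f"
      using leaf.prems(2)[of p l "c p"] c(1)[OF leaf.hyps(3)] by (auto simp: insert_commute)
    with that[of f] False show ?thesis by blast
  qed
  have "\<forall>v\<in>insert l N. (c(l := f)) v \<in> S \<and> v \<in> (c(l := f)) v"
    using c(1) f by simp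
  moreover have "(c(l := f)) u = (c(l := f)) v"
    if uv: "{u, v} \<in> insert {l, p} F" and v: "v \<in> (c(l := f)) u" for u v
  proof (cases "{u, v} \<in> F")
    case True
    with F[OF True] c(2)[OF True] v show ?thesis by simp
  next
    case False
    with uv have "u = l \<and> v = p \<or> u = p \<and> v = l" by (simp add: doubleton_eq_iff)
    with f(3) v lp show ?thesis by auto
  qed
  ultimately show ?case by blast
qed

text \<open>Choices that agree along tree edges agree on all of \<open>c u\<close>, because
  \<open>c u\<close> is connected in the tree. Hence any two chosen hyperedges are equal or
  disjoint.\<close>

lemma hypertree_exact_cover:
  assumes F: "is_tree N F" and S: "\<And>e. e \<in> S \<Longrightarrow> e \<subseteq> N \<and> connected_graph e (induced_edges F e)"
    and cov: "\<And>v. v \<in> N \<Longrightarrow> \<exists>e\<in>S. v \<in> e"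
    and arc: "\<And>e u v. e \<in> S \<Longrightarrow> u \<in> e \<Longrightarrow> v \<in> N \<Longrightarrow> v \<notin> e \<Longrightarrow> \<exists>f\<in>S. v \<in> f \<and> u \<notin> f"
  shows "\<exists>c. (\<forall>v\<in>N. c v \<in> S \<and> v \<in> c v) \<and> (\<forall>u\<in>N. \<forall>v\<in>c u. c v = c u)"
proof -
  have FN: "v \<in> N" if "{u, v} \<in> F" for u v
  proof -
    have "{u, v} \<subseteq> N" using F that unfolding is_tree_def is_graph_def by blast
    then show ?thesis by simp
  qed
  obtain c where c: "\<And>v. v \<in> N \<Longrightarrow> c v \<in> S \<and> v \<in> c v" "\<And>u v. {u, v} \<in> F \<Longrightarrow> v \<in> c u \<Longrightarrow> c u = c v"
  proof -
    have "\<exists>c. (\<forall>v\<in>N. c v \<in> S \<and> v \<in> c v) \<and> (\<forall>u v. {u, v} \<in> F \<longrightarrow> v \<in> c u \<longrightarrow> c u = c v)"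
    proof (rule tree_choice[OF F cov])
      fix u v e assume "{u, v} \<in> F" "e \<in> S" "u \<in> e" "v \<notin> e"
      with FN[of u v] show "\<exists>f\<in>S. v \<in> f \<and> u \<notin> f" by (intro arc)
    qed
    with that show thesis by blast
  qed
  have "c v = c u" if u: "u \<in> N" and v: "v \<in> c u" for u v
  proof -
    have "(u, v) \<in> {(a, b). {a, b} \<in> induced_edges F (c u)}\<^sup>*"
      using S[of "c u"] c(1)[OF u] v by (simp add: connected_graph_def)
    then show ?thesis
    proof (induction rule: rtrancl_induct)
      case (step y z)
      then have "{y, z} \<in> F" "z \<in> c u" by (auto simp: induced_edges_def)
      with step.IH c(2)[of y z] show ?case by simp
    qed simp
  qed
  then have "\<forall>u\<in>N. \<forall>v\<in>c u. c v = c u" by (intro ballI)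
  moreover have "\<forall>v\<in>N. c v \<in> S \<and> v \<in> c v" by (intro ballI c(1))
  ultimately show ?thesis by (intro exI[of _ c] conjI)
qed

text \<open>The row of a hyperedge that cannot be part of an exact cover is erased. It survives if for each
  vertex \<open>u\<close> outside of it and each of its vertices \<open>v\<close> some row contains \<open>u\<close> but not \<open>v\<close>.\<close>

definition supported :: "nat \<Rightarrow> nat \<Rightarrow> (nat \<Rightarrow> nat \<Rightarrow> bool) \<Rightarrow> nat \<Rightarrow> bool" where
  "supported n m M i \<longleftrightarrow> (\<forall>v<n. M i v \<longrightarrow> (\<forall>u<n. \<not> M i u \<longrightarrow> (\<exists>f<m. M f u \<and> \<not> M f v)))"

definition prune :: "nat \<Rightarrow> nat \<Rightarrow> (nat \<Rightarrow> nat \<Rightarrow> bool) \<Rightarrow> nat \<Rightarrow> nat \<Rightarrow> bool" where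
  "prune n m M i v \<longleftrightarrow> M i v \<and> supported n m M i"

definition prune_bit :: "bool list \<Rightarrow> nat \<Rightarrow> bool" where
  "prune_bit x = matrix_bit (vertex_count x) (edge_count x)
     (\<lambda>i v. entry x i v \<and> supported (vertex_count x) (edge_count x) (entry x) i)"

definition covering :: "bool list \<Rightarrow> bool" where
  "covering x \<longleftrightarrow> (\<forall>v<vertex_count x. \<exists>i<edge_count x. entry x i v)"

lemma decidable_supported:
  assumes "definable a"
  shows "decidable (\<lambda>x e. supported (vertex_count x) (edge_count x) (entry x) (a x e))"
  unfolding supported_def
  by (intro definable_intros definable_vertex_count definable_edge_count decidable_entry assms definable_ren[OF assms])

lemma decidable_prune_bit: "decidable (\<lambda>x e. prune_bit x (e 0))"
  unfolding prune_bit_def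
  by (intro decidable_matrix_bit definable_var definable_vertex_count definable_edge_count decidable_conj
      decidable_entry decidable_supported)

lemma decidable_covering: "decidable (\<lambda>x e. covering x)"
  unfolding covering_def by (intro definable_intros definable_vertex_count definable_edge_count decidable_entry)

lemma matrix_word_cong:
  "(\<And>i v. i < m \<Longrightarrow> v < n \<Longrightarrow> M i v = M' i v) \<Longrightarrow> matrix_word n m M = matrix_word n m M'"
  unfolding matrix_word_def by (simp cong: matrix_hypergraph_cong)

lemma supported_cong:
  assumes "\<And>i v. i < m \<Longrightarrow> v < n \<Longrightarrow> M i v = M' i v" "i < m"
  shows "supported n m M i = supported n m M' i"
  unfolding supported_def using assms by (simp cong: conj_cong)

lemma prune_word:
  "map (prune_bit (matrix_word n m M)) [0..<length (matrix_word n m M)] = matrix_word n m (prune n m M)"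
proof -
  let ?M = "\<lambda>i v. entry (matrix_word n m M) i v \<and> supported n m (entry (matrix_word n m M)) i"
  have "map (prune_bit (matrix_word n m M)) [0..<length (matrix_word n m M)] = matrix_word n m ?M"
    by (simp only: prune_bit_def vertex_count_matrix_word edge_count_matrix_word length_matrix_word)
      (simp only: matrix_word_eq)
  also have "\<dots> = matrix_word n m (prune n m M)"
  proof (rule matrix_word_cong)
    fix i v assume "i < m" "v < n"
    moreover have "supported n m (entry (matrix_word n m M)) i = supported n m M i"
      by (rule supported_cong) (use \<open>i < m\<close> in simp_all)
    ultimately show "?M i v = prune n m M i v" by (simp add: prune_def)
  qed
  finally show ?thesis .
qed

lemma prune_words:
  "((\<lambda>y. map (prune_bit y) [0..<length y]) ^^ t) (matrix_word n m M) = matrix_word n m ((prune n m ^^ t) M)"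
  by (induction t) (simp_all only: funpow.simps comp_apply id_apply prune_word)

definition stable :: "nat \<Rightarrow> nat \<Rightarrow> (nat \<Rightarrow> nat \<Rightarrow> bool) \<Rightarrow> bool" where
  "stable n m M \<longleftrightarrow> (\<forall>i<m. \<forall>v<n. M i v \<longrightarrow> supported n m M i)"

lemma stable_prune:
  assumes "stable n m M" shows "stable n m (prune n m M)"
proof -
  have eq: "prune n m M i v = M i v" if "i < m" "v < n" for i v
    using assms that by (auto simp: stable_def prune_def)
  have "supported n m (prune n m M) i = supported n m M i" if "i < m" for i
    by (rule supported_cong[OF _ that]) (rule eq)
  with eq assms show ?thesis by (simp add: stable_def)
qed

text \<open>A round on an unstable matrix erases a nonempty row, and stability persists; so more
  than \<open>m\<close> rounds force stability.\<close>

lemma stable_or_fewer_rows: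
  "stable n m ((prune n m ^^ t) M) \<or> card {i. i < m \<and> (\<exists>v<n. (prune n m ^^ t) M i v)} + t \<le> m"
proof (induction t)
  case 0
  have "card {i. i < m \<and> (\<exists>v<n. M i v)} \<le> card {..<m}" by (rule card_mono) auto
  then show ?case by simp
next
  case (Suc t)
  let ?M = "(prune n m ^^ t) M"
  let ?A = "{i. i < m \<and> (\<exists>v<n. ?M i v)}" and ?B = "{i. i < m \<and> (\<exists>v<n. prune n m ?M i v)}"
  show ?case
  proof (cases "stable n m ?M")
    case True
    then show ?thesis by (simp add: stable_prune)
  next
    case False
    then obtain i v where iv: "i < m" "v < n" "?M i v" "\<not> supported n m ?M i" by (auto simp: stable_def)
    have "?B \<subseteq> ?A" by (auto simp: prune_def)
    moreover have "i \<in> ?A" "i \<notin> ?B" using iv by (auto simp: prune_def)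
    ultimately have "?B \<subset> ?A" by blast
    moreover have "finite ?A" by simp
    ultimately have "card ?B < card ?A" by (rule psubset_card_mono[rotated])
    with Suc False show ?thesis by simp
  qed
qed

text \<open>A row that survives is an original hyperedge and therefore still connected in the
  tree.\<close>

lemma prune_rows: "(\<forall>v. (prune n m ^^ t) M i v = M i v) \<or> (\<forall>v. \<not> (prune n m ^^ t) M i v)"
  by (induction t) (auto simp: prune_def)

text \<open>The rows of an exact cover support each other in every round: a vertex outside of row
  \<open>i\<close> is covered by another row of \<open>I\<close>, which misses all vertices of row
  \<open>i\<close>.\<close>

lemma prune_cover:
  assumes I: "I \<subseteq> {..<m}" "\<And>v. v < n \<Longrightarrow> \<exists>!i. i \<in> I \<and> M i v" and i: "i \<in> I"
  shows "(prune n m ^^ t) M i v = M i v"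
  using i
proof (induction t arbitrary: i v)
  case (Suc t)
  let ?M = "(prune n m ^^ t) M"
  have "supported n m ?M i"
    unfolding supported_def
  proof (intro allI impI)
    fix v u assume v: "v < n" "?M i v" and u: "u < n" "\<not> ?M i u"
    from I(2)[OF u(1)] obtain f where f: "f \<in> I" "M f u" by blast
    have "\<not> M f v" using I(2)[OF v(1)] f Suc v u by metis
    with f I(1) Suc.IH[OF f(1)] show "\<exists>f<m. ?M f u \<and> \<not> ?M f v" by auto
  qed
  with Suc.IH[OF Suc.prems] show ?case by (simp add: prune_def[of n m ?M i v])
qed simp

text \<open>\<open>m < t\<close> guarantees stability, which is arc consistency;
  \<open>hypertree_exact_cover\<close> then applies to the nonempty surviving rows. The tree occurs
  in the proof only, never in the procedure.\<close>

lemma covering_iff_exact_cover: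
  assumes H: "hypertree (matrix_hypergraph n m M)" and t: "m < t"
  shows "covering (matrix_word n m ((prune n m ^^ t) M)) \<longleftrightarrow> has_exact_cover (matrix_hypergraph n m M)"
proof -
  let ?M = "(prune n m ^^ t) M"
  have "covering (matrix_word n m ?M) \<longleftrightarrow> (\<forall>v<n. \<exists>i<m. ?M i v)"
    by (simp add: covering_def cong: conj_cong)
  also have "\<dots> \<longleftrightarrow> (\<exists>I\<subseteq>{..<m}. \<forall>v<n. \<exists>!i. i \<in> I \<and> M i v)"
  proof
    assume "\<exists>I\<subseteq>{..<m}. \<forall>v<n. \<exists>!i. i \<in> I \<and> M i v"
    then obtain I where I: "I \<subseteq> {..<m}" "\<And>v. v < n \<Longrightarrow> \<exists>!i. i \<in> I \<and> M i v" by blast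
    show "\<forall>v<n. \<exists>i<m. ?M i v"
    proof (intro allI impI)
      fix v assume "v < n"
      then obtain i where i: "i \<in> I" "M i v" using I(2) by blast
      then have "?M i v" using prune_cover[OF I i(1)] by simp
      with i(1) I(1) show "\<exists>i<m. ?M i v" by blast
    qed
  next
    assume cov: "\<forall>v<n. \<exists>i<m. ?M i v"
    have st: "stable n m ?M"
      using stable_or_fewer_rows[of n m t M] t by simp
    define row where "row i = {v. v < n \<and> ?M i v}" for i
    define S where "S = {row i | i. i < m \<and> row i \<noteq> {}}"
    obtain F where F: "is_tree {..<n} F"
      and e: "\<And>i. i < m \<Longrightarrow> connected_graph {v. v < n \<and> M i v} (induced_edges F {v. v < n \<and> M i v})"
      using H by (auto simp: hypertree_def)
    have S: "e \<subseteq> {..<n} \<and> connected_graph e (induced_edges F e)" if eS: "e \<in> S" for e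
    proof -
      from eS have "\<exists>i. e = row i \<and> i < m \<and> row i \<noteq> {}" unfolding S_def by (rule CollectD)
      then obtain i where i: "e = row i" "i < m" "row i \<noteq> {}" by (elim exE conjE) (rule that)
      from i(3) have "\<not> (\<forall>v. \<not> ?M i v)" by (auto simp: row_def)
      with prune_rows[of t n m M i] have "row i = {v. v < n \<and> M i v}" by (simp add: row_def)
      with e[OF i(2)] i(1) show ?thesis by auto
    qed
    have covS: "\<exists>e\<in>S. v \<in> e" if "v \<in> {..<n}" for v
    proof -
      from cov that obtain i where "i < m" "?M i v" by auto
      with that have "v \<in> row i" "row i \<in> S" by (auto simp: S_def row_def)
      then show ?thesis by blast
    qed
    have arcS: "\<exists>f\<in>S. v \<in> f \<and> u \<notin> f" if "e \<in> S" "u \<in> e" "v \<in> {..<n}" "v \<notin> e" for e u v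
    proof -
      from \<open>e \<in> S\<close> have "\<exists>i. e = row i \<and> i < m \<and> row i \<noteq> {}" unfolding S_def by (rule CollectD)
      then obtain i where i: "e = row i" "i < m" by (elim exE conjE) (rule that)
      with that have iu: "?M i u" "u < n" "\<not> ?M i v" "v < n" by (auto simp: row_def)
      with st i have "supported n m ?M i" by (auto simp: stable_def)
      with iu obtain f where "f < m" "?M f v" "\<not> ?M f u" unfolding supported_def by blast
      with iu have "v \<in> row f" "u \<notin> row f" "row f \<in> S" by (auto simp: S_def row_def)
      then show ?thesis by blast
    qed
    have "\<exists>c. (\<forall>v\<in>{..<n}. c v \<in> S \<and> v \<in> c v) \<and> (\<forall>u\<in>{..<n}. \<forall>v\<in>c u. c v = c u)"
      by (rule hypertree_exact_cover[OF F S covS arcS])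
    then obtain c where c0: "(\<forall>v\<in>{..<n}. c v \<in> S \<and> v \<in> c v) \<and> (\<forall>u\<in>{..<n}. \<forall>v\<in>c u. c v = c u)" ..
    then have c: "\<And>v. v \<in> {..<n} \<Longrightarrow> c v \<in> S \<and> v \<in> c v"
      "\<And>u v. u \<in> {..<n} \<Longrightarrow> v \<in> c u \<Longrightarrow> c v = c u"
      by blast+
    \<comment> \<open>A hyperedge may occur in several copies; fixing one index for each set puts a
      single copy into the cover.\<close>
    define idx where "idx e = (SOME i. i < m \<and> e = row i)" for e
    have idx: "idx e < m \<and> e = row (idx e)" if "e \<in> S" for e
    proof -
      from that have "\<exists>i. i < m \<and> e = row i" unfolding S_def by blast
      then show ?thesis unfolding idx_def by (rule someI_ex)
    qed
    define I where "I = (\<lambda>v. idx (c v)) ` {..<n}"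
    have M: "M (idx (c u)) v \<longleftrightarrow> v \<in> c u" if u: "u < n" "v < n" for u v
    proof -
      have r: "idx (c u) < m" "c u = row (idx (c u))" "u \<in> c u" using idx[of "c u"] c(1)[of u] u by auto
      then have "?M (idx (c u)) u" by (simp add: row_def set_eq_iff)
      with prune_rows[of t n m M "idx (c u)"] have "\<forall>w. ?M (idx (c u)) w = M (idx (c u)) w" by blast
      then show ?thesis using r(2) u(2) by (auto simp: row_def set_eq_iff)
    qed
    have "\<exists>!i. i \<in> I \<and> M i v" if v: "v < n" for v
    proof (rule ex1I)
      show "idx (c v) \<in> I \<and> M (idx (c v)) v" using v M[OF v v] c(1)[of v] by (auto simp: I_def)
    next
      fix i assume "i \<in> I \<and> M i v"
      then obtain u where u: "u < n" "i = idx (c u)" "M i v" by (auto simp: I_def)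
      with M[OF u(1) v] have "v \<in> c u" by simp
      with c(2)[of u v] u show "i = idx (c v)" by simp
    qed
    moreover have "I \<subseteq> {..<m}" using idx c(1) by (auto simp: I_def)
    ultimately show "\<exists>I\<subseteq>{..<m}. \<forall>v<n. \<exists>!i. i \<in> I \<and> M i v" by blast
  qed
  finally show ?thesis by (simp only: has_exact_cover_matrix)
qed

text \<open>The machine decides \<open>?L\<close> on all words. This language agrees with
  \<open>EXACT_COVER\<close> on encodings of hypertrees, as is demanded, but not necessarily
  elsewhere.\<close>

lemma hypertree_exact_cover_polytime: "polytime_decidable_on (hypergraph_words hypertree) EXACT_COVER"
proof -
  let ?L = "{x. covering (((\<lambda>y. map (prune_bit y) [0..<length y]) ^^ length x) x)}"
  have "x \<in> ?L \<longleftrightarrow> x \<in> EXACT_COVER" if x: "x \<in> hypergraph_words hypertree" for x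
  proof -
    from x obtain n m M where M: "x = matrix_word n m M" "hypertree (matrix_hypergraph n m M)"
      unfolding mem_hypergraph_words well_formed_def decoded_def by blast
    have "m < length x" by (simp add: M)
    then show ?thesis
      using covering_iff_exact_cover[OF M(2), of "length x"]
      unfolding mem_Collect_eq EXACT_COVER_def by (simp only: M(1) prune_words matrix_word_mem_hypergraph_words)
  qed
  note eq = this
  have "polytime_decidable_on UNIV ?L"
    by (rule polytime_decidable_iterate[OF decidable_prune_bit decidable_covering])
  then obtain M p where M: "is_turing_machine M" "\<And>x. \<exists>t\<le>poly p (length x).
      halted_with_output M ((tm_step M ^^ t) (tm_start M x)) [x \<in> ?L]"
    unfolding polytime_decidable_on_def polytime_computable_on_def by blast
  show ?thesis
    unfolding polytime_decidable_on_def polytime_computable_on_def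
  proof (rule exI[of _ M], rule exI[of _ p], intro conjI ballI)
    fix x assume x: "x \<in> hypergraph_words hypertree"
    show "\<exists>t\<le>poly p (length x). halted_with_output M ((tm_step M ^^ t) (tm_start M x)) [x \<in> EXACT_COVER]"
      using M(2)[of x] unfolding eq[OF x] .
  qed (rule M(1))
qed

section \<open>Making a hypergraph acyclic\<close>

text \<open>Row \<open>m\<close> contains all vertices but \<open>n + 1\<close>, so it is the centre of a star-shaped join tree. It cannot
  be used in an exact cover since row \<open>m + 1\<close>, the only one that contains \<open>n + 1\<close>, meets it in \<open>n\<close>.\<close>

definition add_centre :: "nat \<Rightarrow> nat \<Rightarrow> (nat \<Rightarrow> nat \<Rightarrow> bool) \<Rightarrow> nat \<Rightarrow> nat \<Rightarrow> bool" where
  "add_centre n m M i v \<longleftrightarrow> i < m \<and> v < n \<and> M i v \<or> i = m \<and> v \<le> n \<or> i = Suc m \<and> (v = n \<or> v = Suc n)"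

text \<open>Row \<open>m\<close> is the parent of all others. Two rows share vertices up to
  \<open>n\<close> only, and these lie in row \<open>m\<close>.\<close>

lemma alpha_acyclic_add_centre: "alpha_acyclic (matrix_hypergraph (n + 2) (m + 2) (add_centre n m M))"
proof -
  have "rooted (m + 2) (\<lambda>i j. i \<noteq> m \<and> j = m) (\<lambda>i j. i = m \<and> j \<noteq> m)"
    by (simp add: rooted_def)
  moreover have "\<exists>k<m + 2. i \<noteq> m \<and> k = m \<or> j \<noteq> m \<and> k = m" if "i \<noteq> j" for i j
    by (rule exI[of _ m]) (use that in simp)
  moreover have "\<exists>k<m + 2. add_centre n m M k v \<and> (i \<noteq> m \<and> k = m \<or> j \<noteq> m \<and> k = m)"
    if "i \<noteq> j" "add_centre n m M i v" "add_centre n m M j v" for i j v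
    by (rule exI[of _ m]) (use that in \<open>auto simp: add_centre_def\<close>)
  ultimately have "join_rooted (n + 2) (m + 2) (add_centre n m M) (\<lambda>i j. i \<noteq> m \<and> j = m) (\<lambda>i j. i = m \<and> j \<noteq> m)"
    unfolding join_rooted_def by (intro conjI allI impI) blast+
  then show ?thesis unfolding alpha_acyclic_matrix by blast
qed

lemma has_exact_cover_add_centre:
  "has_exact_cover (matrix_hypergraph (n + 2) (m + 2) (add_centre n m M)) \<longleftrightarrow>
   has_exact_cover (matrix_hypergraph n m M)"
  unfolding has_exact_cover_matrix
proof
  let ?M = "add_centre n m M"
  assume "\<exists>I\<subseteq>{..<m + 2}. \<forall>v<n + 2. \<exists>!i. i \<in> I \<and> ?M i v"
  then obtain I where I: "I \<subseteq> {..<m + 2}" "\<And>v. v < n + 2 \<Longrightarrow> \<exists>!i. i \<in> I \<and> ?M i v" by blast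
  have "\<exists>i. i \<in> I \<and> ?M i (Suc n)" using I(2)[of "Suc n"] by auto
  then have s: "Suc m \<in> I" by (auto simp: add_centre_def)
  have m: "m \<notin> I"
  proof
    assume "m \<in> I"
    moreover have "?M m n" "?M (Suc m) n" by (auto simp: add_centre_def)
    moreover have "\<exists>!i. i \<in> I \<and> ?M i n" using I(2) by simp
    ultimately have "m = Suc m" using s by blast
    then show False by simp
  qed
  have e: "i \<in> I \<and> ?M i v \<longleftrightarrow> i \<in> I \<inter> {..<m} \<and> M i v" if "v < n" for i v
    using that m by (auto simp: add_centre_def)
  have "\<exists>!i. i \<in> I \<inter> {..<m} \<and> M i v" if "v < n" for v
    using I(2)[of v] that unfolding e[OF that] by simp
  then show "\<exists>I\<subseteq>{..<m}. \<forall>v<n. \<exists>!i. i \<in> I \<and> M i v"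
    by (intro exI[of _ "I \<inter> {..<m}"]) simp
next
  let ?M = "add_centre n m M"
  assume "\<exists>I\<subseteq>{..<m}. \<forall>v<n. \<exists>!i. i \<in> I \<and> M i v"
  then obtain I where I: "I \<subseteq> {..<m}" "\<And>v. v < n \<Longrightarrow> \<exists>!i. i \<in> I \<and> M i v" by blast
  have Im: "i < m" if "i \<in> I" for i using I(1) that by auto
  have "\<exists>!i. i \<in> insert (Suc m) I \<and> ?M i v" if v: "v < n + 2" for v
  proof (cases "v < n")
    case True
    have "i \<in> insert (Suc m) I \<and> ?M i v \<longleftrightarrow> i \<in> I \<and> M i v" for i
      using True Im by (auto simp: add_centre_def)
    then show ?thesis using I(2)[OF True] by simp
  next
    case False
    have "i \<in> insert (Suc m) I \<and> ?M i v \<longleftrightarrow> i = Suc m" for i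
      using False v by (auto simp: add_centre_def dest: Im)
    then show ?thesis by simp
  qed
  moreover have "insert (Suc m) I \<subseteq> {..<m + 2}" using I(1) by auto
  ultimately show "\<exists>I\<subseteq>{..<m + 2}. \<forall>v<n + 2. \<exists>!i. i \<in> I \<and> ?M i v" by blast
qed

section \<open>Exact covers from coloured slots\<close>

text \<open>The vertices are the pairs of a slot and a colour. With respect to a slot, a hyperedge plays a role
  coded by a number: \<open>0\<close> if it contains no vertex of the slot, \<open>1\<close> if it contains all of them, \<open>4 * b + 2\<close>
  if it contains all but that of colour \<open>b\<close> (it produces \<open>b\<close>), and \<open>4 * b + 3\<close> if it contains only that of
  colour \<open>b\<close> (it consumes \<open>b\<close>). In an exact cover, what is produced is consumed.\<close>

definition producer :: "nat \<Rightarrow> nat" where "producer b = 4 * b + 2"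

definition consumer :: "nat \<Rightarrow> nat" where "consumer b = 4 * b + 3"

lemma role_simps [simp]:
  "producer b = producer c \<longleftrightarrow> b = c" "consumer b = consumer c \<longleftrightarrow> b = c"
  "producer b \<noteq> consumer c" "consumer b \<noteq> producer c"
  "producer b \<noteq> 0" "consumer b \<noteq> 0" "0 < producer b" "0 < consumer b"
  "producer b \<noteq> Suc 0" "consumer b \<noteq> Suc 0" "0 \<noteq> producer b" "0 \<noteq> consumer b"
  "Suc 0 \<noteq> producer b" "Suc 0 \<noteq> consumer b"
  unfolding producer_def consumer_def by presburger+

definition covers :: "nat \<Rightarrow> nat \<Rightarrow> bool" where
  "covers r a \<longleftrightarrow> r = 1 \<or> r mod 4 = 2 \<and> r \<noteq> producer a \<or> r = consumer a"

lemma covers_simps [simp]: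
  "\<not> covers 0 a" "covers (Suc 0) a" "covers (producer b) a \<longleftrightarrow> a \<noteq> b" "covers (consumer b) a \<longleftrightarrow> a = b"
proof -
  have "producer b mod 4 = 2" "consumer b mod 4 \<noteq> 2" unfolding producer_def consumer_def by presburger+
  then show "covers (producer b) a \<longleftrightarrow> a \<noteq> b" "covers (consumer b) a \<longleftrightarrow> a = b"
    by (auto simp: covers_def)
qed (simp_all add: covers_def)

lemma covers_cases:
  assumes "covers r a"
  obtains "r = 1" | b where "r = producer b" "a \<noteq> b" | "r = consumer a"
proof -
  have "r mod 4 = 2 \<Longrightarrow> r = producer (r div 4)" unfolding producer_def by presburger
  then show ?thesis using assms that by (auto simp: covers_def)
qed

text \<open>Some other hyperedge covers \<open>b\<close>. A full one or a second producer would
  overlap the first producer, given three colours, so it consumes \<open>b\<close>. A consumer of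
  any other colour would cover that colour twice.\<close>

lemma produced_consumed:
  assumes B: "3 \<le> B" and cover: "\<And>a. a < B \<Longrightarrow> \<exists>!e. e \<in> I \<and> covers (R e) a"
    and e: "e \<in> I" "R e = producer b" "b < B"
  shows "\<exists>e'\<in>I. R e' = consumer b" "e' \<in> I \<Longrightarrow> R e' = consumer c \<Longrightarrow> c < B \<Longrightarrow> c = b"
proof -
  have u: "e' = e''" if "a < B" "e' \<in> I" "e'' \<in> I" "covers (R e') a" "covers (R e'') a" for a e' e''
    using cover[OF that(1)] that by blast
  obtain e' where e': "e' \<in> I" "covers (R e') b" using cover[OF e(3)] by blast
  have "\<not> covers (R e) b" using e(2) by simp
  with e' have ne: "e' \<noteq> e" by blast
  from e'(2) have "R e' = consumer b"
  proof (cases rule: covers_cases)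
    case 1
    define a where "a = (if b = 0 then 1 else 0 :: nat)"
    have "a < B" "a \<noteq> b" using B by (auto simp: a_def)
    with u[of a e' e] e e' 1 ne show ?thesis by simp
  next
    case (2 b')
    \<comment> \<open>One of the colours \<open>0\<close>, \<open>1\<close>, \<open>2\<close>
      differs from both \<open>b\<close> and \<open>b'\<close>, so both producers cover it.\<close>
    define a where "a = (if b \<noteq> 0 \<and> b' \<noteq> 0 then 0 else if b \<noteq> 1 \<and> b' \<noteq> 1 then 1 else 2 :: nat)"
    have "a < B" "a \<noteq> b" "a \<noteq> b'" using B 2 by (auto simp: a_def)
    with u[of a e' e] e e' 2 ne show ?thesis by simp
  qed simp
  with e' show "\<exists>e'\<in>I. R e' = consumer b" by blast
  show "c = b" if "e' \<in> I" "R e' = consumer c" "c < B" for e'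
  proof (rule ccontr)
    assume "c \<noteq> b"
    then have "e' = e" using u[OF that(3,1) e(1)] that e(2) by simp
    with that(2) e(2) show False by simp
  qed
qed

lemma slot_full:
  assumes "e \<in> I" "R e = 1" "\<And>e'. e' \<in> I \<Longrightarrow> R e' \<noteq> 0 \<Longrightarrow> e' = e"
  shows "\<exists>!e. e \<in> I \<and> covers (R e) a"
proof (rule ex1I[of _ e])
  fix x assume x: "x \<in> I \<and> covers (R x) a"
  then have "R x \<noteq> 0" by (metis covers_simps(1))
  with assms(3) x show "x = e" by simp
qed (use assms(1,2) in simp)

text \<open>Converse of \<open>produced_consumed\<close>: a producer and a consumer of the same
  colour partition the slot.\<close>

lemma slot_produced:
  assumes e: "e \<in> I" "R e = producer b" "e' \<in> I" "R e' = consumer b"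
    and u: "\<And>e''. e'' \<in> I \<Longrightarrow> R e'' \<noteq> 0 \<Longrightarrow> e'' = e \<or> e'' = e'"
  shows "\<exists>!e. e \<in> I \<and> covers (R e) a"
proof -
  define e1 e2 where "e1 = (if a = b then e' else e)" and "e2 = (if a = b then e else e')"
  have c: "e1 \<in> I" "covers (R e1) a" "\<not> covers (R e2) a"
    using e by (auto simp: e1_def e2_def)
  show ?thesis
  proof (rule ex1I[of _ e1])
    fix x assume x: "x \<in> I \<and> covers (R x) a"
    then have "R x \<noteq> 0" by (metis covers_simps(1))
    with u[of x] x have "x = e1 \<or> x = e2" by (auto simp: e1_def e2_def)
    with x c(3) show "x = e1" by metis
  qed (use c in simp)
qed

section \<open>The tableau of a computation as an exact cover problem\<close>

text \<open>The contents of the tapes are described relative to the heads: the cell at position \<open>i\<close> of tape \<open>j\<close> lies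
  \<open>i - 2 * T\<close> cells to the right of the head. Colours \<open>a < 2 * S\<close> of a cell are symbols, with \<open>S\<close> added for
  the cell with absolute position \<open>0\<close>. At time \<open>t\<close> only the positions between \<open>t\<close> and \<open>4 * T - t\<close> are
  described, as what enters from outside is unknown. The slots \<open>(\<kappa>, t, j, i)\<close> are cells (\<open>\<kappa> = 0\<close>), states
  (\<open>\<kappa> = 1\<close>), the move of the head as communicated to a cell (\<open>\<kappa> = 2\<close>) and unknown bits of the input
  (\<open>\<kappa> = 3\<close>). The hyperedges are the start with \<open>ei\<close> unknown bits (\<open>ek = 0\<close>), an unknown bit (\<open>ek = 1\<close>),
  the shift of a cell (\<open>ek = 2\<close>), a transition of the machine (\<open>ek = 3\<close>), the final cells (\<open>ek = 4\<close>) and the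
  final state (\<open>ek = 5\<close>).\<close>

locale tableau =
  fixes k S T Y P nc B :: nat and ini :: "nat \<Rightarrow> nat \<Rightarrow> nat"
    and cq cq' :: "nat \<Rightarrow> nat" and cs cw cd :: "nat \<Rightarrow> nat \<Rightarrow> nat"
  assumes T: "0 < T" and k: "0 < k" and P: "P \<le> T" and Y: "2 * T < Y" "Y + P \<le> 4 * T"
    and S: "3 \<le> S" "2 * S \<le> B" "nc \<le> B"
    and ini: "\<And>j i. ini j i < 2 * S"
    and ctl: "\<And>c. c < nc \<Longrightarrow> cq c < B" "\<And>c. c < nc \<Longrightarrow> cq' c < B"
      "\<And>c j. c < nc \<Longrightarrow> j < k \<Longrightarrow> cs c j < 2 * S" "\<And>c j. c < nc \<Longrightarrow> j < k \<Longrightarrow> cw c j < 2 * S"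
      "\<And>c j. c < nc \<Longrightarrow> j < k \<Longrightarrow> cd c j < 3"
begin

definition win :: "nat \<Rightarrow> nat \<Rightarrow> bool" where "win t i \<longleftrightarrow> t \<le> i \<and> i + t \<le> 4 * T"

text \<open>The cell under the head has no move slot, as the transition itself consumes it. Slots
  that are not valid are met by start hyperedges only and thereby force one into the cover.\<close>

definition valid :: "nat \<Rightarrow> nat \<Rightarrow> nat \<Rightarrow> nat \<Rightarrow> bool" where
  "valid \<kappa> t j i \<longleftrightarrow> \<kappa> = 0 \<and> win t i \<or> \<kappa> = 1 \<and> j = 0 \<and> i = 0 \<or>
     \<kappa> = 2 \<and> t < T \<and> win t i \<and> i \<noteq> 2 * T \<or> \<kappa> = 3 \<and> t = 0 \<and> j = 0 \<and> i < P"

text \<open>Moves are coded as \<open>0\<close>, \<open>1\<close>, \<open>2\<close> for left, stay,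
  right, so a cell now at \<open>i\<close> was at \<open>i + d - 1\<close> before. A rejecting final
  colour has no consumer. Index tuples without a meaning give empty hyperedges, which allows
  \<open>edges\<close> to be a full box.\<close>

definition role :: "nat \<times> nat \<times> nat \<times> nat \<times> nat \<times> nat \<Rightarrow> nat \<times> nat \<times> nat \<times> nat \<Rightarrow> nat" where
  "role = (\<lambda>(ek, et, ej, ei, ea, ed) (\<kappa>, t, j, i).
    (if ek = 0 \<and> et = 0 \<and> ej = 0 \<and> ea = 0 \<and> ed = 0 \<and> ei \<le> P then
       (if \<not> valid \<kappa> t j i \<or> \<kappa> = 3 \<and> ei \<le> i then 1
        else if \<kappa> = 1 \<and> t = 0 then producer 0
        else if \<kappa> = 0 \<and> t = 0 \<and> \<not> (j = 0 \<and> Y \<le> i \<and> i < Y + ei) then producer (ini j i) else 0)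
     else if \<not> valid \<kappa> t j i then 0
     else if ek = 1 \<and> et = 0 \<and> ej = 0 \<and> ed = 0 \<and> ei < P \<and> ea < 2 then
       (if \<kappa> = 3 \<and> i = ei then 1
        else if \<kappa> = 0 \<and> t = 0 \<and> j = 0 \<and> i = Y + ei then producer (ea + 1) else 0)
     else if ek = 2 \<and> et < T \<and> win et ei \<and> ei \<noteq> 2 * T \<and> ea < 2 * S \<and> ed < 3 then
       (if \<kappa> = 0 \<and> t = Suc et \<and> j = ej \<and> i + ed = ei + 1 then producer ea
        else if \<kappa> = 0 \<and> t = et \<and> j = ej \<and> i = ei then consumer ea
        else if \<kappa> = 2 \<and> t = et \<and> j = ej \<and> i = ei then consumer ed else 0)
     else if ek = 3 \<and> ej = 0 \<and> ei = 0 \<and> ed = 0 \<and> et < T \<and> ea < nc then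
       (if \<kappa> = 1 \<and> t = Suc et then producer (cq' ea)
        else if \<kappa> = 1 \<and> t = et then consumer (cq ea)
        else if \<kappa> = 0 \<and> t = Suc et \<and> i + cd ea j = 2 * T + 1 then producer (cw ea j)
        else if \<kappa> = 0 \<and> t = et \<and> i = 2 * T then consumer (cs ea j)
        else if \<kappa> = 2 \<and> t = et then producer (cd ea j) else 0)
     else if ek = 4 \<and> et = 0 \<and> ed = 0 \<and> win T ei \<and> ea < 2 * S \<and> (ej = 1 \<and> S \<le> ea \<longrightarrow> ea = S + 2) then
       (if \<kappa> = 0 \<and> t = T \<and> j = ej \<and> i = ei then consumer ea else 0)
     else if ek = 5 \<and> et = 0 \<and> ej = 0 \<and> ei = 0 \<and> ed = 0 then
       (if \<kappa> = 1 \<and> t = T then consumer ea else 0)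
     else 0))"

lemmas role_eq [simp] = fun_cong[OF fun_cong[OF role_def], of "(ek, et, ej, ei, ea, ed)" "(\<kappa>, t, j, i)" for ek et ej ei ea ed \<kappa> t j i,
  unfolded prod.case]

definition edges :: "(nat \<times> nat \<times> nat \<times> nat \<times> nat \<times> nat) set" where
  "edges = {(ek, et, ej, ei, ea, ed). ek < 6 \<and> et < T + 1 \<and> ej < k \<and> ei < 4 * T + 1 \<and> ea < B \<and> ed < 3}"

definition slots :: "(nat \<times> nat \<times> nat \<times> nat) set" where
  "slots = {(\<kappa>, t, j, i). \<kappa> < 4 \<and> t < T + 1 \<and> j < k \<and> i < 4 * T + 1}"

definition slot_cover :: "(nat \<times> nat \<times> nat \<times> nat \<times> nat \<times> nat) set \<Rightarrow> bool" where
  "slot_cover I \<longleftrightarrow> I \<subseteq> edges \<and> (\<forall>s\<in>slots. \<forall>a<B. \<exists>!e. e \<in> I \<and> covers (role e s) a)"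

text \<open>\<open>st\<close> and \<open>ct\<close> are the states and the contents of the tapes in a run where \<open>bt\<close> are the \<open>l\<close> unknown bits.\<close>

definition run :: "nat \<Rightarrow> (nat \<Rightarrow> nat) \<Rightarrow> (nat \<Rightarrow> nat) \<Rightarrow> (nat \<Rightarrow> nat \<Rightarrow> nat \<Rightarrow> nat) \<Rightarrow> bool" where
  "run l bt st ct \<longleftrightarrow> st 0 = 0 \<and> (\<forall>t. st t < B) \<and> (\<forall>t j i. j < k \<longrightarrow> ct t j i < 2 * S) \<and>
     (\<forall>j i. j < k \<longrightarrow> ct 0 j i = (if j = 0 \<and> Y \<le> i \<and> i < Y + l then bt (i - Y) + 1 else ini j i)) \<and>
     (\<forall>t<T. \<exists>c<nc. cq c = st t \<and> (\<forall>j<k. cs c j = ct t j (2 * T))) \<and>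
     (\<forall>t<T. \<forall>c<nc. cq c = st t \<and> (\<forall>j<k. cs c j = ct t j (2 * T)) \<longrightarrow> st (Suc t) = cq' c \<and>
       (\<forall>j<k. \<forall>i>0. ct (Suc t) j i = (if i + cd c j = 2 * T + 1 then cw c j else ct t j (i + cd c j - 1))))"

lemma runD:
  assumes "run l bt st ct"
  shows "st 0 = 0" "st t < B" "j < k \<Longrightarrow> ct t j i < 2 * S"
    "j < k \<Longrightarrow> ct 0 j i = (if j = 0 \<and> Y \<le> i \<and> i < Y + l then bt (i - Y) + 1 else ini j i)"
    "t < T \<Longrightarrow> \<exists>c<nc. cq c = st t \<and> (\<forall>j<k. cs c j = ct t j (2 * T))"
    "t < T \<Longrightarrow> c < nc \<Longrightarrow> cq c = st t \<Longrightarrow> (\<And>j. j < k \<Longrightarrow> cs c j = ct t j (2 * T)) \<Longrightarrow> st (Suc t) = cq' c"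
    "t < T \<Longrightarrow> c < nc \<Longrightarrow> cq c = st t \<Longrightarrow> (\<And>j. j < k \<Longrightarrow> cs c j = ct t j (2 * T)) \<Longrightarrow> j < k \<Longrightarrow> 0 < i \<Longrightarrow>
       ct (Suc t) j i = (if i + cd c j = 2 * T + 1 then cw c j else ct t j (i + cd c j - 1))"
  using assms unfolding run_def by (elim conjE; blast)+

text \<open>A colour from \<open>S\<close> on marks absolute cell \<open>0\<close>, whose place in
  the window depends on the head. On the output tape this cell has to hold symbol \<open>2\<close>,
  the bit \<open>True\<close>.\<close>

definition accepting :: "(nat \<Rightarrow> nat \<Rightarrow> nat \<Rightarrow> nat) \<Rightarrow> bool" where
  "accepting ct \<longleftrightarrow> (\<forall>i. win T i \<longrightarrow> 1 < k \<longrightarrow> S \<le> ct T 1 i \<longrightarrow> ct T 1 i = S + 2)"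

lemma role_invalid: "\<not> valid \<kappa> t j i \<Longrightarrow> role e (\<kappa>, t, j, i) \<noteq> 0 \<Longrightarrow> \<exists>l\<le>P. e = (0, 0, 0, l, 0, 0)"
  by (cases e) (auto split: if_splits)

lemma role_bit:
  assumes "role e (3, 0, 0, r) \<noteq> 0" "r < P"
  shows "(\<exists>l\<le>r. e = (0, 0, 0, l, 0, 0)) \<or> (\<exists>b<2. e = (1, 0, 0, r, b, 0))"
  using assms by (cases e) (auto simp: valid_def split: if_splits)

lemma role_state:
  assumes "role e (1, t, 0, 0) = consumer b" "t < T"
  shows "\<exists>c<nc. e = (3, t, 0, 0, c, 0) \<and> cq c = b"
  using assms by (cases e) (auto simp: valid_def split: if_splits)

lemma role_cell:
  assumes "role e (0, t, j, i) = consumer a" "t < T" "win t i" "i \<noteq> 2 * T"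
  shows "\<exists>d<3. e = (2, t, j, i, a, d)"
  using assms by (cases e) (auto simp: valid_def split: if_splits)

lemma role_final:
  assumes "role e (0, T, j, i) = consumer a" "win T i"
  shows "j = 1 \<and> S \<le> a \<longrightarrow> a = S + 2"
  using assms by (cases e) (auto simp: valid_def split: if_splits)

lemma win_le: "win t i \<Longrightarrow> t \<le> T \<Longrightarrow> i < 4 * T + 1"
  by (auto simp: win_def)

text \<open>\<open>l\<close> and \<open>bt\<close> are read off the start and bit hyperedges in the
  cover. By induction on time, each state and cell slot is produced with the value of the run; at
  time \<open>T\<close> the output cell finds a consumer only if it accepts.\<close>

lemma cover_sound:
  assumes I: "slot_cover I"
  shows "\<exists>l\<le>P. \<exists>bt. (\<forall>r. bt r < 2) \<and> (\<forall>st ct. run l bt st ct \<longrightarrow> accepting ct)"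
proof -
  have B: "3 \<le> B" using S by simp
  have cov: "\<exists>!e. e \<in> I \<and> covers (role e s) a" if "s \<in> slots" "a < B" for s a
    using I that by (auto simp: slot_cover_def)
  have uniq: "e = e'" if "s \<in> slots" "a < B" "e \<in> I" "e' \<in> I" "covers (role e s) a" "covers (role e' s) a" for s a e e'
    using cov[OF that(1,2)] that(3-6) by blast
  have ex: "\<exists>e\<in>I. role e s \<noteq> 0" if "s \<in> slots" for s
  proof -
    have "0 < B" using B by simp
    from cov[OF that this] obtain e where "e \<in> I" "covers (role e s) 0" by blast
    then show ?thesis by (metis covers_simps(1))
  qed
  \<comment> \<open>A slot that is not valid: only start hyperedges meet it and each of them fills
    it, so exactly one is chosen.\<close>
  have s1: "(3, 1, 0, 0) \<in> slots" using T k by (simp add: slots_def)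
  have nv: "\<not> valid 3 1 0 0" by (simp add: valid_def)
  obtain l where l: "l \<le> P" "(0, 0, 0, l, 0, 0) \<in> I"
    using ex[OF s1] role_invalid[OF nv] by blast
  have lu: "l' = l" if "l' \<le> P" "(0, 0, 0, l', 0, 0) \<in> I" for l'
  proof -
    have "role (0, 0, 0, l', 0, 0) (3, 1, 0, 0) = 1" "role (0, 0, 0, l, 0, 0) (3, 1, 0, 0) = 1"
      using that l nv by simp_all
    then have "covers (role (0, 0, 0, l', 0, 0) (3, 1, 0, 0)) 0" "covers (role (0, 0, 0, l, 0, 0) (3, 1, 0, 0)) 0"
      by (simp_all only: covers_def) simp_all
    moreover have "0 < B" using B by simp
    ultimately have "(0, 0, 0, l', 0, 0) = (0, 0, 0, l, 0 :: nat, 0 :: nat)"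
      using uniq[OF s1 _ that(2) l(2)] by blast
    then show ?thesis by simp
  qed
  have bit: "\<exists>b<2. (1, 0, 0, r, b, 0) \<in> I" if r: "r < l" for r
  proof -
    have "(3, 0, 0, r) \<in> slots" using r l P k by (simp add: slots_def)
    then obtain e where e: "e \<in> I" "role e (3, 0, 0, r) \<noteq> 0" using ex by blast
    have "r < P" using r l by simp
    from role_bit[OF e(2) this] show ?thesis
    proof
      assume "\<exists>l\<le>r. e = (0, 0, 0, l, 0, 0)"
      then obtain l' where "l' \<le> r" "e = (0, 0, 0, l', 0, 0)" by blast
      with lu[of l'] e r \<open>r < P\<close> show ?thesis by simp
    next
      assume "\<exists>b<2. e = (1, 0, 0, r, b, 0)"
      with e show ?thesis by blast
    qed
  qed
  define bt where "bt r = (if r < l then SOME b. b < 2 \<and> (1, 0, 0, r, b, 0) \<in> I else 0)" for r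
  have bt: "bt r < 2 \<and> (1, 0, 0, r, bt r, 0) \<in> I" if "r < l" for r
    using someI_ex[OF bit[OF that]] that by (simp add: bt_def)
  have bt2: "bt r < 2" for r using bt[of r] by (cases "r < l") (auto simp: bt_def)
  have "accepting ct" if r: "run l bt st ct" for st ct
  proof -
    have ctB: "ct t j i < B" if "j < k" for t j i using runD(3)[OF r that, of t i] S by simp
    have link: "(\<exists>e'\<in>I. role e' s = consumer b) \<and> (\<forall>e'\<in>I. \<forall>c<B. role e' s = consumer c \<longrightarrow> c = b)"
      if "s \<in> slots" "e \<in> I" "role e s = producer b" "b < B" for s e b
      using produced_consumed[OF B cov[OF that(1)] that(2,3,4)] by blast
    have main: "(\<exists>e\<in>I. role e (1, t, 0, 0) = producer (st t)) \<and>
      (\<forall>j<k. \<forall>i. win t i \<longrightarrow> (\<exists>e\<in>I. role e (0, t, j, i) = producer (ct t j i)))" if "t \<le> T" for t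
      using that
    proof (induction t)
      case 0
      have "role (0, 0, 0, l, 0, 0) (1, 0, 0, 0) = producer (st 0)"
        using l runD(1)[OF r] by (simp add: valid_def)
      moreover have "\<exists>e\<in>I. role e (0, 0, j, i) = producer (ct 0 j i)" if j: "j < k" and i: "win 0 i" for j i
      proof (cases "j = 0 \<and> Y \<le> i \<and> i < Y + l")
        case True
        then have b: "bt (i - Y) < 2" "(1, 0, 0, i - Y, bt (i - Y), 0) \<in> I" using bt[of "i - Y"] by auto
        then have "role (1, 0, 0, i - Y, bt (i - Y), 0) (0, 0, j, i) = producer (ct 0 j i)"
        proof -
          have "ct 0 j i = bt (i - Y) + 1" using runD(4)[OF r j, of i] True by simp
          moreover have "i - Y < P" "Y + (i - Y) = i" using True l by auto
          ultimately show ?thesis using True i b(1) by (simp add: valid_def)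
        qed
        with b show ?thesis by blast
      next
        case False
        then have "ct 0 j i = ini j i" using runD(4)[OF r j, of i] by (simp only: if_False)
        with False have "role (0, 0, 0, l, 0, 0) (0, 0, j, i) = producer (ct 0 j i)"
          using i l by (auto simp: valid_def)
        with l show ?thesis by blast
      qed
      ultimately show ?case using l by blast
    next
      case (Suc t)
      then have t: "t < T" by simp
      have prodS: "\<exists>e\<in>I. role e (1, t, 0, 0) = producer (st t)"
        and prodC: "\<And>j i. j < k \<Longrightarrow> win t i \<Longrightarrow> \<exists>e\<in>I. role e (0, t, j, i) = producer (ct t j i)"
        using Suc by auto
      have "(1, t, 0, 0) \<in> slots" using t k by (simp add: slots_def)
      \<comment> \<open>The consumer of the state names the transition \<open>c\<close>, whose
        consumed colours must then fit the symbols under the heads.\<close>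
      with prodS obtain e where "e \<in> I" "role e (1, t, 0, 0) = consumer (st t)"
        using link runD(2)[OF r] by blast
      with role_state[OF this(2) t] obtain c where c: "c < nc" "(3, t, 0, 0, c, 0) \<in> I" "cq c = st t" by blast
      have w: "win t (2 * T)" using t by (simp add: win_def)
      have slC: "(0, t, j, i) \<in> slots" if "j < k" "win t i" for j i
        using that t win_le by (simp add: slots_def)
      have cs: "cs c j = ct t j (2 * T)" if j: "j < k" for j
      proof -
        have "role (3, t, 0, 0, c, 0) (0, t, j, 2 * T) = consumer (cs c j)"
          using c t w by (simp add: valid_def)
        moreover have "cs c j < B" using ctl(3)[OF c(1) j] S by simp
        ultimately show ?thesis using prodC[OF j w] link[OF slC[OF j w]] c(2) ctB[OF j] by blast
      qed
      note step = runD(6,7)[OF r t c(1,3) cs]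
      have "role (3, t, 0, 0, c, 0) (1, Suc t, 0, 0) = producer (st (Suc t))"
        using c t step(1) by (simp add: valid_def)
      moreover have "\<exists>e\<in>I. role e (0, Suc t, j, i) = producer (ct (Suc t) j i)"
        if j: "j < k" and i: "win (Suc t) i" for j i
      proof (cases "i + cd c j = 2 * T + 1")
        case True
        have "0 < i" using i by (simp add: win_def)
        then have "role (3, t, 0, 0, c, 0) (0, Suc t, j, i) = producer (ct (Suc t) j i)"
          using c t i True step(2)[OF _ j, of i] by (simp add: valid_def)
        with c show ?thesis by blast
      next
        case False
        have d: "cd c j < 3" by (rule ctl(5)[OF c(1) j])
        let ?i = "i + cd c j - 1"
        have i0: "0 < i" "i + cd c j = ?i + 1" using i by (simp_all add: win_def)
        have wi: "win t ?i" using i d by (auto simp: win_def)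
        have ne: "?i \<noteq> 2 * T" using False i0 by simp
        obtain e where e: "e \<in> I" "role e (0, t, j, ?i) = consumer (ct t j ?i)"
          using prodC[OF j wi] link[OF slC[OF j wi]] ctB[OF j] by blast
        obtain d' where d': "d' < 3" "e = (2, t, j, ?i, ct t j ?i, d')" using role_cell[OF e(2) t wi ne] by blast
        \<comment> \<open>A cell away from the head is passed on by a shift hyperedge; the move slot
          forces its guess \<open>d'\<close> to be the move of \<open>c\<close>.\<close>
        have "(2, t, j, ?i) \<in> slots" using slC[OF j wi] by (simp add: slots_def)
        moreover have "role (3, t, 0, 0, c, 0) (2, t, j, ?i) = producer (cd c j)"
          using c t wi ne by (simp add: valid_def)
        moreover have "role e (2, t, j, ?i) = consumer d'"
          using d' t wi ne runD(3)[OF r j] by (simp add: valid_def)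
        moreover have "cd c j < B" "d' < B" using d d' B by auto
        ultimately have "d' = cd c j" using link c(2) e(1) by blast
        then have "role e (0, Suc t, j, i) = producer (ct (Suc t) j i)"
          using d' t wi ne runD(3)[OF r j] i i0 step(2)[OF _ j i0(1)] False by (simp add: valid_def)
        with e show ?thesis by blast
      qed
      ultimately show ?case using c by blast
    qed
    show ?thesis
      unfolding accepting_def
    proof (intro allI impI)
      fix i assume i: "win T i" and k1: "1 < k" and a: "S \<le> ct T 1 i"
      have "(0, T, 1, i) \<in> slots" using i k1 win_le by (simp add: slots_def)
      moreover obtain e where "e \<in> I" "role e (0, T, 1, i) = producer (ct T 1 i)" using main[of T] i k1 by blast
      ultimately obtain e' where "role e' (0, T, 1, i) = consumer (ct T 1 i)"
        using link ctB[OF k1] by blast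
      from role_final[OF this i] a show "ct T 1 i = S + 2" by simp
    qed
  qed
  with l bt2 show ?thesis by blast
qed

end

context tableau begin

text \<open>The cover is read off the run: each slot is met by one full hyperedge, or by one
  producer and one consumer of the run's value. Acceptance enters at the final cells only.\<close>

lemma cover_complete:
  assumes l: "l \<le> P" and bt: "\<And>r. bt r < 2" and r: "run l bt st ct" and acc: "accepting ct"
  shows "\<exists>I. slot_cover I"
proof -
  define cc where "cc t = (SOME c. c < nc \<and> cq c = st t \<and> (\<forall>j<k. cs c j = ct t j (2 * T)))" for t
  have cc: "cc t < nc \<and> cq (cc t) = st t \<and> (\<forall>j<k. cs (cc t) j = ct t j (2 * T))" if "t < T" for t
    using runD(5)[OF r that] unfolding cc_def by (rule someI2_ex)
  have cd: "cd (cc t) j < 3" if "t < T" "j < k" for t j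
    using ctl(5)[of "cc t" j] cc[OF that(1)] that(2) by simp
  have step: "st (Suc t) = cq' (cc t)"
    "j < k \<Longrightarrow> 0 < i \<Longrightarrow> ct (Suc t) j i =
      (if i + cd (cc t) j = 2 * T + 1 then cw (cc t) j else ct t j (i + cd (cc t) j - 1))" if "t < T" for t j i
    using runD(6,7)[OF r that, of "cc t"] cc[OF that] by simp_all
  note ct = runD(3)[OF r]
  define chosen where "chosen ek et ej ei ea ed \<longleftrightarrow>
      ek = 0 \<and> et = 0 \<and> ej = 0 \<and> ei = l \<and> ea = 0 \<and> ed = 0 \<or>
      ek = 1 \<and> et = 0 \<and> ej = 0 \<and> ei < l \<and> ea = bt ei \<and> ed = 0 \<or>
      ek = 2 \<and> et < T \<and> ej < k \<and> win et ei \<and> ei \<noteq> 2 * T \<and> ea = ct et ej ei \<and> ed = cd (cc et) ej \<or>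
      ek = 3 \<and> et < T \<and> ej = 0 \<and> ei = 0 \<and> ea = cc et \<and> ed = 0 \<or>
      ek = 4 \<and> et = 0 \<and> ej < k \<and> win T ei \<and> ea = ct T ej ei \<and> ed = 0 \<or>
      ek = 5 \<and> et = 0 \<and> ej = 0 \<and> ei = 0 \<and> ea = st T \<and> ed = 0" for ek et ej ei ea ed :: nat
  define I where "I = {(ek, et, ej, ei, ea, ed). chosen ek et ej ei ea ed}"
  have I0: "(0, 0, 0, l, 0, 0) \<in> I" by (simp add: I_def chosen_def)
  have I1: "(1, 0, 0, q, bt q, 0) \<in> I" if "q < l" for q using that by (simp add: I_def chosen_def)
  have I2: "(2, t, j, i, ct t j i, cd (cc t) j) \<in> I" if "t < T" "j < k" "win t i" "i \<noteq> 2 * T" for t j i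
    using that by (simp add: I_def chosen_def)
  have I3: "(3, t, 0, 0, cc t, 0) \<in> I" if "t < T" for t using that by (simp add: I_def chosen_def)
  have I4: "(4, 0, j, i, ct T j i, 0) \<in> I" if "j < k" "win T i" for j i
    using that by (simp add: I_def chosen_def)
  have I5: "(5, 0, 0, 0, st T, 0) \<in> I" by (simp add: I_def chosen_def)
  have iw: "i < 4 * T + 1" if "win t i" for t i using that by (simp add: win_def)
  have sub: "I \<subseteq> edges"
  proof
    fix e assume e: "e \<in> I"
    obtain ek et ej ei ea ed where [simp]: "e = (ek, et, ej, ei, ea, ed)" by (cases e) auto
    have "bt ei < B" "ct et ej ei < B" if "ej < k" using bt[of ei] ct[OF that, of et ei] S by auto
    moreover have "ct T ej ei < B" if "ej < k" using ct[OF that, of T ei] S by auto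
    moreover have "cc et < B" if "et < T" using cc[OF that] S by auto
    moreover have "st T < B" by (rule runD(2)[OF r])
    ultimately show "e \<in> edges"
      using e k T l P S cd[of et ej] iw[of et ei] iw[of T ei] by (auto simp: I_def chosen_def edges_def)
  qed
  have final: "role (4, 0, j, i, ct T j i, 0) (0, T, j, i) = consumer (ct T j i)" if "j < k" "win T i" for j i
    using acc that ct[OF that(1), of T i] by (auto simp: accepting_def valid_def)
  have "\<exists>!e. e \<in> I \<and> covers (role e s) a" if s: "s \<in> slots" for s a
  proof -
    obtain \<kappa> t j i where seq: "s = (\<kappa>, t, j, i)" by (cases s) auto
    have t: "t \<le> T" and j: "j < k" using s seq by (auto simp: slots_def)
    consider "\<not> valid \<kappa> t j i" | "\<kappa> = 3" "t = 0" "j = 0" "i < P" | "\<kappa> = 1" "j = 0" "i = 0"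
      | "\<kappa> = 2" "t < T" "win t i" "i \<noteq> 2 * T" | "\<kappa> = 0" "win t i"
      by (auto simp: valid_def)
    then show ?thesis
    proof cases
      case 1
      show ?thesis
      proof (rule slot_full[where R = "\<lambda>e. role e s", OF I0])
        show "role (0, 0, 0, l, 0, 0) s = 1" using l 1 by (simp add: seq)
      next
        fix e assume "e \<in> I" "role e s \<noteq> 0"
        with role_invalid[OF 1, of e] show "e = (0, 0, 0, l, 0, 0)"
          by (auto simp: seq I_def chosen_def)
      qed
    next
      case 2
      define e1 :: "nat \<times> nat \<times> nat \<times> nat \<times> nat \<times> nat" where "e1 = (if l \<le> i then (0, 0, 0, l, 0, 0) else (1, 0, 0, i, bt i, 0))"
      show ?thesis
      proof (rule slot_full[where R = "\<lambda>e. role e s" and e = e1])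
        show "e1 \<in> I" using I0 I1 by (simp add: e1_def)
        show "role e1 s = 1" using l 2 bt[of i] by (auto simp: seq e1_def valid_def)
      next
        fix e assume e: "e \<in> I" "role e s \<noteq> 0"
        from role_bit[of e i] e(2) 2 have "(\<exists>l\<le>i. e = (0, 0, 0, l, 0, 0)) \<or> (\<exists>b<2. e = (1, 0, 0, i, b, 0))"
          by (simp add: seq)
        with e(1) show "e = e1" by (auto simp: I_def chosen_def e1_def)
      qed
    next
      case 3
      define e1 :: "nat \<times> nat \<times> nat \<times> nat \<times> nat \<times> nat" where "e1 = (if t = 0 then (0, 0, 0, l, 0, 0) else (3, t - 1, 0, 0, cc (t - 1), 0))"
      define e2 :: "nat \<times> nat \<times> nat \<times> nat \<times> nat \<times> nat" where "e2 = (if t < T then (3, t, 0, 0, cc t, 0) else (5, 0, 0, 0, st T, 0))"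
      show ?thesis
      proof (rule slot_produced[where R = "\<lambda>e. role e s" and e = e1 and b = "st t" and e' = e2])
        show "e1 \<in> I" using I0 I3[of "t - 1"] t by (auto simp: e1_def)
        show "e2 \<in> I" using I3 I5 by (simp add: e2_def)
        show "role e1 s = producer (st t)"
        proof (cases t)
          case 0
          then show ?thesis using l 3 runD(1)[OF r] by (simp add: seq e1_def valid_def)
        next
          case (Suc t')
          then show ?thesis using 3 t cc[of t'] step(1)[of t'] by (simp add: seq e1_def valid_def)
        qed
        show "role e2 s = consumer (st t)"
          using 3 t cc[of t] by (auto simp: seq e2_def valid_def)
      next
        fix e assume e: "e \<in> I" "role e s \<noteq> 0"
        then show "e = e1 \<or> e = e2" using 3 t
          by (cases e) (auto simp: seq e1_def e2_def I_def chosen_def valid_def split: if_splits)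
      qed
    next
      case 4
      show ?thesis
      proof (rule slot_produced[where R = "\<lambda>e. role e s", OF I3[OF 4(2)] _ I2[OF 4(2) j 4(3,4)]])
        show "role (3, t, 0, 0, cc t, 0) s = producer (cd (cc t) j)"
          using 4 cc[of t] by (simp add: seq valid_def)
        show "role (2, t, j, i, ct t j i, cd (cc t) j) s = consumer (cd (cc t) j)"
          using 4 ct[OF j] cd[OF 4(2) j] by (simp add: seq valid_def)
      next
        fix e assume e: "e \<in> I" "role e s \<noteq> 0"
        then show "e = (3, t, 0, 0, cc t, 0) \<or> e = (2, t, j, i, ct t j i, cd (cc t) j)" using 4 t
          by (cases e) (auto simp: seq I_def chosen_def valid_def split: if_splits)
      qed
    next
      case 5
      define d where "d = cd (cc (t - 1)) j"
      \<comment> \<open>The producer of the cell: at time \<open>0\<close> the start or an unknown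
        bit, later the transition that wrote it or the shift that moved it.\<close>
      define e1 :: "nat \<times> nat \<times> nat \<times> nat \<times> nat \<times> nat" where "e1 = (if t = 0 then if j = 0 \<and> Y \<le> i \<and> i < Y + l then (1, 0, 0, i - Y, bt (i - Y), 0)
          else (0, 0, 0, l, 0, 0)
        else if i + d = 2 * T + 1 then (3, t - 1, 0, 0, cc (t - 1), 0)
        else (2, t - 1, j, i + d - 1, ct (t - 1) j (i + d - 1), d))"
      define e2 :: "nat \<times> nat \<times> nat \<times> nat \<times> nat \<times> nat" where "e2 = (if t = T then (4, 0, j, i, ct T j i, 0)
        else if i = 2 * T then (3, t, 0, 0, cc t, 0) else (2, t, j, i, ct t j i, cd (cc t) j))"
      have e1: "e1 \<in> I \<and> role e1 s = producer (ct t j i)"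
      proof (cases t)
        case 0
        show ?thesis
        proof (cases "j = 0 \<and> Y \<le> i \<and> i < Y + l")
          case True
          then have c: "ct 0 j i = bt (i - Y) + 1" using runD(4)[OF r j, of i] by simp
          have "e1 = (1, 0, 0, i - Y, bt (i - Y), 0)" using True 0 by (simp add: e1_def)
          moreover have y: "i - Y < l" "i - Y < P" "Y + (i - Y) = i" using True l by auto
          ultimately show ?thesis
            using I1[OF y(1)] bt[of "i - Y"] 0 True 5 c by (simp add: seq valid_def)
        next
          case False
          then have c: "ct 0 j i = ini j i" using runD(4)[OF r j, of i] by (simp only: if_False)
          have e: "e1 = (0, 0, 0, l, 0, 0)" using False 0 by (simp add: e1_def)
          show ?thesis
            using I0 l 0 False 5 c unfolding e by (auto simp: seq valid_def)
        qed
      next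
        case (Suc t')
        then have t': "t' < T" using t by simp
        have d: "d < 3" using cd[OF t' j] Suc by (simp add: d_def)
        have i: "0 < i" using 5(2) Suc by (simp add: win_def)
        have c: "ct t j i = (if i + d = 2 * T + 1 then cw (cc t') j else ct t' j (i + d - 1))"
          using step(2)[OF t' j i] Suc by (simp add: d_def)
        show ?thesis
        proof (cases "i + d = 2 * T + 1")
          case True
          then have "e1 = (3, t', 0, 0, cc t', 0)" using Suc by (simp add: e1_def)
          then show ?thesis using I3[OF t'] cc[OF t'] t' 5 Suc True c by (simp add: seq valid_def d_def)
        next
          case False
          let ?i = "i + d - 1"
          have i': "win t' ?i" "?i \<noteq> 2 * T" "i + d = ?i + 1" using 5(2) Suc d False i by (auto simp: win_def)
          have e: "e1 = (2, t', j, ?i, ct t' j ?i, d)" using Suc False by (simp add: e1_def)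
          have "d = cd (cc t') j" using Suc by (simp add: d_def)
          with e have "e1 \<in> I" using I2[OF t' j i'(1,2)] by simp
          moreover have "role e1 s = producer (ct t' j ?i)"
            unfolding e using ct[OF j, of t' ?i] d t' 5 Suc i' by (simp add: seq valid_def)
          ultimately show ?thesis using c False by simp
        qed
      qed
      have e2: "e2 \<in> I \<and> role e2 s = consumer (ct t j i)"
      proof (cases "t = T")
        case True
        then show ?thesis using I4[OF j] final[OF j] 5 by (simp add: seq e2_def del: role_eq)
      next
        case False
        then have t': "t < T" using t by simp
        show ?thesis
        proof (cases "i = 2 * T")
          case True
          then show ?thesis using I3[OF t'] cc[OF t'] t' 5 j by (simp add: seq e2_def valid_def)
        next
          case False
          then show ?thesis using I2[OF t' j 5(2)] t' 5 ct[OF j, of t i] cd[OF t' j]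
            by (simp add: seq e2_def valid_def)
        qed
      qed
      show ?thesis
      proof (rule slot_produced[where R = "\<lambda>e. role e s" and e = e1 and b = "ct t j i" and e' = e2])
        fix e assume e: "e \<in> I" "role e s \<noteq> 0"
        obtain ek et ej ei ea ed where ee: "e = (ek, et, ej, ei, ea, ed)" by (cases e) auto
        have v: "valid 0 t j i" using 5 by (simp add: valid_def)
        from e(1) consider "e = (0, 0, 0, l, 0, 0)" | "ei < l" "e = (1, 0, 0, ei, bt ei, 0)"
          | "et < T" "ej < k" "win et ei" "ei \<noteq> 2 * T" "e = (2, et, ej, ei, ct et ej ei, cd (cc et) ej)"
          | "et < T" "e = (3, et, 0, 0, cc et, 0)" | "e = (4, 0, ej, ei, ct T ej ei, 0)" | "e = (5, 0, 0, 0, st T, 0)"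
          unfolding ee I_def chosen_def by auto
        then show "e = e1 \<or> e = e2"
        proof cases
          case 1
          with e(2) l 5 have "t = 0 \<and> \<not> (j = 0 \<and> Y \<le> i \<and> i < Y + l)"
            by (simp add: seq v split: if_splits)
          with 1 show ?thesis by (auto simp: e1_def)
        next
          case 2
          with e(2) 5 have "t = 0 \<and> j = 0 \<and> i = Y + ei"
            by (simp add: seq v split: if_splits)
          with 2 show ?thesis by (auto simp: e1_def)
        next
          case 3
          with e(2) 5 have "t = Suc et \<and> j = ej \<and> i + cd (cc et) ej = ei + 1 \<or> t = et \<and> j = ej \<and> i = ei"
            by (simp add: seq v split: if_splits)
          then show ?thesis
          proof
            assume a: "t = Suc et \<and> j = ej \<and> i + cd (cc et) ej = ei + 1"
            then have "d = cd (cc et) ej" by (simp add: d_def)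
            with a 3(4) have "i + d - 1 = ei" "i + d \<noteq> 2 * T + 1" "t \<noteq> 0" "t - 1 = et" by simp_all
            then have "e1 = (2, et, j, ei, ct et j ei, d)" by (simp add: e1_def)
            with a 3(5) \<open>d = cd (cc et) ej\<close> show ?thesis by simp
          next
            assume a: "t = et \<and> j = ej \<and> i = ei"
            with 3 have "e2 = (2, et, ej, ei, ct et ej ei, cd (cc et) ej)" by (simp add: e2_def)
            with 3(5) show ?thesis by simp
          qed
        next
          case 4
          with e(2) 5 have "t = Suc et \<and> i + cd (cc et) j = 2 * T + 1 \<or> t = et \<and> i = 2 * T"
            by (simp add: seq v split: if_splits)
          then show ?thesis
          proof
            assume a: "t = Suc et \<and> i + cd (cc et) j = 2 * T + 1"
            then have "e1 = (3, et, 0, 0, cc et, 0)" by (simp add: e1_def d_def)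
            with 4 show ?thesis by simp
          next
            assume a: "t = et \<and> i = 2 * T"
            with 4(1) have "e2 = (3, et, 0, 0, cc et, 0)" by (simp add: e2_def)
            with 4 show ?thesis by simp
          qed
        next
          case c5: 5
          with e(2) 5 have "t = T \<and> j = ej \<and> i = ei"
            by (simp add: seq v split: if_splits)
          with c5 show ?thesis by (simp add: e2_def)
        next
          case 6
          with e(2) 5 show ?thesis by (simp add: seq v)
        qed
      qed (use e1 e2 in simp_all)
    qed
  qed
  then have "\<forall>s\<in>slots. \<forall>a<B. \<exists>!e. e \<in> I \<and> covers (role e s) a" by (intro ballI allI impI)
  with sub have "slot_cover I" unfolding slot_cover_def by (rule conjI)
  then show ?thesis ..
qed

end

lemma ex1_conjE:
  assumes "\<exists>!x. Q x \<and> R x"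
  obtains x where "Q x" "R x" "\<And>y. Q y \<Longrightarrow> R y \<Longrightarrow> y = x"
  using assms by blast

section \<open>Numbering of vertices and hyperedges\<close>

context tableau begin

text \<open>Mixed-radix digits of \<open>i\<close>: \<open>div\<close> and \<open>mod\<close> alone
  recover the components, which keeps the incidence matrix definable.\<close>

definition edge_of :: "nat \<Rightarrow> nat \<times> nat \<times> nat \<times> nat \<times> nat \<times> nat" where
  "edge_of i = (let W = 4 * T + 1 in (i div 3 div B div W div k div (T + 1), i div 3 div B div W div k mod (T + 1),
     i div 3 div B div W mod k, i div 3 div B mod W, i div 3 mod B, i mod 3))"

definition slot_of :: "nat \<Rightarrow> nat \<times> nat \<times> nat \<times> nat" where
  "slot_of v = (let W = 4 * T + 1 in (v div B div W div k div (T + 1), v div B div W div k mod (T + 1),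
     v div B div W mod k, v div B mod W))"

definition edge_number :: nat where "edge_number = 6 * (T + 1) * k * (4 * T + 1) * B * 3"

definition vertex_number :: nat where "vertex_number = 4 * (T + 1) * k * (4 * T + 1) * B"

definition incident :: "nat \<Rightarrow> nat \<Rightarrow> bool" where
  "incident i v \<longleftrightarrow> covers (role (edge_of i) (slot_of v)) (v mod B)"

lemma pair_less: "x < a \<Longrightarrow> r < b \<Longrightarrow> x * b + r < a * (b :: nat)"
  using mult_le_mono1[of "Suc x" a b] by simp

lemma B_pos: "0 < B" using S by simp

lemma div_mod_pair: "r < b \<Longrightarrow> (x * b + r) div b = (x :: nat)" "r < b \<Longrightarrow> (x * b + r) mod b = r"
  by simp_all

lemma bij_edge_of: "bij_betw edge_of {..<edge_number} edges"
proof (rule bij_betw_byWitness)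
  let ?enc = "\<lambda>(ek, et, ej, ei, ea, ed). ((((ek * (T + 1) + et) * k + ej) * (4 * T + 1) + ei) * B + ea) * 3 + ed"
  show "\<forall>i\<in>{..<edge_number}. ?enc (edge_of i) = i"
    by (simp only: edge_of_def Let_def prod.case div_mult_mod_eq) simp
  show "edge_of ` {..<edge_number} \<subseteq> edges"
    using T k B_pos by (auto simp: edge_of_def Let_def edges_def edge_number_def intro!: less_mult_imp_div_less)
  have enc: "?enc e < edge_number \<and> edge_of (?enc e) = e" if eE: "e \<in> edges" for e
  proof -
    obtain ek et ej ei ea ed where e: "e = (ek, et, ej, ei, ea, ed)" by (cases e) auto
    have b: "ek < 6" "et < T + 1" "ej < k" "ei < 4 * T + 1" "ea < B" "ed < 3"
      using eE by (simp_all add: e edges_def)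
    have "?enc e < edge_number"
      unfolding e prod.case edge_number_def by (intro pair_less b)
    moreover have "edge_of (?enc e) = e"
      unfolding e prod.case by (simp only: edge_of_def Let_def div_mod_pair b)
    ultimately show ?thesis by (rule conjI)
  qed
  show "\<forall>e\<in>edges. edge_of (?enc e) = e" by (rule ballI) (rule enc[THEN conjunct2])
  show "?enc ` edges \<subseteq> {..<edge_number}" by (rule image_subsetI) (unfold lessThan_iff, rule enc[THEN conjunct1])
qed

lemma slot_of_mem: "v < vertex_number \<Longrightarrow> slot_of v \<in> slots \<and> v mod B < B"
  using T k B_pos by (auto simp: slot_of_def Let_def slots_def vertex_number_def intro!: less_mult_imp_div_less)

lemma slot_of_surj:
  assumes "s \<in> slots" "a < B"
  shows "\<exists>v<vertex_number. slot_of v = s \<and> v mod B = a"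
proof -
  obtain \<kappa> t j i where s: "s = (\<kappa>, t, j, i)" by (cases s) auto
  have b: "\<kappa> < 4" "t < T + 1" "j < k" "i < 4 * T + 1" "a < B"
    using assms by (simp_all add: s slots_def)
  let ?v = "(((\<kappa> * (T + 1) + t) * k + j) * (4 * T + 1) + i) * B + a"
  have "?v < vertex_number" unfolding vertex_number_def by (intro pair_less b)
  moreover have "slot_of ?v = s" "?v mod B = a"
    unfolding s by (simp_all only: slot_of_def Let_def div_mod_pair b)
  ultimately show ?thesis by blast
qed

lemma has_exact_cover_iff_slot_cover:
  "has_exact_cover (matrix_hypergraph vertex_number edge_number incident) \<longleftrightarrow> (\<exists>I. slot_cover I)"
  unfolding has_exact_cover_matrix
proof
  assume "\<exists>I\<subseteq>{..<edge_number}. \<forall>v<vertex_number. \<exists>!i. i \<in> I \<and> incident i v"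
  then obtain I where I: "I \<subseteq> {..<edge_number}" "\<And>v. v < vertex_number \<Longrightarrow> \<exists>!i. i \<in> I \<and> incident i v"
    by metis
  have "\<exists>!e. e \<in> edge_of ` I \<and> covers (role e s) a" if sa: "s \<in> slots" "a < B" for s a
  proof -
    obtain v where v: "v < vertex_number" "slot_of v = s" "v mod B = a" using slot_of_surj[OF sa] by metis
    from I(2)[OF v(1)] obtain i where i: "i \<in> I" "incident i v" "\<And>j. j \<in> I \<Longrightarrow> incident j v \<Longrightarrow> j = i"
      by (rule ex1_conjE) iprover
    show ?thesis
    proof (rule ex1I[of _ "edge_of i"])
      show "edge_of i \<in> edge_of ` I \<and> covers (role (edge_of i) s) a"
        using i(1,2) v by (simp add: incident_def)
    next
      fix e assume "e \<in> edge_of ` I \<and> covers (role e s) a"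
      then obtain j where "j \<in> I" "e = edge_of j" "covers (role (edge_of j) s) a" by auto
      with i(3)[of j] v show "e = edge_of i" by (simp add: incident_def)
    qed
  qed
  moreover have "edge_of ` I \<subseteq> edges" using I(1) bij_betw_imp_surj_on[OF bij_edge_of] by auto
  ultimately have "slot_cover (edge_of ` I)" unfolding slot_cover_def by (intro conjI ballI allI impI)
  then show "\<exists>I. slot_cover I" ..
next
  assume "\<exists>I. slot_cover I"
  then obtain I where I: "slot_cover I" ..
  define J where "J = {i. i < edge_number \<and> edge_of i \<in> I}"
  have "\<exists>!i. i \<in> J \<and> incident i v" if v: "v < vertex_number" for v
  proof -
    let ?s = "slot_of v" and ?a = "v mod B"
    have "\<exists>!e. e \<in> I \<and> covers (role e ?s) ?a" using I slot_of_mem[OF v] by (simp add: slot_cover_def)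
    then obtain e where e: "e \<in> I" "covers (role e ?s) ?a" "\<And>e'. e' \<in> I \<Longrightarrow> covers (role e' ?s) ?a \<Longrightarrow> e' = e"
      by (rule ex1_conjE) iprover
    have "e \<in> edge_of ` {..<edge_number}"
      using e(1) I bij_betw_imp_surj_on[OF bij_edge_of] by (auto simp: slot_cover_def)
    then obtain i where i: "i < edge_number" "e = edge_of i" by auto
    show ?thesis
    proof (rule ex1I[of _ i])
      show "i \<in> J \<and> incident i v" using e(1,2) i by (simp add: J_def incident_def)
    next
      fix j assume "j \<in> J \<and> incident j v"
      then have j: "j < edge_number" "edge_of j = edge_of i"
        using e(3)[of "edge_of j"] i(2) by (auto simp: J_def incident_def)
      with i(1) bij_betw_imp_inj_on[OF bij_edge_of] show "j = i" by (auto dest: inj_onD)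
    qed
  qed
  moreover have "J \<subseteq> {..<edge_number}" by (auto simp: J_def)
  ultimately show "\<exists>I\<subseteq>{..<edge_number}. \<forall>v<vertex_number. \<exists>!i. i \<in> I \<and> incident i v" by (intro exI[of _ J]) simp
qed

end

section \<open>Runs of Turing machines\<close>

definition run_config :: "turing_machine \<Rightarrow> bool list \<Rightarrow> nat \<Rightarrow> config" where
  "run_config M w t = (tm_step M ^^ t) (tm_start M w)"

definition good_config :: "turing_machine \<Rightarrow> nat \<Rightarrow> config \<Rightarrow> bool" where
  "good_config M t C \<longleftrightarrow> fst C \<le> state_count M \<and> length (snd C) = tape_count M \<and>
     (\<forall>j<tape_count M. (\<forall>z. fst (snd C ! j) z < symbol_count M) \<and> \<bar>snd (snd C ! j)\<bar> \<le> int t)"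

lemma transition_bounds:
  assumes "is_turing_machine M" "q < state_count M" "length ss = tape_count M" "set ss \<subseteq> {..<symbol_count M}"
    "transition M q ss = (q', as)"
  shows "q' \<le> state_count M" "length as = tape_count M" "fst ` set as \<subseteq> {..<symbol_count M}"
proof -
  have "case transition M q ss of (q', as) \<Rightarrow>
      q' \<le> state_count M \<and> length as = tape_count M \<and> fst ` set as \<subseteq> {..<symbol_count M}"
    using assms(1-4) by (simp add: is_turing_machine_def)
  then show "q' \<le> state_count M" "length as = tape_count M" "fst ` set as \<subseteq> {..<symbol_count M}"
    unfolding assms(5) by simp_all
qed

lemma tm_step_tape:
  assumes "fst C \<noteq> state_count M" "transition M (fst C) (map read_tape (snd C)) = (q', as)"
    "length as = tape_count M" "length (snd C) = tape_count M" "j < tape_count M"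
  shows "fst (tm_step M C) = q'" "snd (tm_step M C) ! j = act_tape (as ! j) (snd C ! j)"
    "length (snd (tm_step M C)) = tape_count M"
  using assms by (cases C; simp)+

lemma act_tape_eq:
  "act_tape a c = ((fst c)(snd c := fst a), snd c + shift (snd a))"
  by (cases a; cases c) simp

lemma good_config_step:
  assumes M: "is_turing_machine M" and C: "good_config M t C"
  shows "good_config M (Suc t) (tm_step M C)"
proof (cases "fst C = state_count M")
  case True
  then have "tm_step M C = C" by (cases C) simp
  with C show ?thesis by (fastforce simp: good_config_def)
next
  case False
  let ?ss = "map read_tape (snd C)"
  obtain q' as where tr: "transition M (fst C) ?ss = (q', as)" by (cases "transition M (fst C) ?ss")
  have len: "length (snd C) = tape_count M" using C by (simp add: good_config_def)
  have rd: "read_tape (snd C ! j) < symbol_count M" if "j < tape_count M" for j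
    using C that by (cases "snd C ! j") (simp add: good_config_def, metis fst_conv)
  have "\<forall>s\<in>set ?ss. s < symbol_count M"
    unfolding all_set_conv_all_nth using rd len by simp
  then have ss: "set ?ss \<subseteq> {..<symbol_count M}" "length ?ss = tape_count M" using len by auto
  have "fst C < state_count M" using C False by (simp add: good_config_def)
  note tr' = transition_bounds[OF M this ss(2,1) tr]
  have "(\<forall>z. fst (snd (tm_step M C) ! j) z < symbol_count M) \<and> \<bar>snd (snd (tm_step M C) ! j)\<bar> \<le> int (Suc t)"
    if j: "j < tape_count M" for j
  proof -
    have "fst (as ! j) < symbol_count M" using tr'(2,3) j by (auto simp: image_subset_iff)
    moreover have "\<bar>shift (snd (as ! j))\<bar> \<le> 1" by (cases "snd (as ! j)") auto
    moreover have "\<bar>snd (snd C ! j)\<bar> \<le> int t" "\<And>z. fst (snd C ! j) z < symbol_count M"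
      using C j by (simp_all add: good_config_def)
    ultimately show ?thesis
      unfolding tm_step_tape(2)[OF False tr tr'(2) len j] act_tape_eq by auto
  qed
  moreover have "0 < tape_count M" using M by (simp add: is_turing_machine_def)
  ultimately show ?thesis
    using tm_step_tape(1,3)[OF False tr tr'(2) len] tr'(1) by (auto simp: good_config_def)
qed

lemma good_config_run:
  assumes "is_turing_machine M"
  shows "good_config M t (run_config M w t)"
proof (induction t)
  case 0
  have "2 \<le> tape_count M" "3 \<le> symbol_count M" using assms by (auto simp: is_turing_machine_def)
  then show ?case
    by (auto simp: run_config_def good_config_def tm_start_def nth_Cons word_tape_def bit_symbol_def split: nat.split)
next
  case (Suc t)
  then show ?case using good_config_step[OF assms] by (simp add: run_config_def)
qed

lemma run_config_halted:
  assumes "fst (run_config M w s) = state_count M" "s \<le> t"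
  shows "run_config M w t = run_config M w s"
  using assms(2)
proof (induction t rule: dec_induct)
  case (step t)
  then have "run_config M w (Suc t) = tm_step M (run_config M w s)" by (simp add: run_config_def)
  also have "\<dots> = run_config M w s" using assms(1) by (cases "run_config M w s") simp
  finally show ?case .
qed simp

text \<open>Transitions are indexed by a state and the scanned colours, hence the doubled alphabet.
  Any enumeration serves, as it depends on \<open>M\<close> and not on the input.\<close>

definition controls :: "turing_machine \<Rightarrow> (nat \<times> nat list) list" where
  "controls M = (SOME L. set L = {..state_count M} \<times>
     {ss. set ss \<subseteq> {..<2 * symbol_count M} \<and> length ss = tape_count M})"

lemma set_controls:
  "set (controls M) = {..state_count M} \<times> {ss. set ss \<subseteq> {..<2 * symbol_count M} \<and> length ss = tape_count M}"
proof -
  have "finite ({..state_count M} \<times> {ss. set ss \<subseteq> {..<2 * symbol_count M} \<and> length ss = tape_count M})"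
    by (intro finite_cartesian_product finite_lists_length_eq) auto
  then have "\<exists>L. set L = {..state_count M} \<times> {ss. set ss \<subseteq> {..<2 * symbol_count M} \<and> length ss = tape_count M}"
    by (rule finite_list)
  then show ?thesis unfolding controls_def by (rule someI_ex)
qed

text \<open>Like \<open>tm_step\<close>, the halting state idles, so that every run continues up to
  the horizon. \<open>mod\<close> reduces colours to symbols.\<close>

definition control_action :: "turing_machine \<Rightarrow> nat \<Rightarrow> nat \<times> (nat \<times> direction) list" where
  "control_action M c = (case controls M ! c of (q, ss) \<Rightarrow>
     let rs = map (\<lambda>a. a mod symbol_count M) ss in
     if q = state_count M then (q, map (\<lambda>s. (s, Stay)) rs) else transition M q rs)"

text \<open>The default \<open>0\<close> outside of the ranges makes this a finite lookup and hence
  definable for arbitrary \<open>f\<close>.\<close>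

definition guarded :: "turing_machine \<Rightarrow> (nat \<Rightarrow> nat \<Rightarrow> nat) \<Rightarrow> nat \<Rightarrow> nat \<Rightarrow> nat" where
  "guarded M f c j = (if c < length (controls M) then if j < tape_count M then f c j else 0 else 0)"

definition scan_state :: "turing_machine \<Rightarrow> nat \<Rightarrow> nat" where
  "scan_state M c = (if c < length (controls M) then fst (controls M ! c) else 0)"

definition next_state :: "turing_machine \<Rightarrow> nat \<Rightarrow> nat" where
  "next_state M c = (if c < length (controls M) then fst (control_action M c) else 0)"

definition scan_colour :: "turing_machine \<Rightarrow> nat \<Rightarrow> nat \<Rightarrow> nat" where
  "scan_colour M = guarded M (\<lambda>c j. snd (controls M ! c) ! j)"

text \<open>The quotient of the scanned colour by the alphabet size is the mark of absolute cell
  \<open>0\<close>; it stays with the cell when the symbol changes.\<close>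

definition write_colour :: "turing_machine \<Rightarrow> nat \<Rightarrow> nat \<Rightarrow> nat" where
  "write_colour M = guarded M (\<lambda>c j. fst (snd (control_action M c) ! j) +
     symbol_count M * (snd (controls M ! c) ! j div symbol_count M))"

definition head_move :: "turing_machine \<Rightarrow> nat \<Rightarrow> nat \<Rightarrow> nat" where
  "head_move M = guarded M (\<lambda>c j. nat (shift (snd (snd (control_action M c) ! j)) + 1))"

definition colour_bound :: "turing_machine \<Rightarrow> nat" where
  "colour_bound M = 2 * symbol_count M + length (controls M) + state_count M + 3"

text \<open>\<open>p\<close> is the absolute position of the cell, position \<open>2 * T\<close>
  being under the head.\<close>

definition cell_colour :: "turing_machine \<Rightarrow> nat \<Rightarrow> config \<Rightarrow> nat \<Rightarrow> nat \<Rightarrow> nat" where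
  "cell_colour M T C j i = (let p = snd (snd C ! j) + int i - 2 * int T in
     fst (snd C ! j) p + (if p = 0 then symbol_count M else 0))"

lemma control_step:
  assumes M: "is_turing_machine M" and C: "good_config M t C" and c: "c < length (controls M)"
    "fst (controls M ! c) = fst C" "map (\<lambda>a. a mod symbol_count M) (snd (controls M ! c)) = map read_tape (snd C)"
  shows "fst (tm_step M C) = fst (control_action M c)"
    "j < tape_count M \<Longrightarrow> snd (tm_step M C) ! j = act_tape (snd (control_action M c) ! j) (snd C ! j)"
proof -
  have len: "length (snd C) = tape_count M" using C by (simp add: good_config_def)
  obtain q ss where qs: "controls M ! c = (q, ss)" by (cases "controls M ! c")
  show "fst (tm_step M C) = fst (control_action M c)"
    "j < tape_count M \<Longrightarrow> snd (tm_step M C) ! j = act_tape (snd (control_action M c) ! j) (snd C ! j)"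
  proof (atomize(full), cases "fst C = state_count M")
    case True
    then have s: "tm_step M C = C" by (cases C) simp
    have a: "control_action M c = (fst C, map (\<lambda>s. (s, Stay)) (map read_tape (snd C)))"
      using True c qs by (simp add: control_action_def Let_def del: map_map)
    show "fst (tm_step M C) = fst (control_action M c) \<and>
      (j < tape_count M \<longrightarrow> snd (tm_step M C) ! j = act_tape (snd (control_action M c) ! j) (snd C ! j))"
      unfolding s a using len by (cases "snd C ! j") simp
  next
    case False
    obtain q' as where tr: "transition M (fst C) (map read_tape (snd C)) = (q', as)"
      by (cases "transition M (fst C) (map read_tape (snd C))")
    have a: "control_action M c = (q', as)"
      using False c qs tr by (simp add: control_action_def Let_def)
    have "fst (tm_step M C) = q'" using False tr by (cases C) simp
    moreover have "length as = tape_count M"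
    proof -
      have "0 < symbol_count M" using M by (simp add: is_turing_machine_def)
      then have "set (map (\<lambda>a. a mod symbol_count M) (snd (controls M ! c))) \<subseteq> {..<symbol_count M}" by auto
      then have ss: "set (map read_tape (snd C)) \<subseteq> {..<symbol_count M}" "length (map read_tape (snd C)) = tape_count M"
        using c(3) len by simp_all
      have "fst C < state_count M" using C False by (simp add: good_config_def)
      from transition_bounds(2)[OF M this ss(2,1) tr] show ?thesis .
    qed
    ultimately show "fst (tm_step M C) = fst (control_action M c) \<and>
      (j < tape_count M \<longrightarrow> snd (tm_step M C) ! j = act_tape (snd (control_action M c) ! j) (snd C ! j))"
      using tm_step_tape(2)[OF False tr _ len] by (simp add: a)
  qed
qed

lemma control_bounds:
  assumes M: "is_turing_machine M" and c: "c < length (controls M)" and j: "j < tape_count M"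
  shows "scan_state M c \<le> state_count M" "next_state M c \<le> state_count M"
    "scan_colour M c j < 2 * symbol_count M" "write_colour M c j < 2 * symbol_count M" "head_move M c j < 3"
proof -
  let ?S = "symbol_count M"
  obtain q ss where qs: "controls M ! c = (q, ss)" by (cases "controls M ! c")
  have "(q, ss) \<in> set (controls M)" using qs c by (metis nth_mem)
  then have q: "q \<le> state_count M" and ss: "set ss \<subseteq> {..<2 * ?S}" "length ss = tape_count M"
    unfolding set_controls by auto
  have S: "0 < ?S" using M by (simp add: is_turing_machine_def)
  let ?rs = "map (\<lambda>a. a mod ?S) ss"
  have rs: "length ?rs = tape_count M" "set ?rs \<subseteq> {..<?S}" using ss S by auto
  have act: "fst (control_action M c) \<le> state_count M \<and> fst (snd (control_action M c) ! j) < ?S"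
  proof (cases "q = state_count M")
    case True
    then show ?thesis using qs j ss S by (simp add: control_action_def Let_def)
  next
    case False
    then have q': "q < state_count M" using q by simp
    obtain p as where tr: "transition M q ?rs = (p, as)" by (cases "transition M q ?rs")
    then have "control_action M c = (p, as)" using False qs by (simp add: control_action_def Let_def)
    with transition_bounds[OF M q' rs tr] j show ?thesis by (auto simp: image_subset_iff)
  qed
  have a: "ss ! j < 2 * ?S" using ss j by (auto simp: subset_iff)
  then have "ss ! j div ?S < 2" using S by (simp add: less_mult_imp_div_less)
  then have "ss ! j div ?S = 0 \<or> ss ! j div ?S = 1" by auto
  with act have "fst (snd (control_action M c) ! j) + ?S * (ss ! j div ?S) < 2 * ?S" by auto
  then show "scan_state M c \<le> state_count M" "next_state M c \<le> state_count M"
    "scan_colour M c j < 2 * ?S" "write_colour M c j < 2 * ?S"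
    using q a act qs c j by (simp_all add: scan_state_def next_state_def scan_colour_def write_colour_def guarded_def)
  show "head_move M c j < 3"
    using c j by (cases "snd (snd (control_action M c) ! j)") (simp_all add: head_move_def guarded_def)
qed

lemma colour_decode:
  assumes "s < S" "a = s + (if b then S else 0)"
  shows "a mod S = s" "a div S = of_bool b" "a < 2 * (S :: nat)"
  using assms by auto

text \<open>\<open>M\<close> is meant as verifier of an arbitrary problem in NP, \<open>pM\<close>
  as its time bound and \<open>pp\<close> as the bound on certificates; these roles are assumed only
  in \<open>instance_word_correct\<close>.\<close>

locale reduction =
  fixes M :: turing_machine and pM pp :: "nat poly"
  assumes M: "is_turing_machine M"
begin

abbreviation "k \<equiv> tape_count M"
abbreviation "S \<equiv> symbol_count M"

definition free :: "bool list \<Rightarrow> nat" where "free x = poly pp (length x)"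

text \<open>The first summand bounds the running time on the longest pair word. The second is the
  length of that word, which therefore fits into the window to the right of the head; it also makes
  the horizon positive.\<close>

definition horizon :: "bool list \<Rightarrow> nat" where
  "horizon x = poly pM (2 * length x + 1 + free x) + (2 * length x + 1 + free x)"

definition first_free :: "bool list \<Rightarrow> nat" where
  "first_free x = 2 * horizon x + (2 * length x + 1)"

text \<open>The part of \<open>pair_word x y\<close> that does not depend on \<open>y\<close>:
  \<open>True\<close> at even positions, the bits of \<open>x\<close> at odd ones, and the separator
  \<open>False\<close>.\<close>

definition start_symbol :: "bool list \<Rightarrow> nat \<Rightarrow> nat" where
  "start_symbol x p = (if p < 2 * length x then if p mod 2 = 0 \<or> bit_at x (p div 2) then 2 else 1
     else if p = 2 * length x then 1 else 0)"

definition start_colour :: "bool list \<Rightarrow> nat \<Rightarrow> nat \<Rightarrow> nat" where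
  "start_colour x j i = (if j = 0 \<and> 2 * horizon x \<le> i then start_symbol x (i - 2 * horizon x) else 0) +
     (if i = 2 * horizon x then S else 0)"

lemma k2: "2 \<le> k" and S3: "3 \<le> S" using M by (auto simp: is_turing_machine_def)

lemma tableau: "tableau k S (horizon x) (first_free x) (free x) (length (controls M)) (colour_bound M)
    (start_colour x) (scan_state M) (next_state M) (scan_colour M) (write_colour M) (head_move M)"
proof
  show "start_colour x j i < 2 * S" for j i using S3 by (auto simp: start_colour_def start_symbol_def)
  have k0: "0 < k" using k2 by simp
  show "scan_state M c < colour_bound M" "next_state M c < colour_bound M" if "c < length (controls M)" for c
    using control_bounds(1,2)[OF M that k0] unfolding colour_bound_def by linarith+
qed (use k2 S3 control_bounds[OF M] in \<open>auto simp: horizon_def first_free_def colour_bound_def\<close>)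

text \<open>The transition index is determined up to repetition in the list by the state and the
  colours under the heads. A head moves by \<open>d - 1\<close>, so the cell now at position
  \<open>i\<close> is the one formerly at \<open>i + d - 1\<close>.\<close>

lemma run_config_run:
  fixes x y
  defines "C \<equiv> run_config M (pair_word x y)"
  assumes y: "length y \<le> free x" and bt: "\<And>r. r < length y \<Longrightarrow> bt r = of_bool (y ! r)"
  shows "tableau.run k S (horizon x) (first_free x) (length (controls M)) (colour_bound M)
    (start_colour x) (scan_state M) (next_state M) (scan_colour M) (write_colour M) (head_move M)
    (length y) bt (\<lambda>t. fst (C t)) (\<lambda>t. cell_colour M (horizon x) (C t))"
proof -
  let ?T = "horizon x" and ?ct = "\<lambda>t. cell_colour M (horizon x) (C t)"
  have good: "good_config M t (C t)" for t unfolding C_def by (rule good_config_run[OF M])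
  have sym: "fst (snd (C t) ! j) z < S" if "j < k" for t j z using good[of t] that by (simp add: good_config_def)
  have len: "length (snd (C t)) = k" for t using good[of t] by (simp add: good_config_def)
  have st: "fst (C t) \<le> state_count M" for t using good[of t] by (simp add: good_config_def)
  have dec: "?ct t j i mod S = fst (snd (C t) ! j) (snd (snd (C t) ! j) + int i - 2 * int ?T)"
    "?ct t j i div S = of_bool (snd (snd (C t) ! j) + int i - 2 * int ?T = 0)" "?ct t j i < 2 * S" if "j < k" for t j i
    using colour_decode[OF sym[OF that], of "?ct t j i"] by (simp_all add: cell_colour_def Let_def)
  have mid: "2 * int ?T = int (2 * ?T)" by simp
  have read: "?ct t j (2 * ?T) mod S = read_tape (snd (C t) ! j)" if "j < k" for t j
    using dec(1)[OF that, of t "2 * ?T"] by (cases "snd (C t) ! j") simp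
  have exc: "\<exists>c<length (controls M). scan_state M c = fst (C t) \<and> (\<forall>j<k. scan_colour M c j = ?ct t j (2 * ?T))" for t
  proof -
    have "(fst (C t), map (\<lambda>j. ?ct t j (2 * ?T)) [0..<k]) \<in> set (controls M)"
      unfolding set_controls using st[of t] dec(3) by auto
    then obtain c where "c < length (controls M)" "controls M ! c = (fst (C t), map (\<lambda>j. ?ct t j (2 * ?T)) [0..<k])"
      by (metis in_set_conv_nth)
    then show ?thesis by (intro exI[of _ c]) (simp add: scan_state_def scan_colour_def guarded_def)
  qed
  have step: "fst (C (Suc t)) = next_state M c \<and> (\<forall>j<k. \<forall>i>0. ?ct (Suc t) j i =
      (if i + head_move M c j = 2 * ?T + 1 then write_colour M c j else ?ct t j (i + head_move M c j - 1)))"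
    if c: "c < length (controls M)" "scan_state M c = fst (C t)" and cs: "\<And>j. j < k \<Longrightarrow> scan_colour M c j = ?ct t j (2 * ?T)" for t c
  proof -
    obtain q ss where qs: "controls M ! c = (q, ss)" by (cases "controls M ! c")
    have "(q, ss) \<in> set (controls M)" using qs c(1) by (metis nth_mem)
    then have lss: "length ss = k" unfolding set_controls by simp
    have ssj: "ss ! j = ?ct t j (2 * ?T)" if "j < k" for j
      using cs[OF that] c(1) that qs by (simp add: scan_colour_def guarded_def)
    have q: "fst (controls M ! c) = fst (C t)" using c by (simp add: scan_state_def)
    have rd: "map (\<lambda>a. a mod S) (snd (controls M ! c)) = map read_tape (snd (C t))"
      by (rule nth_equalityI) (use lss len qs ssj read in simp_all)
    have Suc: "C (Suc t) = tm_step M (C t)" by (simp add: C_def run_config_def)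
    have "?ct (Suc t) j i =
      (if i + head_move M c j = 2 * ?T + 1 then write_colour M c j else ?ct t j (i + head_move M c j - 1))"
      if j: "j < k" and i: "0 < i" for j i
    proof -
      let ?a = "snd (control_action M c) ! j" and ?c = "snd (C t) ! j"
      have tp: "snd (C (Suc t)) ! j = ((fst ?c)(snd ?c := fst ?a), snd ?c + shift (snd ?a))"
        unfolding Suc using control_step(2)[OF M good c(1) q rd j] by (simp only: act_tape_eq)
      have mv: "int (head_move M c j) = shift (snd ?a) + 1"
        using c(1) j by (cases "snd ?a") (simp_all add: head_move_def guarded_def)
      show ?thesis
      proof (cases "i + head_move M c j = 2 * ?T + 1")
        case True
        then have "shift (snd ?a) + int i = 2 * int ?T" using mv by linarith
        then have p: "snd ?c + shift (snd ?a) + int i - 2 * int ?T = snd ?c" by linarith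
        have "?ct (Suc t) j i = fst ?a + (if snd ?c = 0 then S else 0)"
          unfolding cell_colour_def Let_def tp fst_conv snd_conv p by simp
        moreover have "write_colour M c j = fst ?a + S * (?ct t j (2 * ?T) div S)"
          using c(1) j qs ssj[OF j] by (simp add: write_colour_def guarded_def)
        moreover have "?ct t j (2 * ?T) div S = of_bool (snd ?c = 0)"
          using dec(2)[OF j, of t "2 * ?T"] by simp
        ultimately show ?thesis using True by simp
      next
        case False
        then have "shift (snd ?a) + int i \<noteq> 2 * int ?T" using mv by linarith
        moreover have "int (i + head_move M c j - 1) = int i + shift (snd ?a)" using i mv by linarith
        ultimately have p: "snd ?c + shift (snd ?a) + int i - 2 * int ?T \<noteq> snd ?c"
          "snd ?c + shift (snd ?a) + int i - 2 * int ?T = snd ?c + int (i + head_move M c j - 1) - 2 * int ?T"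
          by linarith+
        have "?ct (Suc t) j i = ?ct t j (i + head_move M c j - 1)"
          unfolding cell_colour_def Let_def tp fst_conv snd_conv
          using p(1) by (simp only: p(2) fun_upd_apply if_False)
        with False show ?thesis by simp
      qed
    qed
    moreover have "fst (C (Suc t)) = next_state M c"
      unfolding Suc using control_step(1)[OF M good c(1) q rd] c(1) by (simp add: next_state_def)
    ultimately show ?thesis by blast
  qed
  have C0: "C 0 = tm_start M (pair_word x y)" by (simp add: C_def run_config_def)
  have init: "?ct 0 j i = (if j = 0 \<and> first_free x \<le> i \<and> i < first_free x + length y
      then bt (i - first_free x) + 1 else start_colour x j i)" if j: "j < k" for j i
  proof (cases "j = 0 \<and> 2 * ?T \<le> i")
    case False
    have "snd (C 0) ! j = word_tape (if j = 0 then pair_word x y else [])"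
      unfolding C0 tm_start_def using j by (cases j) simp_all
    moreover have "fst (word_tape (pair_word x y)) (int i - 2 * int ?T) = 0" if "i < 2 * ?T"
      using that by (simp add: word_tape_def)
    moreover have "fst (word_tape []) z = 0" for z by (simp add: word_tape_def)
    ultimately show ?thesis
      using False by (auto simp: cell_colour_def Let_def start_colour_def first_free_def)
  next
    case True
    define p where "p = i - 2 * ?T"
    have i: "i = 2 * ?T + p" using True by (simp add: p_def)
    have "snd (C 0) ! j = word_tape (pair_word x y)" using True by (simp add: C0 tm_start_def)
    then have c: "?ct 0 j i = (if p < length (pair_word x y) then bit_symbol (pair_word x y ! p) else 0) + (if p = 0 then S else 0)"
      by (simp add: cell_colour_def Let_def i)
    show ?thesis
    proof (cases "2 * length x + 1 \<le> p")
      case True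
      define r where "r = p - (2 * length x + 1)"
      have "p = 2 * length x + 1 + r" using True by (simp add: r_def)
      then show ?thesis
        using \<open>j = 0 \<and> 2 * ?T \<le> i\<close> c bt[of r]
        by (simp add: i first_free_def nth_pair_word start_colour_def start_symbol_def bit_symbol_def)
    next
      case False
      then show ?thesis
        using \<open>j = 0 \<and> 2 * ?T \<le> i\<close> c
        by (auto simp: i first_free_def nth_pair_word start_colour_def start_symbol_def bit_symbol_def bit_at_def
            even_iff_mod_2_eq_zero)
    qed
  qed
  have "fst (C t) < colour_bound M" for t using st[of t] by (simp add: colour_bound_def)
  moreover have "fst (C 0) = 0" by (simp add: C0 tm_start_def)
  ultimately show ?thesis
    unfolding tableau.run_def[OF tableau] using dec(3) init exc step by blast
qed

text \<open>Absolute cell \<open>0\<close> is at \<open>2 * T\<close> minus the head position, and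
  this lies between \<open>T\<close> and \<open>3 * T\<close>, in the final window, as the head has
  moved at most \<open>T\<close> cells.\<close>

lemma accepting_iff:
  fixes x w
  defines "C \<equiv> run_config M w (horizon x)"
  shows "tableau.accepting k S (horizon x) (\<lambda>t. cell_colour M (horizon x) (run_config M w t)) \<longleftrightarrow> fst (snd C ! 1) 0 = 2"
proof -
  let ?T = "horizon x"
  have good: "good_config M ?T C" unfolding C_def by (rule good_config_run[OF M])
  have k1: "1 < k" using k2 by simp
  have h: "\<bar>snd (snd C ! 1)\<bar> \<le> int ?T" and sym: "\<And>z. fst (snd C ! 1) z < S"
    using good k1 by (simp_all add: good_config_def)
  define i where "i = nat (2 * int ?T - snd (snd C ! 1))"
  have i: "int i = 2 * int ?T - snd (snd C ! 1)" using h by (simp add: i_def)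
  have w: "tableau.win ?T ?T i" unfolding tableau.win_def[OF tableau] using i h by linarith
  have col: "cell_colour M ?T C 1 l = fst (snd C ! 1) (snd (snd C ! 1) + int l - 2 * int ?T) + (if l = i then S else 0)" for l
    unfolding cell_colour_def Let_def using i by auto
  have "S \<le> cell_colour M ?T C 1 l \<longleftrightarrow> l = i" for l
    unfolding col using sym[of "snd (snd C ! 1) + int l - 2 * int ?T"] by auto
  moreover have "cell_colour M ?T C 1 i = S + fst (snd C ! 1) 0"
    unfolding col using i by simp
  ultimately show ?thesis
    unfolding tableau.accepting_def[OF tableau] C_def[symmetric] using w k1 by auto
qed

end

lemma definable_guarded:
  assumes "definable a" "definable b" shows "definable (\<lambda>x e. guarded M f (a x e) (b x e))"
  unfolding guarded_def
  by (rule definable_cases[OF assms(1)], rule definable_lookup[OF assms(2)])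

context reduction begin

interpretation tab: tableau k S "horizon x" "first_free x" "free x" "length (controls M)" "colour_bound M"
    "start_colour x" "scan_state M" "next_state M" "scan_colour M" "write_colour M" "head_move M" for x
  by (rule tableau)

lemma definable_free: "definable (\<lambda>x e. free x)"
  unfolding free_def by (intro definable_poly definable_length)

lemma definable_horizon: "definable (\<lambda>x e. horizon x)"
  unfolding horizon_def by (intro definable_add definable_poly definable_mult definable_length definable_const definable_free)

lemma definable_first_free: "definable (\<lambda>x e. first_free x)"
  unfolding first_free_def by (intro definable_intros definable_horizon)

lemma definable_start_colour:
  "definable a \<Longrightarrow> definable b \<Longrightarrow> definable (\<lambda>x e. start_colour x (a x e) (b x e))"
  unfolding start_colour_def start_symbol_def by (intro definable_intros definable_horizon; assumption)

lemma definable_control: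
  assumes "definable a"
  shows "definable (\<lambda>x e. scan_state M (a x e))" "definable (\<lambda>x e. next_state M (a x e))"
    "definable b \<Longrightarrow> definable (\<lambda>x e. scan_colour M (a x e) (b x e))"
    "definable b \<Longrightarrow> definable (\<lambda>x e. write_colour M (a x e) (b x e))"
    "definable b \<Longrightarrow> definable (\<lambda>x e. head_move M (a x e) (b x e))"
  unfolding scan_state_def next_state_def scan_colour_def write_colour_def head_move_def
  by (rule definable_lookup[OF assms] definable_guarded[OF assms]; assumption?)+

lemma definable_role:
  assumes "definable ek" "definable et" "definable ej" "definable ei" "definable ea" "definable ed"
    "definable \<kappa>" "definable t" "definable j" "definable i"
  shows "definable (\<lambda>x e. tab.role x (ek x e, et x e, ej x e, ei x e, ea x e, ed x e) (\<kappa> x e, t x e, j x e, i x e))"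
  unfolding tab.role_eq producer_def consumer_def tab.valid_def tab.win_def
  by (intro definable_intros definable_free definable_horizon definable_first_free definable_start_colour
    definable_control assms)

lemma decidable_incident:
  assumes "definable a" "definable b"
  shows "decidable (\<lambda>x e. tab.incident x (a x e) (b x e))"
  unfolding tab.incident_def tab.edge_of_def tab.slot_of_def Let_def covers_def producer_def consumer_def
  by (intro definable_role definable_intros definable_horizon assms)

definition instance_word :: "bool list \<Rightarrow> bool list" where
  "instance_word x = matrix_word (tab.vertex_number x + 2) (tab.edge_number x + 2)
     (add_centre (tab.vertex_number x) (tab.edge_number x) (tab.incident x))"

lemma polytime_instance_word: "polytime_computable_on UNIV instance_word"
proof -
  have v: "definable (\<lambda>x e. tab.vertex_number x)" "definable (\<lambda>x e. tab.edge_number x)"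
    unfolding tab.vertex_number_def tab.edge_number_def by (intro definable_intros definable_horizon)+
  have "decidable (\<lambda>x e. matrix_bit (tab.vertex_number x + 2) (tab.edge_number x + 2)
     (add_centre (tab.vertex_number x) (tab.edge_number x) (tab.incident x)) (e 0))"
    unfolding add_centre_def[abs_def]
    by (intro decidable_matrix_bit definable_intros v decidable_incident)
  then show ?thesis
    unfolding instance_word_def matrix_word_eq
    by (rule polytime_definable) (intro definable_intros v)
qed

lemma instance_word_alpha_acyclic: "instance_word x \<in> hypergraph_words alpha_acyclic"
  unfolding instance_word_def matrix_word_mem_hypergraph_words by (rule alpha_acyclic_add_centre)

lemma instance_word_exact_cover: "instance_word x \<in> EXACT_COVER \<longleftrightarrow> (\<exists>I. tab.slot_cover x I)"
  unfolding instance_word_def EXACT_COVER_def matrix_word_mem_hypergraph_words has_exact_cover_add_centre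
  by (rule tab.has_exact_cover_iff_slot_cover)

text \<open>Soundness yields bits on which every run accepts, and the computation on the word
  \<open>y\<close> made of these bits is such a run. Conversely, an accepting computation on a given
  \<open>y\<close> yields a cover by completeness.\<close>

lemma slot_cover_iff:
  "(\<exists>I. tab.slot_cover x I) \<longleftrightarrow>
   (\<exists>y. length y \<le> free x \<and> fst (snd (run_config M (pair_word x y) (horizon x)) ! 1) 0 = 2)"
proof
  assume "\<exists>I. tab.slot_cover x I"
  then obtain I where "tab.slot_cover x I" ..
  from tab.cover_sound[OF this] obtain l bt where l: "l \<le> free x" and bt: "\<forall>r. bt r < 2"
    and acc: "\<forall>st ct. tab.run x l bt st ct \<longrightarrow> tab.accepting x ct" by metis
  define y where "y = map (\<lambda>r. bt r = 1) [0..<l]"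
  have y: "length y = l" by (simp add: y_def)
  have "bt r = of_bool (y ! r)" if "r < length y" for r
    using that bt[rule_format, of r] by (auto simp: y_def less_2_cases_iff)
  from run_config_run[OF _ this] l y
  have "tab.run x l bt (\<lambda>t. fst (run_config M (pair_word x y) t)) (\<lambda>t. cell_colour M (horizon x) (run_config M (pair_word x y) t))"
    by simp
  with acc have "tab.accepting x (\<lambda>t. cell_colour M (horizon x) (run_config M (pair_word x y) t))" by simp
  then have "fst (snd (run_config M (pair_word x y) (horizon x)) ! 1) 0 = 2" unfolding accepting_iff .
  with l y show "\<exists>y. length y \<le> free x \<and> fst (snd (run_config M (pair_word x y) (horizon x)) ! 1) 0 = 2" by blast
next
  assume "\<exists>y. length y \<le> free x \<and> fst (snd (run_config M (pair_word x y) (horizon x)) ! 1) 0 = 2"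
  then obtain y where y: "length y \<le> free x" and a: "fst (snd (run_config M (pair_word x y) (horizon x)) ! 1) 0 = 2"
    by blast
  have "tab.run x (length y) (\<lambda>r. of_bool (bit_at y r)) (\<lambda>t. fst (run_config M (pair_word x y) t))
    (\<lambda>t. cell_colour M (horizon x) (run_config M (pair_word x y) t))"
    by (rule run_config_run[OF y]) (simp add: bit_at_def)
  moreover have "tab.accepting x (\<lambda>t. cell_colour M (horizon x) (run_config M (pair_word x y) t))"
    unfolding accepting_iff by (rule a)
  ultimately show "\<exists>I. tab.slot_cover x I"
    by (intro tab.cover_complete[OF y]) simp_all
qed

text \<open>The horizon is at least the halting time and a halted configuration persists, so the
  output cell at the horizon shows the verdict.\<close>

lemma instance_word_correct:
  assumes R: "\<And>w. \<exists>t\<le>poly pM (length w). halted_with_output M (run_config M w t) [w \<in> R]"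
  shows "instance_word x \<in> EXACT_COVER \<longleftrightarrow> (\<exists>y. length y \<le> poly pp (length x) \<and> pair_word x y \<in> R)"
proof -
  have "fst (snd (run_config M (pair_word x y) (horizon x)) ! 1) 0 = 2 \<longleftrightarrow> pair_word x y \<in> R"
    if y: "length y \<le> free x" for y
  proof -
    let ?w = "pair_word x y"
    obtain t where t: "t \<le> poly pM (length ?w)" and h: "halted_with_output M (run_config M ?w t) [?w \<in> R]"
      using R by blast
    have "poly pM (length ?w) \<le> poly pM (2 * length x + 1 + free x)"
      by (rule monoD[OF poly_nat_mono]) (use y in simp)
    with t have "t \<le> horizon x" by (simp add: horizon_def)
    moreover have "fst (run_config M ?w t) = state_count M" using h by (simp add: halted_with_output_def)
    ultimately have "run_config M ?w (horizon x) = run_config M ?w t" by (intro run_config_halted)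
    moreover have "fst (snd (run_config M ?w t) ! 1) 0 = bit_symbol (?w \<in> R)"
      using h by (simp add: halted_with_output_def)
    ultimately show ?thesis by (simp add: bit_symbol_def)
  qed
  then show ?thesis
    unfolding instance_word_exact_cover slot_cover_iff free_def[symmetric] by (meson)
qed

end

lemma NP_hard:
  assumes "A \<in> NP"
  shows "\<exists>f. polytime_computable_on UNIV f \<and>
    (\<forall>x. f x \<in> hypergraph_words alpha_acyclic \<and> (x \<in> A \<longleftrightarrow> f x \<in> EXACT_COVER))"
proof -
  obtain R and pp :: "nat poly" where R: "polytime_decidable_on UNIV R"
    and A: "\<And>x. x \<in> A \<longleftrightarrow> (\<exists>y. length y \<le> poly pp (length x) \<and> pair_word x y \<in> R)"
    using assms by (auto simp: NP_def)
  obtain M and pM :: "nat poly" where M: "is_turing_machine M"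
    and h: "\<And>w. \<exists>t\<le>poly pM (length w). halted_with_output M (run_config M w t) [w \<in> R]"
    using R unfolding polytime_decidable_on_def polytime_computable_on_def run_config_def by blast
  interpret reduction M pM pp by unfold_locales (rule M)
  show ?thesis
    using polytime_instance_word instance_word_alpha_acyclic instance_word_correct[of R, OF h] A by blast
qed

theorem theorem9:
  shows "NP_complete_on (hypergraph_words alpha_acyclic) EXACT_COVER \<and>
         polytime_decidable_on (hypergraph_words hypertree) EXACT_COVER"
  using alpha_acyclic_exact_cover_in_NP NP_hard hypertree_exact_cover_polytime
  by (simp add: NP_complete_on_def)

end
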